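(* For an orthoalgebra $A$, the poset $\mathrm{BSub}(A)^*$ of Boolean subalgebras of $A$ of height $3$ or less can be reconstructed from the hypergraph $\mathcal{G}(A)$: it is isomorphic to the poset $Y$ consisting of a bottom element $\bot$ together with the points, lines and planes of $\mathcal{G}(A)$, ordered by containment of their sets of points (each point being identified with the corresponding singleton and $\bot$ with the empty set). Thus, if $A$ is proper, then up to isomorphism $A$ can be reconstructed from $\mathcal{G}(A)$ as the orthoalgebra of directions of $\mathrm{BSub}(A)^*$, i.e. $A\simeq\mathrm{Dir}(\mathrm{BSub}(A)^* )\simeq\mathrm{Dir}(Y)$.
   Context: **Orthoalgebras.** An orthoalgebra is a set $A$ with a partial binary operation $\oplus$ (write $a\perp b$ when $a\oplus b$ is defined), a unary operation $'$ and constants $0,1$ such that: (1) $\oplus$ is commutative and associative in the usual sense for partial operations (if one side is defined so is the other and they are equal); (2) $a'$ is the unique element with $a\oplus a'$ defined and equal to $1$; (3) $a\oplus a$ is defined iff $a=0$. It is Boolean if it arises from a Boolean algebra by restricting the join to pairs of orthogonal elements. A morphism $f\colon A\to C$ preserves $'$ and satisfies: if $a\oplus b$ is defined then so is $f(a)\oplus f(b)$, and $f(a\oplus b)=f(a)\oplus f(b)$; an isomorphism is a morphism with an inverse morphism. A subalgebra is a subset containing $0,1$, closed under $'$ and under $\oplus$ (when defined); a Boolean subalgebra is a subalgebra that is a Boolean orthoalgebra. $\mathrm{BSub}(A)$ is the set of Boolean subalgebras ordered by inclusion, and $\mathrm{BSub}(A)^*$ is its sub-poset of elements of height at most $3$ (the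 least element $\{0,1\}$ has height $0$). A block is a maximal Boolean subalgebra; it is small if it has at most $4$ elements. $A$ is proper if it has no small blocks. **The hypergraph $\mathcal{G}(A)$.** Its points are the atoms of $\mathrm{BSub}(A)$; its lines are the sets of three points that are the atoms below an element of height $2$ of $\mathrm{BSub}(A)$; its planes are the sets of seven points that are the atoms below an element of height $3$. **Boolean domains.** $\mathrm{Sub}(B)$ is the lattice of Boolean subalgebras of a Boolean algebra $B$, ordered by inclusion. A Boolean domain is a lattice isomorphic to $\mathrm{Sub}(B)$ for some Boolean algebra $B$ (by a theorem of Grätzer et al., equivalently an algebraic lattice in which, for each compact $x$, $\downarrow x$ is isomorphic to the lattice of partitions of a finite set, finer partitions being larger). Its least and largest elements are $\bot,\top$. In a poset with least element, an element is basic if it is an atom or the least element. An element $x$ of a lattice is dual modular if $(x\vee y)\wedge z=x\vee(y\wedge z)$ for all $y$ and all $z\ge x$, and $(w\vee x)\wedge y=w\vee(x\wedge y)$ for all $w\le y$. A principal pair of a Boolean domain is an ordered pair $(y,z)$ of dual modular elements such that (1) $y=\top$ and $z$ is basic, or (2) $z=\top$ and $y$ is basic, or (3) $y\vee z=\top$ and $y\wedge z$ is a basic element that is not dual modular. It is a principal pair for the basic element $x$ if $y\wedge z=x$. **Orthodomains and directions.** $x\lessdot z$ means $z$ covers $x$. An orthodomain is a poset $X$ with least element $\bot$ such that: (1) every directed subset has a join; (2) $X$ is atomistic and its atoms are compact; (3) each $\downarrow x$ is a Boolean domain; (4) if $x,y$ are distinct atoms and $x,y\lessdot w$, then $x\vee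 y=w$. (For an orthoalgebra $A$, $\mathrm{BSub}(A)^*$ is an orthodomain.) A direction for a basic element $x$ of $X$ is a map $d\colon\uparrow x\to X^2$ such that for all $y,z\in\uparrow x$: (1) $d(y)$ is a principal pair for $x$ in the Boolean domain $\downarrow y$; (2) if $y\le z$ and $d(z)=(v,w)$ then $d(y)=(y\wedge v,y\wedge w)$; (3) if $x\lessdot y,z$ and $d(y)=(x,y)$, $d(z)=(z,x)$, then $y\vee z$ exists and $y,z\lessdot y\vee z$. $\mathrm{Dir}(X)$ is the set of all directions for basic elements of $X$. $X$ is proper if no maximal element is basic; $X$ has enough directions if it is proper and each basic element has a direction (it then has exactly two). If $A$ is proper, $\mathrm{BSub}(A)^*$ has enough directions. **Operations on $\mathrm{Dir}(X)$** (for $X$ an orthodomain with enough directions). If $d$ is a direction for $x$, then $d'$ is the direction for $x$ with $d'(w)=(z,y)$ when $d(w)=(y,z)$. $0$ and $1$ are the directions for $\bot$ given by $0(w)=(\bot,w)$, $1(w)=(w,\bot)$. Two atoms $x,y$ are near if they are distinct and their join exists and covers both; then there is exactly one further atom below $x\vee y$. The partial operation $\oplus$ is defined exactly in these cases: $d\oplus 0=d=0\oplus d$; $d\oplus d'=1$; and if $d$ is a direction for $x$, $e$ a direction for $y$, with $x,y$ near, $w=x\vee y$, $z$ the third atom below $w$, and $d(w)=(x,w)$, $e(w)=(y,w)$, then $d\oplus e$ is the direction for $z$ with $(d\oplus e)(w)=(w,z)$. *)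

theory Defs
  imports "HOL-Algebra.Lattice" "HOL-Library.Extended_Nat"
begin

section \<open>Posets\<close>

text \<open>
  Posets are \<^typ>\<open>'a gorder\<close> records whose equality is \<open>(=)\<close>.
\<close>

definition order_isomorphic :: "'a gorder \<Rightarrow> 'b gorder \<Rightarrow> bool" where
  "order_isomorphic X Y \<longleftrightarrow>
     (\<exists>f. order_emb X Y f \<and> bij_betw f (carrier X) (carrier Y))"

definition inclusion_order :: "'a set set \<Rightarrow> 'a set gorder" where
  "inclusion_order S = \<lparr>carrier = S, eq = (=), le = (\<subseteq>)\<rparr>"

definition down :: "'a gorder \<Rightarrow> 'a \<Rightarrow> 'a gorder" where
  "down X x = X\<lparr>carrier := {y \<in> carrier X. y \<sqsubseteq>\<^bsub>X\<^esub> x}\<rparr>"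

definition up_set :: "'a gorder \<Rightarrow> 'a \<Rightarrow> 'a set" where
  "up_set X x = {y \<in> carrier X. x \<sqsubseteq>\<^bsub>X\<^esub> y}"

definition covered_by :: "'a gorder \<Rightarrow> 'a \<Rightarrow> 'a \<Rightarrow> bool" where
  "covered_by X x z \<longleftrightarrow> x \<in> carrier X \<and> z \<in> carrier X \<and> x \<sqsubset>\<^bsub>X\<^esub> z \<and>
     \<not> (\<exists>y\<in>carrier X. x \<sqsubset>\<^bsub>X\<^esub> y \<and> y \<sqsubset>\<^bsub>X\<^esub> z)"

definition is_atom :: "'a gorder \<Rightarrow> 'a \<Rightarrow> bool" where
  "is_atom X x \<longleftrightarrow> covered_by X \<bottom>\<^bsub>X\<^esub> x"

definition basic :: "'a gorder \<Rightarrow> 'a \<Rightarrow> bool" where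
  "basic X x \<longleftrightarrow> is_atom X x \<or> x = \<bottom>\<^bsub>X\<^esub>"

text \<open>
  The height of \<open>x\<close> is the supremum of the lengths of the finite chains below \<open>x\<close>, a chain
  with \<open>n + 1\<close> elements having length \<open>n\<close>.
\<close>

definition height :: "'a gorder \<Rightarrow> 'a \<Rightarrow> enat" where
  "height X x =
     (SUP C \<in> {C. C \<subseteq> carrier (down X x) \<and> finite C \<and> (\<forall>a\<in>C. \<forall>b\<in>C. a \<sqsubseteq>\<^bsub>X\<^esub> b \<or> b \<sqsubseteq>\<^bsub>X\<^esub> a)}.
        enat (card C - 1))"

section \<open>Orthoalgebras\<close>

text \<open>
  A value \<open>None\<close> of the operation means that the sum is undefined; fields are irrelevant at
  arguments outside the carrier.
\<close>

record 'a orthoalg = "'a partial_object" +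
  osum :: "'a \<Rightarrow> 'a \<Rightarrow> 'a option" (infixl \<open>\<oplus>\<index>\<close> 65)
  ocompl :: "'a \<Rightarrow> 'a"
  ozero :: 'a
  oone :: 'a

locale orthoalgebra =
  fixes A :: "'a orthoalg" (structure)
  assumes osum_closed:
      "\<lbrakk>a \<in> carrier A; b \<in> carrier A; a \<oplus> b = Some c\<rbrakk> \<Longrightarrow> c \<in> carrier A"
    and ocompl_closed: "a \<in> carrier A \<Longrightarrow> ocompl A a \<in> carrier A"
    and ozero_closed: "ozero A \<in> carrier A"
    and oone_closed: "oone A \<in> carrier A"
    and osum_comm: "\<lbrakk>a \<in> carrier A; b \<in> carrier A\<rbrakk> \<Longrightarrow> a \<oplus> b = b \<oplus> a"
    and osum_assoc:
      "\<lbrakk>a \<in> carrier A; b \<in> carrier A; c \<in> carrier A\<rbrakk> \<Longrightarrow>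
         Option.bind (a \<oplus> b) (\<lambda>s. s \<oplus> c) = Option.bind (b \<oplus> c) (\<lambda>s. a \<oplus> s)"
    and osum_ocompl: "a \<in> carrier A \<Longrightarrow> a \<oplus> ocompl A a = Some (oone A)"
    and ocompl_unique:
      "\<lbrakk>a \<in> carrier A; b \<in> carrier A; a \<oplus> b = Some (oone A)\<rbrakk> \<Longrightarrow> b = ocompl A a"
    and osum_self: "a \<in> carrier A \<Longrightarrow> a \<oplus> a \<noteq> None \<longleftrightarrow> a = ozero A"

definition ortho_morphism :: "'a orthoalg \<Rightarrow> 'b orthoalg \<Rightarrow> ('a \<Rightarrow> 'b) \<Rightarrow> bool" where
  "ortho_morphism A C f \<longleftrightarrow>
     f \<in> carrier A \<rightarrow> carrier C \<and>
     (\<forall>a\<in>carrier A. f (ocompl A a) = ocompl C (f a)) \<and>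
     (\<forall>a\<in>carrier A. \<forall>b\<in>carrier A. \<forall>c. a \<oplus>\<^bsub>A\<^esub> b = Some c \<longrightarrow> f a \<oplus>\<^bsub>C\<^esub> f b = Some (f c))"

definition ortho_isomorphic :: "'a orthoalg \<Rightarrow> 'b orthoalg \<Rightarrow> bool" where
  "ortho_isomorphic A C \<longleftrightarrow>
     (\<exists>f g. ortho_morphism A C f \<and> ortho_morphism C A g \<and>
        (\<forall>a\<in>carrier A. g (f a) = a) \<and> (\<forall>c\<in>carrier C. f (g c) = c))"

locale boolean_lattice = bounded_lattice L for L (structure) +
  assumes meet_join_distrib:
      "\<lbrakk>x \<in> carrier L; y \<in> carrier L; z \<in> carrier L\<rbrakk> \<Longrightarrow>
         x \<sqinter> (y \<squnion> z) = (x \<sqinter> y) \<squnion> (x \<sqinter> z)"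
    and complement_exists:
      "x \<in> carrier L \<Longrightarrow> \<exists>y\<in>carrier L. x \<sqinter> y = \<bottom> \<and> x \<squnion> y = \<top>"

definition boolean_orthoalgebra :: "'a orthoalg \<Rightarrow> bool" where
  "boolean_orthoalgebra C \<longleftrightarrow> orthoalgebra C \<and>
     (\<exists>L :: 'a gorder. boolean_lattice L \<and> carrier L = carrier C \<and>
        ozero C = \<bottom>\<^bsub>L\<^esub> \<and> oone C = \<top>\<^bsub>L\<^esub> \<and>
        (\<forall>a\<in>carrier C. a \<sqinter>\<^bsub>L\<^esub> ocompl C a = \<bottom>\<^bsub>L\<^esub> \<and> a \<squnion>\<^bsub>L\<^esub> ocompl C a = \<top>\<^bsub>L\<^esub>) \<and>
        (\<forall>a\<in>carrier C. \<forall>b\<in>carrier C.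
           a \<oplus>\<^bsub>C\<^esub> b = (if a \<sqinter>\<^bsub>L\<^esub> b = \<bottom>\<^bsub>L\<^esub> then Some (a \<squnion>\<^bsub>L\<^esub> b) else None)))"

definition ortho_subalgebra :: "'a orthoalg \<Rightarrow> 'a set \<Rightarrow> bool" where
  "ortho_subalgebra A S \<longleftrightarrow> S \<subseteq> carrier A \<and> ozero A \<in> S \<and> oone A \<in> S \<and>
     (\<forall>a\<in>S. ocompl A a \<in> S) \<and>
     (\<forall>a\<in>S. \<forall>b\<in>S. \<forall>c. a \<oplus>\<^bsub>A\<^esub> b = Some c \<longrightarrow> c \<in> S)"

definition boolean_subalgebra :: "'a orthoalg \<Rightarrow> 'a set \<Rightarrow> bool" where
  "boolean_subalgebra A S \<longleftrightarrow>
     ortho_subalgebra A S \<and> boolean_orthoalgebra (A\<lparr>carrier := S\<rparr>)"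

definition BSub :: "'a orthoalg \<Rightarrow> 'a set gorder" where
  "BSub A = inclusion_order {S. boolean_subalgebra A S}"

definition BSub_star :: "'a orthoalg \<Rightarrow> 'a set gorder" where
  "BSub_star A = inclusion_order {S \<in> carrier (BSub A). height (BSub A) S \<le> 3}"

definition block :: "'a orthoalg \<Rightarrow> 'a set \<Rightarrow> bool" where
  "block A S \<longleftrightarrow> boolean_subalgebra A S \<and>
     (\<forall>T. boolean_subalgebra A T \<and> S \<subseteq> T \<longrightarrow> T = S)"

definition small :: "'a set \<Rightarrow> bool" where
  "small S \<longleftrightarrow> finite S \<and> card S \<le> 4"

definition proper :: "'a orthoalg \<Rightarrow> bool" where
  "proper A \<longleftrightarrow> \<not> (\<exists>S. block A S \<and> small S)"

section \<open>The hypergraph of an orthoalgebra\<close>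

record 'p hypergraph =
  points :: "'p set"
  hlines :: "'p set set"
  hplanes :: "'p set set"

definition atoms_below :: "'a gorder \<Rightarrow> 'a \<Rightarrow> 'a set" where
  "atoms_below X x = {p. is_atom X p \<and> p \<sqsubseteq>\<^bsub>X\<^esub> x}"

definition hypergraph_of :: "'a orthoalg \<Rightarrow> 'a set hypergraph" where
  "hypergraph_of A =
     \<lparr>points = {p. is_atom (BSub A) p},
      hlines = {l. card l = 3 \<and>
        (\<exists>x\<in>carrier (BSub A). height (BSub A) x = 2 \<and> l = atoms_below (BSub A) x)},
      hplanes = {l. card l = 7 \<and>
        (\<exists>x\<in>carrier (BSub A). height (BSub A) x = 3 \<and> l = atoms_below (BSub A) x)}\<rparr>"

definition hypergraph_poset :: "'p hypergraph \<Rightarrow> 'p set gorder" where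
  "hypergraph_poset G =
     inclusion_order ({{}} \<union> (\<lambda>p. {p}) ` points G \<union> hlines G \<union> hplanes G)"

section \<open>Directions\<close>

definition dual_modular :: "'a gorder \<Rightarrow> 'a \<Rightarrow> bool" where
  "dual_modular L x \<longleftrightarrow> x \<in> carrier L \<and>
     (\<forall>y\<in>carrier L. \<forall>z\<in>carrier L. x \<sqsubseteq>\<^bsub>L\<^esub> z \<longrightarrow>
        (x \<squnion>\<^bsub>L\<^esub> y) \<sqinter>\<^bsub>L\<^esub> z = x \<squnion>\<^bsub>L\<^esub> (y \<sqinter>\<^bsub>L\<^esub> z)) \<and>
     (\<forall>w\<in>carrier L. \<forall>y\<in>carrier L. w \<sqsubseteq>\<^bsub>L\<^esub> y \<longrightarrow>
        (w \<squnion>\<^bsub>L\<^esub> x) \<sqinter>\<^bsub>L\<^esub> y = w \<squnion>\<^bsub>L\<^esub> (x \<sqinter>\<^bsub>L\<^esub> y))"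

text \<open>
  The notions below are meant for an orthodomain \<open>X\<close>, in which every \<open>down X y\<close> is a Boolean
  domain; the formulas themselves use only that \<open>down X y\<close> is a bounded lattice. The
  operations on directions further presuppose that \<open>X\<close> has enough directions, as is the
  case for \<open>BSub_star A\<close> with \<open>A\<close> proper.
\<close>

definition principal_pair :: "'a gorder \<Rightarrow> 'a \<times> 'a \<Rightarrow> bool" where
  "principal_pair L = (\<lambda>(y, z). dual_modular L y \<and> dual_modular L z \<and>
     (y = \<top>\<^bsub>L\<^esub> \<and> basic L z \<or>
      z = \<top>\<^bsub>L\<^esub> \<and> basic L y \<or>
      y \<squnion>\<^bsub>L\<^esub> z = \<top>\<^bsub>L\<^esub> \<and> basic L (y \<sqinter>\<^bsub>L\<^esub> z) \<and> \<not> dual_modular L (y \<sqinter>\<^bsub>L\<^esub> z)))"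

definition principal_pair_for :: "'a gorder \<Rightarrow> 'a \<Rightarrow> 'a \<times> 'a \<Rightarrow> bool" where
  "principal_pair_for L x p \<longleftrightarrow> principal_pair L p \<and> fst p \<sqinter>\<^bsub>L\<^esub> snd p = x"

text \<open>
  A direction for \<open>x\<close> is a map with domain exactly \<open>up_set X x\<close>, so that directions for
  different elements are different maps.
\<close>

definition direction :: "'a gorder \<Rightarrow> 'a \<Rightarrow> ('a \<rightharpoonup> 'a \<times> 'a) \<Rightarrow> bool" where
  "direction X x d \<longleftrightarrow>
     x \<in> carrier X \<and> basic X x \<and> dom d = up_set X x \<and>
     (\<forall>y\<in>up_set X x. principal_pair_for (down X y) x (the (d y))) \<and>
     (\<forall>y\<in>up_set X x. \<forall>z\<in>up_set X x. \<forall>v w.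
        y \<sqsubseteq>\<^bsub>X\<^esub> z \<and> d z = Some (v, w) \<longrightarrow> d y = Some (y \<sqinter>\<^bsub>X\<^esub> v, y \<sqinter>\<^bsub>X\<^esub> w)) \<and>
     (\<forall>y z. covered_by X x y \<and> covered_by X x z \<and> d y = Some (x, y) \<and> d z = Some (z, x) \<longrightarrow>
        (\<exists>j. is_lub X j {y, z} \<and> covered_by X y j \<and> covered_by X z j))"

definition directions :: "'a gorder \<Rightarrow> ('a \<rightharpoonup> 'a \<times> 'a) set" where
  "directions X = {d. \<exists>x. direction X x d}"

definition dir_compl :: "('a \<rightharpoonup> 'a \<times> 'a) \<Rightarrow> ('a \<rightharpoonup> 'a \<times> 'a)" where
  "dir_compl d = (\<lambda>w. map_option prod.swap (d w))"

definition dir_zero :: "'a gorder \<Rightarrow> ('a \<rightharpoonup> 'a \<times> 'a)" where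
  "dir_zero X = (\<lambda>w. if w \<in> carrier X then Some (\<bottom>\<^bsub>X\<^esub>, w) else None)"

definition dir_one :: "'a gorder \<Rightarrow> ('a \<rightharpoonup> 'a \<times> 'a)" where
  "dir_one X = (\<lambda>w. if w \<in> carrier X then Some (w, \<bottom>\<^bsub>X\<^esub>) else None)"

text \<open>
  \<open>near_via X x y w z\<close>: the atoms \<open>x\<close> and \<open>y\<close> are near, \<open>w\<close> is their join, and \<open>z\<close> is the
  third atom below \<open>w\<close>.
\<close>

definition near_via :: "'a gorder \<Rightarrow> 'a \<Rightarrow> 'a \<Rightarrow> 'a \<Rightarrow> 'a \<Rightarrow> bool" where
  "near_via X x y w z \<longleftrightarrow> is_atom X x \<and> is_atom X y \<and> x \<noteq> y \<and>
     is_lub X w {x, y} \<and> covered_by X x w \<and> covered_by X y w \<and>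
     is_atom X z \<and> z \<sqsubseteq>\<^bsub>X\<^esub> w \<and> z \<noteq> x \<and> z \<noteq> y"

definition dir_summable :: "'a gorder \<Rightarrow> ('a \<rightharpoonup> 'a \<times> 'a) \<Rightarrow> ('a \<rightharpoonup> 'a \<times> 'a) \<Rightarrow> 'a \<Rightarrow> 'a \<Rightarrow> bool" where
  "dir_summable X d e w z \<longleftrightarrow>
     (\<exists>x y. near_via X x y w z \<and> direction X x d \<and> direction X y e \<and>
        d w = Some (x, w) \<and> e w = Some (y, w))"

definition dir_sum ::
    "'a gorder \<Rightarrow> ('a \<rightharpoonup> 'a \<times> 'a) \<Rightarrow> ('a \<rightharpoonup> 'a \<times> 'a) \<Rightarrow> ('a \<rightharpoonup> 'a \<times> 'a) option" where
  "dir_sum X d e =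
     (if e = dir_zero X then Some d
      else if d = dir_zero X then Some e
      else if e = dir_compl d then Some (dir_one X)
      else if \<exists>w z. dir_summable X d e w z
        then Some (THE f. \<exists>w z. dir_summable X d e w z \<and> direction X z f \<and> f w = Some (w, z))
      else None)"

definition Dir :: "'a gorder \<Rightarrow> ('a \<rightharpoonup> 'a \<times> 'a) orthoalg" where
  "Dir X = \<lparr>carrier = directions X, osum = dir_sum X, ocompl = dir_compl,
            ozero = dir_zero X, oone = dir_one X\<rparr>"

end

theory Submission
  imports Defs
begin

text \<open>
  A Boolean subalgebra is determined by the atoms of the poset below it, because each of its
  elements \<open>a\<close> other than \<open>\<zero>\<close> and \<open>\<one>\<close> lies in the four-element subalgebra of \<open>a\<close>, which is such an
  atom (\<open>atoms_below_subset_iff\<close>). A Boolean subalgebra of height \<open>n - 1\<close> has \<open>n\<close> atoms of its own,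
  hence \<open>2 ^ (n - 1) - 1\<close> atoms of the poset below it, which for heights \<open>2\<close> and \<open>3\<close> gives the
  numbers \<open>3\<close> and \<open>7\<close> of points of a line and of a plane. So sending a subalgebra to the set of
  atoms below it is an isomorphism from \<^const>\<open>BSub_star\<close> onto the poset of the hypergraph.

  The subalgebras of height at most \<open>3\<close> are handled through partitions of \<open>\<one>\<close> into at most four
  nonzero parts, called frames below: the one given by a frame has the lattice of all fields
  of subsets of its set of parts as its down-set. In that lattice the fields of the form
  \<open>{s. s \<subseteq> U \<or> I - U \<subseteq> s}\<close>, consisting of an ideal and the complements of its members, are dual
  modular, and on at most four points the only principal pairs with meet \<open>{{}, U, I - U, I}\<close> are
  the two orderings of the fields of the ideals of \<open>U\<close> and of \<open>I - U\<close>
  (\<open>principal_pair_ideal_fields\<close>, \<open>principal_pair_fields_cases\<close>).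

  Hence an element \<open>a\<close> has the direction \<open>dir_of a\<close> that splits every subalgebra containing \<open>a\<close>
  into its part below \<open>a\<close> and its part below the complement of \<open>a\<close>, and any direction for the atom
  of \<open>a\<close> agrees at each place with this one or with the one of the complement. The third
  condition on directions forces the same choice at all places: two places with different
  choices would yield places of this kind having a join, whose value restricts to both
  (\<open>direction_cases\<close>). That \<open>dir_of a\<close> itself satisfies the third condition is the existence of a
  common refinement of a partition of \<open>a\<close> and a partition of its complement (\<open>join_of_covers\<close>). So
  \<open>dir_of\<close> is onto the directions. Properness makes it injective, as some subalgebra above the one
  of \<open>a\<close> tells \<open>a\<close> from its complement. Finally \<open>a \<oplus> b\<close> is defined for nontrivial and
  noncomplementary \<open>a\<close> and \<open>b\<close> iff they are two of the three parts of a frame, the other one being the complement of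
  \<open>a \<oplus> b\<close>, and this is what the sum of directions expresses (\<open>dir_sum_dir_of\<close>). The orthoalgebra
  structure therefore passes from \<open>A\<close> to the directions of \<^const>\<open>BSub_star\<close>, and from there to
  those of the isomorphic poset of the hypergraph.
\<close>

section \<open>Isomorphic posets have isomorphic sets of directions\<close>

lemma partial_order_inclusion_order: "partial_order (inclusion_order S)"
  by unfold_locales (auto simp: inclusion_order_def)

lemma carrier_inclusion_order [simp]: "carrier (inclusion_order S) = S"
  by (simp add: inclusion_order_def)

lemma le_inclusion_order [simp]: "x \<sqsubseteq>\<^bsub>inclusion_order S\<^esub> y \<longleftrightarrow> x \<subseteq> y"
  by (simp add: inclusion_order_def)

lemma lless_inclusion_order [simp]: "x \<sqsubset>\<^bsub>inclusion_order S\<^esub> y \<longleftrightarrow> x \<subset> y"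
  by (auto simp: inclusion_order_def lless_def)

lemma carrier_down: "carrier (down X x) = {y \<in> carrier X. y \<sqsubseteq>\<^bsub>X\<^esub> x}"
  by (simp add: down_def)

lemma le_down [simp]: "y \<sqsubseteq>\<^bsub>down X x\<^esub> z \<longleftrightarrow> y \<sqsubseteq>\<^bsub>X\<^esub> z"
  by (simp add: down_def)

lemma partial_order_down:
  assumes "partial_order X"
  shows "partial_order (down X x)"
proof -
  interpret partial_order X by fact
  have e: "(.=\<^bsub>X\<^esub>) = (=)" by (rule eq_is_equal)
  show ?thesis
    by unfold_locales
      (auto simp: down_def e dest: le_antisym intro: le_trans)
qed

lemma is_lub_pair:
  fixes X (structure)
  assumes "x \<in> carrier X" "y \<in> carrier X"
  shows "is_lub X j {x, y} \<longleftrightarrow> j \<in> carrier X \<and> x \<sqsubseteq> j \<and> y \<sqsubseteq> j \<and>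
    (\<forall>u\<in>carrier X. x \<sqsubseteq> u \<and> y \<sqsubseteq> u \<longrightarrow> j \<sqsubseteq> u)"
  using assms by (auto simp: least_def Upper_def)

lemma is_glb_pair:
  fixes X (structure)
  assumes "x \<in> carrier X" "y \<in> carrier X"
  shows "is_glb X j {x, y} \<longleftrightarrow> j \<in> carrier X \<and> j \<sqsubseteq> x \<and> j \<sqsubseteq> y \<and>
    (\<forall>u\<in>carrier X. u \<sqsubseteq> x \<and> u \<sqsubseteq> y \<longrightarrow> u \<sqsubseteq> j)"
  using assms by (auto simp: greatest_def Lower_def)

context partial_order
begin

lemma join_eqI: "is_lub L j {x, y} \<Longrightarrow> x \<squnion> y = j"
  unfolding join_def sup_def by (rule some_equality) (auto intro: least_unique)

lemma meet_eqI: "is_glb L j {x, y} \<Longrightarrow> x \<sqinter> y = j"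
  unfolding meet_def inf_def by (rule some_equality) (auto intro: greatest_unique)

lemma bottom_eqI: "\<lbrakk>b \<in> carrier L; \<And>x. x \<in> carrier L \<Longrightarrow> b \<sqsubseteq> x\<rbrakk> \<Longrightarrow> \<bottom> = b"
  unfolding bottom_def by (rule some_equality) (auto simp: least_def)

lemma top_eqI: "\<lbrakk>b \<in> carrier L; \<And>x. x \<in> carrier L \<Longrightarrow> x \<sqsubseteq> b\<rbrakk> \<Longrightarrow> \<top> = b"
  unfolding top_def by (rule some_equality) (auto simp: greatest_def)

end

lemma (in lattice) is_lub_join:
  "\<lbrakk>x \<in> carrier L; y \<in> carrier L\<rbrakk> \<Longrightarrow> is_lub L (x \<squnion> y) {x, y}"
  by (simp add: is_lub_pair join_left join_right join_le)

lemma (in lattice) is_glb_meet: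
  "\<lbrakk>x \<in> carrier L; y \<in> carrier L\<rbrakk> \<Longrightarrow> is_glb L (x \<sqinter> y) {x, y}"
  by (simp add: is_glb_pair meet_left meet_right meet_le)

locale order_iso =
  X: partial_order X + Y: partial_order Y
  for X :: "'a gorder" and Y :: "'b gorder" +
  fixes f :: "'a \<Rightarrow> 'b"
  assumes bij: "bij_betw f (carrier X) (carrier Y)"
    and le_iff: "\<lbrakk>x \<in> carrier X; y \<in> carrier X\<rbrakk> \<Longrightarrow> f x \<sqsubseteq>\<^bsub>Y\<^esub> f y \<longleftrightarrow> x \<sqsubseteq>\<^bsub>X\<^esub> y"
begin

abbreviation g :: "'b \<Rightarrow> 'a" where "g \<equiv> inv_into (carrier X) f"

lemma image: "carrier Y = f ` carrier X"
  using bij by (simp add: bij_betw_def)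

lemma closed: "x \<in> carrier X \<Longrightarrow> f x \<in> carrier Y"
  by (simp add: image)

lemma g_closed: "y \<in> carrier Y \<Longrightarrow> g y \<in> carrier X"
  by (simp add: image inv_into_into)

lemma gf: "x \<in> carrier X \<Longrightarrow> g (f x) = x"
  using bij by (simp add: bij_betw_inv_into_left)

lemma fg: "y \<in> carrier Y \<Longrightarrow> f (g y) = y"
  using bij by (simp add: bij_betw_inv_into_right)

lemma eq_iff: "\<lbrakk>x \<in> carrier X; y \<in> carrier X\<rbrakk> \<Longrightarrow> f x = f y \<longleftrightarrow> x = y"
  using gf by metis

lemma inverse: "order_iso Y X g"
proof unfold_locales
  show "bij_betw g (carrier Y) (carrier X)" using bij by (rule bij_betw_inv_into)
  show "g x \<sqsubseteq>\<^bsub>X\<^esub> g y \<longleftrightarrow> x \<sqsubseteq>\<^bsub>Y\<^esub> y" if "x \<in> carrier Y" "y \<in> carrier Y" for x y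
    using le_iff[of "g x" "g y"] that by (simp add: g_closed fg)
qed

lemma lless_iff:
  "\<lbrakk>x \<in> carrier X; y \<in> carrier X\<rbrakk> \<Longrightarrow> f x \<sqsubset>\<^bsub>Y\<^esub> f y \<longleftrightarrow> x \<sqsubset>\<^bsub>X\<^esub> y"
  by (simp add: X.lless_eq Y.lless_eq le_iff eq_iff)

lemma is_lub: "\<lbrakk>x \<in> carrier X; y \<in> carrier X; is_lub X j {x, y}\<rbrakk> \<Longrightarrow> is_lub Y (f j) {f x, f y}"
  by (auto simp: is_lub_pair image le_iff)

lemma is_glb: "\<lbrakk>x \<in> carrier X; y \<in> carrier X; is_glb X j {x, y}\<rbrakk> \<Longrightarrow> is_glb Y (f j) {f x, f y}"
  by (auto simp: is_glb_pair image le_iff)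

lemma covered_by:
  "covered_by X x y \<Longrightarrow> covered_by Y (f x) (f y)"
  by (auto simp: covered_by_def image lless_iff)

lemma up_set: "x \<in> carrier X \<Longrightarrow> up_set Y (f x) = f ` up_set X x"
  by (auto simp: up_set_def image le_iff)

lemma down: "x \<in> carrier X \<Longrightarrow> order_iso (down X x) (down Y (f x)) f"
proof -
  assume x: "x \<in> carrier X"
  interpret dX: partial_order "down X x" by (intro partial_order_down) unfold_locales
  interpret dY: partial_order "down Y (f x)" by (intro partial_order_down) unfold_locales
  show ?thesis
  proof unfold_locales
    show "bij_betw f (carrier (down X x)) (carrier (down Y (f x)))"
      using x bij unfolding bij_betw_def inj_on_def
      by (auto simp: carrier_down le_iff image)
  qed (auto simp: carrier_down le_iff)
qed

lemma bounded_lattice: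
  assumes "bounded_lattice X"
  shows "bounded_lattice Y"
proof -
  interpret L: bounded_lattice X by fact
  show ?thesis
  proof unfold_locales
    fix x y assume xy: "x \<in> carrier Y" "y \<in> carrier Y"
    show "\<exists>s. is_lub Y s {x, y}"
      using is_lub[OF _ _ L.is_lub_join] xy by (metis fg g_closed)
    show "\<exists>s. is_glb Y s {x, y}"
      using is_glb[OF _ _ L.is_glb_meet] xy by (metis fg g_closed)
  next
    show "\<exists>x. least Y x (carrier Y)"
      by (rule exI[of _ "f \<bottom>\<^bsub>X\<^esub>"]) (auto simp: least_def image le_iff)
    show "\<exists>x. greatest Y x (carrier Y)"
      by (rule exI[of _ "f \<top>\<^bsub>X\<^esub>"]) (auto simp: greatest_def image le_iff)
  qed
qed

lemma bottom:
  assumes "b \<in> carrier X" "\<And>x. x \<in> carrier X \<Longrightarrow> b \<sqsubseteq>\<^bsub>X\<^esub> x"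
  shows "\<bottom>\<^bsub>Y\<^esub> = f \<bottom>\<^bsub>X\<^esub>"
proof -
  have "\<bottom>\<^bsub>X\<^esub> = b" by (rule X.bottom_eqI) (use assms in auto)
  moreover have "\<bottom>\<^bsub>Y\<^esub> = f b" by (rule Y.bottom_eqI) (use assms in \<open>auto simp: image le_iff\<close>)
  ultimately show ?thesis by simp
qed

end

locale lattice_iso = order_iso X Y f + X: bounded_lattice X
  for X :: "'a gorder" and Y :: "'b gorder" and f
begin

sublocale Y: bounded_lattice Y
  by (rule bounded_lattice) unfold_locales

lemma lattice_iso_inverse: "lattice_iso Y X g"
  by (simp add: lattice_iso_def inverse Y.bounded_lattice_axioms)

lemma join: "\<lbrakk>x \<in> carrier X; y \<in> carrier X\<rbrakk> \<Longrightarrow> f (x \<squnion>\<^bsub>X\<^esub> y) = f x \<squnion>\<^bsub>Y\<^esub> f y"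
  by (simp add: Y.join_eqI[OF is_lub[OF _ _ X.is_lub_join]])

lemma meet: "\<lbrakk>x \<in> carrier X; y \<in> carrier X\<rbrakk> \<Longrightarrow> f (x \<sqinter>\<^bsub>X\<^esub> y) = f x \<sqinter>\<^bsub>Y\<^esub> f y"
  by (simp add: Y.meet_eqI[OF is_glb[OF _ _ X.is_glb_meet]])

lemma bot: "\<bottom>\<^bsub>Y\<^esub> = f \<bottom>\<^bsub>X\<^esub>"
  by (rule bottom[of "\<bottom>\<^bsub>X\<^esub>"]) auto

lemma top: "\<top>\<^bsub>Y\<^esub> = f \<top>\<^bsub>X\<^esub>"
  by (rule Y.top_eqI) (auto simp: image le_iff)

lemma basic: "basic X x \<Longrightarrow> basic Y (f x)"
  using covered_by by (auto simp: basic_def is_atom_def bot)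

lemma dual_modular_iff: "x \<in> carrier X \<Longrightarrow> dual_modular Y (f x) \<longleftrightarrow> dual_modular X x"
  by (simp add: dual_modular_def image le_iff eq_iff flip: join meet)

lemma principal_pair_for:
  assumes "principal_pair_for X x p"
  shows "principal_pair_for Y (f x) (map_prod f f p)"
proof -
  obtain y z where p: "p = (y, z)" by fastforce
  have c: "y \<in> carrier X" "z \<in> carrier X"
    using assms by (auto simp: p principal_pair_for_def principal_pair_def dual_modular_def)
  show ?thesis
    using assms basic[of y] basic[of z] basic[of "y \<sqinter>\<^bsub>X\<^esub> z"] c
    by (auto simp: p principal_pair_for_def principal_pair_def dual_modular_iff join[symmetric]
        meet[symmetric] eq_iff top bot)
qed

end

lemma lattice_iso_principal_pair_for_iff:
  assumes "lattice_iso X Y f" "x \<in> carrier X" "y \<in> carrier X" "z \<in> carrier X"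
  shows "principal_pair_for Y (f x) (f y, f z) \<longleftrightarrow> principal_pair_for X x (y, z)"
proof -
  interpret lattice_iso X Y f by fact
  interpret i: lattice_iso Y X g by (rule lattice_iso_inverse)
  show ?thesis
    using principal_pair_for[of x "(y, z)"] i.principal_pair_for[of "f x" "(f y, f z)"] assms
    by (auto simp: gf)
qed

text \<open>
  Meets and joins are choices among the greatest lower or least upper bounds, hence preserved
  by isomorphisms only where such bounds exist. All meets and joins in the definition of a
  direction are taken below some element, so lattices as down-sets are enough.
\<close>

locale downset_lattice = partial_order X for X :: "'a gorder" +
  assumes has_bottom: "\<exists>b\<in>carrier X. \<forall>x\<in>carrier X. b \<sqsubseteq>\<^bsub>X\<^esub> x"
    and bounded_lattice_down: "y \<in> carrier X \<Longrightarrow> bounded_lattice (down X y)"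
begin

lemma is_glb_below:
  assumes "y \<in> carrier X" "v \<in> carrier X" "z \<in> carrier X" "y \<sqsubseteq>\<^bsub>X\<^esub> z" "v \<sqsubseteq>\<^bsub>X\<^esub> z"
  shows "\<exists>j. is_glb X j {y, v}"
proof -
  interpret L: bounded_lattice "down X z" using assms by (intro bounded_lattice_down)
  have "is_glb (down X z) (y \<sqinter>\<^bsub>down X z\<^esub> v) {y, v}"
    by (rule L.is_glb_meet) (use assms in \<open>auto simp: carrier_down\<close>)
  then have "is_glb X (y \<sqinter>\<^bsub>down X z\<^esub> v) {y, v}"
    using assms by (auto simp: is_glb_pair carrier_down intro: le_trans)
  then show ?thesis ..
qed

lemma direction_values:
  assumes "direction X x d" "d y = Some (v, w)"
  shows "y \<in> carrier X \<and> v \<in> carrier X \<and> w \<in> carrier X \<and> v \<sqsubseteq>\<^bsub>X\<^esub> y \<and> w \<sqsubseteq>\<^bsub>X\<^esub> y"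
proof -
  have dom: "dom d = up_set X x" and
    pp: "\<And>y. y \<in> up_set X x \<Longrightarrow> principal_pair_for (down X y) x (the (d y))"
    using assms unfolding direction_def by blast+
  have "y \<in> up_set X x" using dom assms(2) by blast
  from pp[OF this] have "principal_pair_for (down X y) x (v, w)" by (simp add: assms(2))
  with \<open>y \<in> up_set X x\<close> show ?thesis
    by (auto simp: up_set_def principal_pair_for_def principal_pair_def dual_modular_def carrier_down)
qed

end

locale downset_lattice_iso = order_iso X Y f + X: downset_lattice X
  for X :: "'a gorder" and Y :: "'b gorder" and f
begin

lemma lattice_iso_down: "x \<in> carrier X \<Longrightarrow> lattice_iso (down X x) (down Y (f x)) f"
  by (simp add: lattice_iso_def down X.bounded_lattice_down)

sublocale Y: downset_lattice Y
proof (intro downset_lattice.intro downset_lattice_axioms.intro Y.partial_order_axioms)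
  show "\<exists>b\<in>carrier Y. \<forall>x\<in>carrier Y. b \<sqsubseteq>\<^bsub>Y\<^esub> x"
    using X.has_bottom by (auto simp: image le_iff)
  fix y assume "y \<in> carrier Y"
  then show "bounded_lattice (down Y y)"
    using lattice_iso_down[of "g y"] order_iso.bounded_lattice[OF down X.bounded_lattice_down]
    by (metis fg g_closed)
qed

lemma downset_lattice_iso_inverse: "downset_lattice_iso Y X g"
  by (simp add: downset_lattice_iso_def inverse Y.downset_lattice_axioms)

lemma bottom_eq: "\<bottom>\<^bsub>Y\<^esub> = f \<bottom>\<^bsub>X\<^esub>"
  using bottom X.has_bottom by blast

text \<open>
  A map given on \<open>X\<close> is moved to \<open>Y\<close> in both its arguments and its values; its domain stays
  within the carrier, so that inverse isomorphisms give inverse maps on directions.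
\<close>

definition lift :: "('a \<rightharpoonup> 'a \<times> 'a) \<Rightarrow> ('b \<rightharpoonup> 'b \<times> 'b)" where
  "lift d = (\<lambda>y. if y \<in> carrier Y then map_option (map_prod f f) (d (g y)) else None)"

lemma lift_f: "x \<in> carrier X \<Longrightarrow> lift d (f x) = map_option (map_prod f f) (d x)"
  by (simp add: lift_def closed gf)

lemma lift_eq_SomeD:
  assumes "direction X x d" "lift d y = Some q"
  obtains y' v w where "y = f y'" "d y' = Some (v, w)" "q = (f v, f w)"
    "y' \<in> carrier X" "v \<in> carrier X" "w \<in> carrier X" "v \<sqsubseteq>\<^bsub>X\<^esub> y'" "w \<sqsubseteq>\<^bsub>X\<^esub> y'"
proof -
  have y: "y \<in> carrier Y" using assms(2) by (auto simp: lift_def split: if_splits)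
  obtain v w where vw: "d (g y) = Some (v, w)" "q = (f v, f w)"
    using assms(2) y by (auto simp: lift_def)
  show ?thesis
    using that[of "g y" v w] vw X.direction_values[OF assms(1) vw(1)] y by (simp add: fg)
qed

lemma is_atom: "is_atom X x \<Longrightarrow> is_atom Y (f x)"
  by (simp add: is_atom_def bottom_eq covered_by)

lemma direction_lift:
  assumes d: "direction X x d"
  shows "direction Y (f x) (lift d)"
proof -
  have x: "x \<in> carrier X" "basic X x" and dom: "dom d = up_set X x"
    and pp: "\<And>y. y \<in> up_set X x \<Longrightarrow> principal_pair_for (down X y) x (the (d y))"
    and mt: "\<And>y z v w. y \<in> up_set X x \<Longrightarrow> z \<in> up_set X x \<Longrightarrow> y \<sqsubseteq>\<^bsub>X\<^esub> z \<Longrightarrow> d z = Some (v, w) \<Longrightarrow>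
         d y = Some (y \<sqinter>\<^bsub>X\<^esub> v, y \<sqinter>\<^bsub>X\<^esub> w)"
    and cv: "\<And>y z. covered_by X x y \<Longrightarrow> covered_by X x z \<Longrightarrow> d y = Some (x, y) \<Longrightarrow>
         d z = Some (z, x) \<Longrightarrow> \<exists>j. is_lub X j {y, z} \<and> covered_by X y j \<and> covered_by X z j"
    using d unfolding direction_def by blast+
  show ?thesis
    unfolding direction_def
  proof (intro conjI ballI allI impI)
    show "f x \<in> carrier Y" using x by (simp add: closed)
    show "basic Y (f x)" using x is_atom by (auto simp: basic_def bottom_eq)
    show "dom (lift d) = up_set Y (f x)"
    proof
      show "dom (lift d) \<subseteq> up_set Y (f x)"
        using dom by (auto simp: up_set x elim!: lift_eq_SomeD[OF d])
      show "up_set Y (f x) \<subseteq> dom (lift d)"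
      proof
        fix y assume "y \<in> up_set Y (f x)"
        then obtain y' where y': "y = f y'" "y' \<in> up_set X x" by (auto simp: up_set x)
        then obtain p where "d y' = Some p" using dom by (metis domD)
        then show "y \<in> dom (lift d)" using y' by (simp add: domIff lift_f up_set_def)
      qed
    qed
  next
    fix y assume "y \<in> up_set Y (f x)"
    then obtain y' where y': "y = f y'" "y' \<in> up_set X x" by (auto simp: up_set x)
    then have c: "y' \<in> carrier X" by (simp add: up_set_def)
    interpret L: lattice_iso "down X y'" "down Y (f y')" f using c by (rule lattice_iso_down)
    obtain p where "d y' = Some p" using y' dom by (metis domD)
    then show "principal_pair_for (down Y y) (f x) (the (lift d y))"
      using L.principal_pair_for[OF pp[OF y'(2)]] c y' by (simp add: lift_f)
  next
    fix y z v w
    assume y: "y \<in> up_set Y (f x)" and z: "z \<in> up_set Y (f x)"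
      and yz: "y \<sqsubseteq>\<^bsub>Y\<^esub> z \<and> lift d z = Some (v, w)"
    obtain z' v' w' where z: "z = f z'" and dz: "d z' = Some (v', w')"
      and vw: "(v, w) = (f v', f w')"
      and c: "z' \<in> carrier X" "v' \<in> carrier X" "w' \<in> carrier X" "v' \<sqsubseteq>\<^bsub>X\<^esub> z'" "w' \<sqsubseteq>\<^bsub>X\<^esub> z'"
      by (rule lift_eq_SomeD[OF d yz[THEN conjunct2]])
    note z' = z dz
    obtain y' where y': "y = f y'" "y' \<in> up_set X x" using y by (auto simp: up_set x)
    then have cy: "y' \<in> carrier X" by (simp add: up_set_def)
    have le: "y' \<sqsubseteq>\<^bsub>X\<^esub> z'" using yz y' z' c cy by (simp add: le_iff)
    have zz: "z' \<in> up_set X x" using z' dom by auto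
    have meet: "f (y' \<sqinter>\<^bsub>X\<^esub> t) = f y' \<sqinter>\<^bsub>Y\<^esub> f t" if t: "t \<in> carrier X" "t \<sqsubseteq>\<^bsub>X\<^esub> z'" for t
    proof -
      obtain j where j: "is_glb X j {y', t}" using X.is_glb_below[OF cy t(1) c(1) le t(2)] ..
      then show ?thesis
        using X.meet_eqI[OF j] Y.meet_eqI[OF is_glb[OF cy t(1) j]] by simp
    qed
    show "lift d y = Some (y \<sqinter>\<^bsub>Y\<^esub> v, y \<sqinter>\<^bsub>Y\<^esub> w)"
      using mt[OF y'(2) zz le dz] cy y'(1) vw c by (simp add: lift_f meet)
  next
    fix y z
    assume h: "covered_by Y (f x) y \<and> covered_by Y (f x) z \<and>
      lift d y = Some (f x, y) \<and> lift d z = Some (z, f x)"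
    interpret i: order_iso Y X g by (rule inverse)
    have c: "y \<in> carrier Y" "z \<in> carrier Y" using h by (auto simp: covered_by_def)
    have "covered_by X x (g y)" "covered_by X x (g z)"
      using h i.covered_by x gf by metis+
    moreover have "d (g y) = Some (x, g y)"
    proof -
      obtain y' v w where *: "y = f y'" "d y' = Some (v, w)" "(f x, y) = (f v, f w)"
        "y' \<in> carrier X" "v \<in> carrier X" "w \<in> carrier X"
        using h by (elim conjE lift_eq_SomeD[OF d])
      then show ?thesis using x by (auto simp: gf eq_iff)
    qed
    moreover have "d (g z) = Some (g z, x)"
    proof -
      obtain y' v w where *: "z = f y'" "d y' = Some (v, w)" "(z, f x) = (f v, f w)"
        "y' \<in> carrier X" "v \<in> carrier X" "w \<in> carrier X"
        using h by (elim conjE lift_eq_SomeD[OF d])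
      then show ?thesis using x by (auto simp: gf eq_iff)
    qed
    ultimately obtain j where "is_lub X j {g y, g z}" "covered_by X (g y) j" "covered_by X (g z) j"
      using cv by blast
    then show "\<exists>j. is_lub Y j {y, z} \<and> covered_by Y y j \<and> covered_by Y z j"
      using is_lub[OF g_closed[OF c(1)] g_closed[OF c(2)]] covered_by c fg by metis
  qed
qed

lemma near_via: "near_via X x y w z \<Longrightarrow> near_via Y (f x) (f y) (f w) (f z)"
  unfolding near_via_def
  using is_lub[of x y w] covered_by is_atom le_iff eq_iff
  by (auto simp: is_atom_def covered_by_def)

lemma dir_summable_lift:
  assumes "dir_summable X d e w z"
  shows "dir_summable Y (lift d) (lift e) (f w) (f z)"
proof -
  obtain x y where h: "near_via X x y w z" "direction X x d" "direction X y e"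
      "d w = Some (x, w)" "e w = Some (y, w)"
    using assms by (auto simp: dir_summable_def)
  then have "w \<in> carrier X" by (auto simp: near_via_def covered_by_def)
  with h show ?thesis
    unfolding dir_summable_def
    by (intro exI[of _ "f x"] exI[of _ "f y"]) (simp add: near_via direction_lift lift_f)
qed

lemma lift_in_directions: "d \<in> directions X \<Longrightarrow> lift d \<in> directions Y"
  using direction_lift by (auto simp: directions_def)

lemma lift_zero: "lift (dir_zero X) = dir_zero Y"
  by (rule ext) (auto simp: lift_def dir_zero_def bottom_eq g_closed fg)

lemma lift_one: "lift (dir_one X) = dir_one Y"
  by (rule ext) (auto simp: lift_def dir_one_def bottom_eq g_closed fg)

lemma lift_compl: "lift (dir_compl d) = dir_compl (lift d)"
  by (rule ext) (auto simp: lift_def dir_compl_def option.map_comp o_def prod.map_comp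
      intro!: option.map_cong split: prod.splits)

lemma unlift_lift:
  assumes "d \<in> directions X"
  shows "downset_lattice_iso.lift Y X g (lift d) = d"
proof -
  interpret i: downset_lattice_iso Y X g by (rule downset_lattice_iso_inverse)
  obtain x where d: "direction X x d" using assms by (auto simp: directions_def)
  show ?thesis
  proof
    fix y
    show "i.lift (lift d) y = d y"
    proof (cases "y \<in> carrier X")
      case True
      then have "i.lift (lift d) y = map_option (map_prod g g) (map_option (map_prod f f) (d y))"
        using i.lift_f[of "f y"] by (simp add: gf lift_f closed)
      also have "\<dots> = d y"
        using X.direction_values[OF d] by (cases "d y") (auto simp: gf)
      finally show ?thesis .
    next
      case False
      then show ?thesis using X.direction_values[OF d] by (cases "d y") (auto simp: i.lift_def)
    qed
  qed
qed

lemma lift_unlift: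
  assumes "k \<in> directions Y"
  shows "lift (downset_lattice_iso.lift Y X g k) = k"
proof -
  interpret i: downset_lattice_iso Y X g by (rule downset_lattice_iso_inverse)
  obtain x where k: "direction Y x k" using assms by (auto simp: directions_def)
  show ?thesis
  proof
    fix y
    show "lift (i.lift k) y = k y"
    proof (cases "y \<in> carrier Y")
      case True
      then have "lift (i.lift k) y = map_option (map_prod f f) (map_option (map_prod g g) (k y))"
        by (simp add: lift_def i.lift_f)
      also have "\<dots> = k y"
        using Y.direction_values[OF k] by (cases "k y") (auto simp: fg)
      finally show ?thesis .
    next
      case False
      then show ?thesis using Y.direction_values[OF k] by (cases "k y") (auto simp: lift_def)
    qed
  qed
qed

lemma lift_eq_iff:
  "\<lbrakk>d \<in> directions X; e \<in> directions X\<rbrakk> \<Longrightarrow> lift d = lift e \<longleftrightarrow> d = e"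
  using unlift_lift by metis

text \<open>
  The value of \<^const>\<open>dir_sum\<close> is given by a definite description, so it can be transported
  only where the description is known to denote.
\<close>

lemma dir_sum_lift:
  assumes d: "d \<in> directions X" and e: "e \<in> directions X"
    and zero: "dir_zero X \<in> directions X" and compl: "dir_compl d \<in> directions X"
    and the: "\<exists>w z. dir_summable X d e w z \<Longrightarrow>
      \<exists>!h. \<exists>w z. dir_summable X d e w z \<and> direction X z h \<and> h w = Some (w, z)"
  shows "dir_sum Y (lift d) (lift e) = map_option lift (dir_sum X d e)"
proof -
  interpret i: downset_lattice_iso Y X g by (rule downset_lattice_iso_inverse)
  have reflect: "dir_summable X d e (g w) (g z)" if "dir_summable Y (lift d) (lift e) w z" for w z
    using i.dir_summable_lift[OF that] by (simp add: unlift_lift d e)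
  have ex: "(\<exists>w z. dir_summable Y (lift d) (lift e) w z) \<longleftrightarrow> (\<exists>w z. dir_summable X d e w z)"
    using reflect dir_summable_lift by blast
  have zero_iff: "lift d' = dir_zero Y \<longleftrightarrow> d' = dir_zero X" if "d' \<in> directions X" for d'
    using lift_eq_iff[OF that zero] by (simp add: lift_zero)
  have compl_iff: "lift e = dir_compl (lift d) \<longleftrightarrow> e = dir_compl d"
    using lift_eq_iff[OF e compl] by (simp add: lift_compl)
  have "(THE h. \<exists>w z. dir_summable Y (lift d) (lift e) w z \<and> direction Y z h \<and> h w = Some (w, z))
      = lift (THE h. \<exists>w z. dir_summable X d e w z \<and> direction X z h \<and> h w = Some (w, z))"
    if s: "\<exists>w z. dir_summable X d e w z"
  proof (rule the_equality)
    obtain h w z where h: "dir_summable X d e w z" "direction X z h" "h w = Some (w, z)"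
      and h': "(THE h. \<exists>w z. dir_summable X d e w z \<and> direction X z h \<and> h w = Some (w, z)) = h"
      using theI'[OF the[OF s]] by blast
    show "\<exists>w z. dir_summable Y (lift d) (lift e) w z \<and>
      direction Y z (lift (THE h. \<exists>w z. dir_summable X d e w z \<and> direction X z h \<and> h w = Some (w, z))) \<and>
      lift (THE h. \<exists>w z. dir_summable X d e w z \<and> direction X z h \<and> h w = Some (w, z)) w = Some (w, z)"
      unfolding h'
      using dir_summable_lift[OF h(1)] direction_lift[OF h(2)] X.direction_values[OF h(2,3)] h(3)
      by (intro exI[of _ "f w"] exI[of _ "f z"]) (simp add: lift_f)
    fix k assume "\<exists>w z. dir_summable Y (lift d) (lift e) w z \<and> direction Y z k \<and> k w = Some (w, z)"
    then obtain w' z' where k: "dir_summable Y (lift d) (lift e) w' z'" "direction Y z' k"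
      "k w' = Some (w', z')" by blast
    have "dir_summable X d e (g w') (g z')" "direction X (g z') (i.lift k)"
      "i.lift k (g w') = Some (g w', g z')"
      using reflect[OF k(1)] i.direction_lift[OF k(2)] Y.direction_values[OF k(2,3)] k(3)
      by (auto simp: i.lift_f)
    then have "i.lift k = h" using the[OF s] h by blast
    moreover have "k \<in> directions Y" using k(2) by (auto simp: directions_def)
    ultimately show "k = lift (THE h. \<exists>w z. dir_summable X d e w z \<and> direction X z h \<and> h w = Some (w, z))"
      unfolding h' using lift_unlift[of k] by simp
  qed
  then show ?thesis
    by (auto simp: dir_sum_def zero_iff d e compl_iff lift_one ex)
qed

end

section \<open>Transport of an orthoalgebra along a bijection\<close>

text \<open>
  The map has to preserve undefinedness of sums as well, which is why the sum is compared as an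
  option.
\<close>

lemma orthoalgebra_transport:
  assumes A: "orthoalgebra A" and f: "bij_betw f (carrier A) (carrier C)"
    and zero: "f (ozero A) = ozero C" and one: "f (oone A) = oone C"
    and compl: "\<And>a. a \<in> carrier A \<Longrightarrow> f (ocompl A a) = ocompl C (f a)"
    and sum: "\<And>a b. a \<in> carrier A \<Longrightarrow> b \<in> carrier A \<Longrightarrow>
      f a \<oplus>\<^bsub>C\<^esub> f b = map_option f (a \<oplus>\<^bsub>A\<^esub> b)"
  shows "orthoalgebra C" "ortho_isomorphic A C"
proof -
  interpret A: orthoalgebra A by fact
  have im: "carrier C = f ` carrier A" and inj: "inj_on f (carrier A)"
    using f by (auto simp: bij_betw_def)
  have eq_iff: "f a = f b \<longleftrightarrow> a = b" if "a \<in> carrier A" "b \<in> carrier A" for a b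
    using inj that by (auto dest: inj_onD)
  show "orthoalgebra C"
  proof unfold_locales
    fix a b c assume "a \<in> carrier C" "b \<in> carrier C" "a \<oplus>\<^bsub>C\<^esub> b = Some c"
    then show "c \<in> carrier C" by (auto simp: im sum intro!: imageI elim!: A.osum_closed[rotated 2])
  next
    fix a assume "a \<in> carrier C"
    then show "ocompl C a \<in> carrier C" by (auto simp: im A.ocompl_closed simp flip: compl)
  next
    show "ozero C \<in> carrier C" "oone C \<in> carrier C"
      by (auto simp: im A.ozero_closed A.oone_closed simp flip: zero one)
  next
    fix a b assume "a \<in> carrier C" "b \<in> carrier C"
    then show "a \<oplus>\<^bsub>C\<^esub> b = b \<oplus>\<^bsub>C\<^esub> a" by (auto simp: im sum A.osum_comm)
  next
    fix a b c assume "a \<in> carrier C" "b \<in> carrier C" "c \<in> carrier C"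
    then obtain a' b' c' where
      [simp]: "a' \<in> carrier A" "b' \<in> carrier A" "c' \<in> carrier A" "a = f a'" "b = f b'" "c = f c'"
      by (auto simp: im)
    have "Option.bind (a \<oplus>\<^bsub>C\<^esub> b) (\<lambda>s. s \<oplus>\<^bsub>C\<^esub> c) =
        map_option f (Option.bind (a' \<oplus>\<^bsub>A\<^esub> b') (\<lambda>s. s \<oplus>\<^bsub>A\<^esub> c'))"
      by (cases "a' \<oplus>\<^bsub>A\<^esub> b'") (auto simp: sum A.osum_closed[of a' b'])
    also have "\<dots> = map_option f (Option.bind (b' \<oplus>\<^bsub>A\<^esub> c') (\<lambda>s. a' \<oplus>\<^bsub>A\<^esub> s))"
      by (simp add: A.osum_assoc)
    also have "\<dots> = Option.bind (b \<oplus>\<^bsub>C\<^esub> c) (\<lambda>s. a \<oplus>\<^bsub>C\<^esub> s)"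
      by (cases "b' \<oplus>\<^bsub>A\<^esub> c'") (auto simp: sum A.osum_closed[of b' c'])
    finally show "Option.bind (a \<oplus>\<^bsub>C\<^esub> b) (\<lambda>s. s \<oplus>\<^bsub>C\<^esub> c) =
      Option.bind (b \<oplus>\<^bsub>C\<^esub> c) (\<lambda>s. a \<oplus>\<^bsub>C\<^esub> s)" .
  next
    fix a assume "a \<in> carrier C"
    then show "a \<oplus>\<^bsub>C\<^esub> ocompl C a = Some (oone C)"
      by (auto simp: im sum A.osum_ocompl A.ocompl_closed one simp flip: compl)
  next
    fix a b assume "a \<in> carrier C" "b \<in> carrier C" "a \<oplus>\<^bsub>C\<^esub> b = Some (oone C)"
    then obtain a' b' c' where h: "a' \<in> carrier A" "b' \<in> carrier A" "a = f a'" "b = f b'"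
        "a' \<oplus>\<^bsub>A\<^esub> b' = Some c'" "f c' = f (oone A)"
      by (auto simp: im sum one)
    then have "a' \<oplus>\<^bsub>A\<^esub> b' = Some (oone A)"
      using A.osum_closed[of a' b' c'] by (simp add: eq_iff A.oone_closed)
    then show "b = ocompl C a" using h A.ocompl_unique[of a' b'] by (simp flip: compl)
  next
    fix a assume "a \<in> carrier C"
    then obtain a' where a': "a' \<in> carrier A" "a = f a'" by (auto simp: im)
    then show "a \<oplus>\<^bsub>C\<^esub> a \<noteq> None \<longleftrightarrow> a = ozero C"
      using A.osum_self[of a'] by (simp add: sum eq_iff A.ozero_closed flip: zero)
  qed
  let ?g = "inv_into (carrier A) f"
  have gf: "?g (f a) = a" if "a \<in> carrier A" for a
    using inj that by simp
  have "ortho_morphism A C f"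
    unfolding ortho_morphism_def by (intro conjI Pi_I ballI allI impI) (simp_all add: im compl sum)
  moreover have "ortho_morphism C A ?g"
    unfolding ortho_morphism_def
  proof (intro conjI Pi_I ballI allI impI)
    fix c assume "c \<in> carrier C"
    then obtain a where a: "a \<in> carrier A" "c = f a" by (auto simp: im)
    show "?g c \<in> carrier A" using a by (simp add: gf)
    show "?g (ocompl C c) = ocompl A (?g c)"
      using a by (simp add: gf A.ocompl_closed flip: compl)
    fix d s assume "d \<in> carrier C" and s: "c \<oplus>\<^bsub>C\<^esub> d = Some s"
    then obtain b where b: "b \<in> carrier A" "d = f b" by (auto simp: im)
    obtain t where "a \<oplus>\<^bsub>A\<^esub> b = Some t" "s = f t" using s a b by (auto simp: sum)
    then show "?g c \<oplus>\<^bsub>A\<^esub> ?g d = Some (?g s)"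
      using a b A.osum_closed[of a b t] by (simp add: gf)
  qed
  moreover have "f (?g c) = c" if "c \<in> carrier C" for c
    using f that by (rule bij_betw_inv_into_right)
  ultimately show "ortho_isomorphic A C"
    unfolding ortho_isomorphic_def using gf by blast
qed

section \<open>Principal pairs in the lattice of fields of subsets of a small set\<close>

definition set_fields :: "'i set \<Rightarrow> 'i set set set" where
  "set_fields I = {F. F \<subseteq> Pow I \<and> {} \<in> F \<and> (\<forall>s\<in>F. I - s \<in> F) \<and> (\<forall>s\<in>F. \<forall>t\<in>F. s \<inter> t \<in> F)}"

definition gen_field :: "'i set \<Rightarrow> 'i set set \<Rightarrow> 'i set set" where
  "gen_field I G = \<Inter>{F \<in> set_fields I. G \<subseteq> F}"

text \<open>
  The atom (or least element) of the lattice of fields given by the partition into \<open>U\<close> and its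
  complement.
\<close>

definition split_field :: "'i set \<Rightarrow> 'i set \<Rightarrow> 'i set set" where
  "split_field I U = {{}, U, I - U, I}"

text \<open>
  The subalgebra of the principal ideal of \<open>U\<close>. As a partition it consists of the singletons in
  \<open>U\<close> and the complement of \<open>U\<close>.
\<close>

definition ideal_field :: "'i set \<Rightarrow> 'i set \<Rightarrow> 'i set set" where
  "ideal_field I U = {s. s \<subseteq> I \<and> (s \<subseteq> U \<or> I - U \<subseteq> s)}"

abbreviation fields_order :: "'i set \<Rightarrow> 'i set set gorder" where
  "fields_order I \<equiv> inclusion_order (set_fields I)"

lemma set_fieldsD:
  assumes "F \<in> set_fields I"
  shows "F \<subseteq> Pow I" "{} \<in> F" "I \<in> F" "s \<in> F \<Longrightarrow> I - s \<in> F"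
    "s \<in> F \<Longrightarrow> t \<in> F \<Longrightarrow> s \<inter> t \<in> F"
  using assms by (auto simp: set_fields_def)

lemma set_fields_Un:
  assumes F: "F \<in> set_fields I" and "s \<in> F" "t \<in> F"
  shows "s \<union> t \<in> F"
proof -
  have "s \<subseteq> I" "t \<subseteq> I" using assms set_fieldsD(1)[OF F] by auto
  then have "s \<union> t = I - ((I - s) \<inter> (I - t))" by auto
  with assms set_fieldsD[OF F] show ?thesis by metis
qed

lemma set_fields_Diff:
  assumes F: "F \<in> set_fields I" and "s \<in> F" "t \<in> F"
  shows "s - t \<in> F"
proof -
  have "s \<subseteq> I" using assms set_fieldsD(1)[OF F] by auto
  then have "s - t = s \<inter> (I - t)" by auto
  with assms set_fieldsD[OF F] show ?thesis by metis
qed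

lemma Pow_in_set_fields: "Pow I \<in> set_fields I"
  by (auto simp: set_fields_def)

lemma Int_in_set_fields: "\<lbrakk>F \<in> set_fields I; G \<in> set_fields I\<rbrakk> \<Longrightarrow> F \<inter> G \<in> set_fields I"
  by (auto simp: set_fields_def)

lemma gen_field_in:
  assumes "G \<subseteq> Pow I"
  shows "gen_field I G \<in> set_fields I"
  unfolding set_fields_def
proof (intro CollectI conjI ballI)
  show "gen_field I G \<subseteq> Pow I"
    using assms Pow_in_set_fields unfolding gen_field_def by (intro Inter_lower) auto
qed (auto simp: gen_field_def set_fieldsD)

lemma split_field_in: "U \<subseteq> I \<Longrightarrow> split_field I U \<in> set_fields I"
  by (auto simp: split_field_def set_fields_def)

lemma ideal_field_in: "U \<subseteq> I \<Longrightarrow> ideal_field I U \<in> set_fields I"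
  by (auto simp: ideal_field_def set_fields_def)

interpretation fields_order: partial_order "fields_order I" for I :: "'i set"
  by (rule partial_order_inclusion_order)

lemma fields_glb:
  "\<lbrakk>F \<in> set_fields I; G \<in> set_fields I\<rbrakk> \<Longrightarrow> is_glb (fields_order I) (F \<inter> G) {F, G}"
  by (auto simp: is_glb_pair Int_in_set_fields)

lemma fields_lub:
  assumes "F \<in> set_fields I" "G \<in> set_fields I"
  shows "is_lub (fields_order I) (gen_field I (F \<union> G)) {F, G}"
proof -
  have "gen_field I (F \<union> G) \<in> set_fields I"
    using assms by (intro gen_field_in) (auto dest: set_fieldsD)
  with assms show ?thesis by (auto simp: is_lub_pair gen_field_def)
qed

lemma fields_meet:
  "\<lbrakk>F \<in> set_fields I; G \<in> set_fields I\<rbrakk> \<Longrightarrow> F \<sqinter>\<^bsub>fields_order I\<^esub> G = F \<inter> G"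
  by (rule fields_order.meet_eqI[OF fields_glb])

lemma fields_bottom: "\<bottom>\<^bsub>fields_order I\<^esub> = {{}, I}"
proof (rule fields_order.bottom_eqI)
  show "{{}, I} \<in> carrier (fields_order I)" by (auto simp: set_fields_def)
qed (auto simp: set_fieldsD)

lemma fields_top: "\<top>\<^bsub>fields_order I\<^esub> = Pow I"
  by (rule fields_order.top_eqI) (auto simp: Pow_in_set_fields dest: set_fieldsD)

lemma bounded_lattice_fields: "bounded_lattice (fields_order I)"
proof unfold_locales
  fix F G assume "F \<in> carrier (fields_order I)" "G \<in> carrier (fields_order I)"
  then show "\<exists>s. is_lub (fields_order I) s {F, G}" "\<exists>s. is_glb (fields_order I) s {F, G}"
    using fields_lub[of F I G] fields_glb[of F I G] by (simp_all) blast+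
next
  show "\<exists>x. least (fields_order I) x (carrier (fields_order I))"
    by (rule exI[of _ "{{}, I}"]) (auto simp: least_def set_fields_def)
  show "\<exists>x. greatest (fields_order I) x (carrier (fields_order I))"
    by (rule exI[of _ "Pow I"]) (auto simp: greatest_def set_fields_def)
qed

lemma fields_join_in:
  assumes "F \<in> set_fields I" "G \<in> set_fields I"
  shows "F \<squnion>\<^bsub>fields_order I\<^esub> G \<in> set_fields I"
  using fields_order.join_eqI[OF fields_lub[OF assms]] least_closed[OF fields_lub[OF assms]] by simp

lemma fields_join_eqI:
  assumes "F \<in> set_fields I" "G \<in> set_fields I" "H \<in> set_fields I" "F \<subseteq> H" "G \<subseteq> H"
    and "\<And>K. K \<in> set_fields I \<Longrightarrow> F \<subseteq> K \<Longrightarrow> G \<subseteq> K \<Longrightarrow> H \<subseteq> K"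
  shows "F \<squnion>\<^bsub>fields_order I\<^esub> G = H"
  by (rule fields_order.join_eqI) (use assms in \<open>auto simp: is_lub_pair\<close>)

text \<open>
  Joining with the subalgebra of an ideal forgets what happens inside the generator \<open>U\<close> of
  the ideal, because any two sets that agree outside \<open>U\<close> differ by members of the ideal.
\<close>

lemma ideal_field_join:
  assumes U: "U \<subseteq> I" and G: "G \<in> set_fields I"
  shows "ideal_field I U \<squnion>\<^bsub>fields_order I\<^esub> G = {s. s \<subseteq> I \<and> (\<exists>t\<in>G. s - U = t - U)}"
    (is "_ = ?H")
proof (rule fields_join_eqI)
  note D = set_fieldsD[OF G]
  show "?H \<in> set_fields I"
    unfolding set_fields_def
  proof (rule CollectI, intro conjI ballI)
    fix s assume "s \<in> ?H"
    then obtain t where "s \<subseteq> I" "t \<in> G" "s - U = t - U" by auto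
    then show "I - s \<in> ?H" by (auto intro!: bexI[of _ "I - t"] D)
    fix s' assume "s' \<in> ?H"
    then obtain t' where "s' \<subseteq> I" "t' \<in> G" "s' - U = t' - U" by auto
    with \<open>s \<subseteq> I\<close> \<open>t \<in> G\<close> \<open>s - U = t - U\<close> show "s \<inter> s' \<in> ?H"
      by (auto intro!: bexI[of _ "t \<inter> t'"] D)
  qed (use D in auto)
  show "ideal_field I U \<subseteq> ?H"
  proof
    fix s assume "s \<in> ideal_field I U"
    then have "s \<subseteq> I" "s - U = {} - U \<or> s - U = I - U" by (auto simp: ideal_field_def)
    with D show "s \<in> ?H" by blast
  qed
  show "G \<subseteq> ?H" using D by auto
  fix K assume K: "K \<in> set_fields I" "ideal_field I U \<subseteq> K" "G \<subseteq> K"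
  show "?H \<subseteq> K"
  proof
    fix s assume "s \<in> ?H"
    then obtain t where s: "s \<subseteq> I" "t \<in> G" "s - U = t - U" by auto
    have "s \<inter> U \<in> K" "U \<in> K" using K(2) U by (auto simp: ideal_field_def)
    then have "(s \<inter> U) \<union> (t - U) \<in> K"
      using s K by (intro set_fields_Un[OF K(1)] set_fields_Diff[OF K(1)]) auto
    moreover have "(s \<inter> U) \<union> (t - U) = s" using s by blast
    ultimately show "s \<in> K" by simp
  qed
qed (use assms ideal_field_in in auto)

lemma fields_join_commute: "F \<squnion>\<^bsub>fields_order I\<^esub> G = G \<squnion>\<^bsub>fields_order I\<^esub> F"
  by (rule join_comm)

text \<open>
  The explicit join with an ideal reduces both modular laws to replacing a witness \<open>t\<close> that agrees
  with \<open>s\<close> outside \<open>U\<close> by a better one. In the first law everything inside \<open>U\<close> is available, so \<open>t\<close>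
  can be rebuilt from \<open>s\<close>; in the second law the difference of \<open>s\<close> and \<open>t\<close> belongs to the ideal.
\<close>

lemma dual_modular_ideal_field:
  assumes U: "U \<subseteq> I"
  shows "dual_modular (fields_order I) (ideal_field I U)"
proof -
  let ?P = "ideal_field I U" and ?L = "fields_order I"
  have P: "?P \<in> set_fields I" using U by (rule ideal_field_in)
  have "(?P \<squnion>\<^bsub>?L\<^esub> G) \<sqinter>\<^bsub>?L\<^esub> H = ?P \<squnion>\<^bsub>?L\<^esub> (G \<sqinter>\<^bsub>?L\<^esub> H)"
    if G: "G \<in> set_fields I" and H: "H \<in> set_fields I" and PH: "?P \<subseteq> H" for G H
  proof -
    have "?P \<squnion>\<^bsub>?L\<^esub> G \<in> set_fields I"
      using P G by (rule fields_join_in)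
    moreover have "{s. s \<subseteq> I \<and> (\<exists>t\<in>G. s - U = t - U)} \<inter> H = {s. s \<subseteq> I \<and> (\<exists>t\<in>G \<inter> H. s - U = t - U)}"
    proof (intro equalityI subsetI)
      fix s assume "s \<in> {s. s \<subseteq> I \<and> (\<exists>t\<in>G. s - U = t - U)} \<inter> H"
      then obtain t where s: "s \<subseteq> I" "t \<in> G" "s - U = t - U" "s \<in> H" by auto
      have t: "t \<subseteq> I" using s set_fieldsD(1)[OF G] by auto
      have "t \<inter> U \<in> H" "U \<in> H" using PH U by (auto simp: ideal_field_def)
      then have "(t \<inter> U) \<union> (s - U) \<in> H"
        using s by (intro set_fields_Un[OF H] set_fields_Diff[OF H]) auto
      moreover have "(t \<inter> U) \<union> (s - U) = t" using s by blast
      ultimately show "s \<in> {s. s \<subseteq> I \<and> (\<exists>t\<in>G \<inter> H. s - U = t - U)}" using s by auto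
    next
      fix s assume "s \<in> {s. s \<subseteq> I \<and> (\<exists>t\<in>G \<inter> H. s - U = t - U)}"
      then obtain t where s: "s \<subseteq> I" "t \<in> G" "t \<in> H" "s - U = t - U" by auto
      have "s \<inter> U \<in> H" "U \<in> H" using PH U by (auto simp: ideal_field_def)
      then have "(s \<inter> U) \<union> (t - U) \<in> H"
        using s by (intro set_fields_Un[OF H] set_fields_Diff[OF H]) auto
      moreover have "(s \<inter> U) \<union> (t - U) = s" using s by blast
      ultimately show "s \<in> {s. s \<subseteq> I \<and> (\<exists>t\<in>G. s - U = t - U)} \<inter> H" using s by auto
    qed
    ultimately show ?thesis
      using G H by (simp add: ideal_field_join[OF U] fields_meet Int_in_set_fields)
  qed
  moreover have "(W \<squnion>\<^bsub>?L\<^esub> ?P) \<sqinter>\<^bsub>?L\<^esub> G = W \<squnion>\<^bsub>?L\<^esub> (?P \<sqinter>\<^bsub>?L\<^esub> G)"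
    if W: "W \<in> set_fields I" and G: "G \<in> set_fields I" and WG: "W \<subseteq> G" for W G
  proof -
    have J: "?P \<squnion>\<^bsub>?L\<^esub> W \<in> set_fields I"
      using P W by (rule fields_join_in)
    have "W \<squnion>\<^bsub>?L\<^esub> (?P \<inter> G) = (?P \<squnion>\<^bsub>?L\<^esub> W) \<inter> G"
    proof (rule fields_join_eqI)
      fix K assume K: "K \<in> set_fields I" "W \<subseteq> K" "?P \<inter> G \<subseteq> K"
      show "(?P \<squnion>\<^bsub>?L\<^esub> W) \<inter> G \<subseteq> K"
      proof
        fix s assume "s \<in> (?P \<squnion>\<^bsub>?L\<^esub> W) \<inter> G"
        then obtain t where s: "s \<subseteq> I" "t \<in> W" "s - U = t - U" "s \<in> G"
          by (auto simp: ideal_field_join[OF U W])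
        have t: "t \<in> G" "t \<subseteq> I" using s WG set_fieldsD(1)[OF W] by auto
        have "s - t \<in> G" "t - s \<in> G"
          using s t by (auto intro: set_fields_Diff[OF G])
        moreover have "s - t \<in> ?P" "t - s \<in> ?P" using s t by (auto simp: ideal_field_def)
        ultimately have "s - t \<in> K" "t - s \<in> K" "t \<in> K" using K s by auto
        then have "(t - (t - s)) \<union> (s - t) \<in> K"
          by (metis set_fields_Un[OF K(1)] set_fields_Diff[OF K(1)])
        moreover have "(t - (t - s)) \<union> (s - t) = s" by blast
        ultimately show "s \<in> K" by simp
      qed
    next
      show "W \<subseteq> (?P \<squnion>\<^bsub>?L\<^esub> W) \<inter> G"
        using WG set_fieldsD(1)[OF W] by (auto simp: ideal_field_join[OF U W])
      show "?P \<inter> G \<subseteq> (?P \<squnion>\<^bsub>?L\<^esub> W) \<inter> G"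
        using fields_lub[OF P W] fields_order.join_eqI[OF fields_lub[OF P W]] P W
        by (auto simp: is_lub_pair)
    qed (use W G P J in \<open>auto intro: Int_in_set_fields\<close>)
    then show ?thesis
      using P W G J by (simp add: fields_meet fields_join_commute[of I W ?P])
  qed
  ultimately show ?thesis
    using P by (auto simp: dual_modular_def)
qed

text \<open>
  For \<open>a \<in> U\<close> and \<open>c \<notin> U\<close>, the subalgebra generated by \<open>{a, c}\<close> meets the one of the ideal of
  \<open>U\<close> trivially, although together with \<open>U\<close> it separates \<open>a\<close> from the rest of \<open>U\<close>.
\<close>

lemma not_dual_modular_split_field:
  assumes U: "U \<subseteq> I" and a: "a \<in> U" "a' \<in> U" "a' \<noteq> a" and c: "c \<in> I - U" "c' \<in> I - U" "c' \<noteq> c"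
  shows "\<not> dual_modular (fields_order I) (split_field I U)"
proof
  let ?L = "fields_order I" and ?x = "split_field I U" and ?y = "split_field I {a, c}"
    and ?z = "ideal_field I U"
  assume m: "dual_modular ?L ?x"
  have ac: "{a, c} \<subseteq> I" using a c U by auto
  have x: "?x \<in> set_fields I" and y: "?y \<in> set_fields I" and z: "?z \<in> set_fields I"
    using U ac by (auto intro: split_field_in ideal_field_in)
  have xz: "?x \<subseteq> ?z" using U by (auto simp: split_field_def ideal_field_def)
  have e: "(?x \<squnion>\<^bsub>?L\<^esub> ?y) \<sqinter>\<^bsub>?L\<^esub> ?z = ?x \<squnion>\<^bsub>?L\<^esub> (?y \<sqinter>\<^bsub>?L\<^esub> ?z)"
    using m x y z xz by (auto simp: dual_modular_def)
  have yz: "?y \<inter> ?z = {{}, I}"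
    using a c U by (auto simp: split_field_def ideal_field_def)
  have "?x \<squnion>\<^bsub>?L\<^esub> {{}, I} = ?x"
    using x by (intro fields_join_eqI) (auto simp: set_fields_def split_field_def)
  moreover have J: "is_lub ?L (?x \<squnion>\<^bsub>?L\<^esub> ?y) {?x, ?y}"
    using fields_lub[OF x y] fields_order.join_eqI[OF fields_lub[OF x y]] by simp
  then have j: "?x \<squnion>\<^bsub>?L\<^esub> ?y \<in> set_fields I" "?x \<subseteq> ?x \<squnion>\<^bsub>?L\<^esub> ?y" "?y \<subseteq> ?x \<squnion>\<^bsub>?L\<^esub> ?y"
    using x y by (auto simp: is_lub_pair)
  ultimately have "(?x \<squnion>\<^bsub>?L\<^esub> ?y) \<inter> ?z = ?x"
    using e x y z by (simp add: fields_meet yz)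
  moreover have "U \<inter> {a, c} \<in> ?x \<squnion>\<^bsub>?L\<^esub> ?y"
    using j by (intro set_fieldsD(5)[OF j(1)]) (auto simp: split_field_def)
  moreover have "U \<inter> {a, c} = {a}" using a c by auto
  moreover have "{a} \<in> ?z" using a U by (auto simp: ideal_field_def)
  ultimately have "{a} \<in> ?x" by auto
  with a c U show False by (auto simp: split_field_def)
qed

text \<open>
  Every set contains \<open>U\<close> or is disjoint from it if \<open>U\<close> has at most one element, and the field of
  the ideal of the complement is made of the sets of these two sorts.
\<close>

lemma split_eq_ideal_field:
  assumes "U \<subseteq> I" "\<And>a b. a \<in> U \<Longrightarrow> b \<in> U \<Longrightarrow> a = b"
  shows "split_field I U = ideal_field I U" "ideal_field I (I - U) = Pow I"
proof -
  have *: "s \<inter> U = {} \<or> U \<subseteq> s" for s using assms(2) by blast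
  show "split_field I U = ideal_field I U"
    unfolding split_field_def ideal_field_def using assms(1) *
    by (auto; blast)
  show "ideal_field I (I - U) = Pow I"
    unfolding ideal_field_def using assms(1) * by (auto; blast)
qed

lemma split_field_compl: "U \<subseteq> I \<Longrightarrow> split_field I (I - U) = split_field I U"
  by (auto simp: split_field_def double_diff)

lemma basic_split_field:
  assumes U: "U \<subseteq> I"
  shows "basic (fields_order I) (split_field I U)"
proof (cases "U = {} \<or> U = I")
  case True
  then show ?thesis by (auto simp: basic_def fields_bottom split_field_def)
next
  case False
  have "F = split_field I U" if "F \<in> set_fields I" "{{}, I} \<subset> F" "F \<subseteq> split_field I U" for F
  proof -
    have "U \<in> F \<or> I - U \<in> F" using that by (auto simp: split_field_def)
    then have "U \<in> F \<and> I - U \<in> F" using set_fieldsD(4)[OF that(1)] U by (metis double_diff subset_refl)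
    then show ?thesis using that by (auto simp: split_field_def)
  qed
  moreover have "{{}, I} \<subset> split_field I U" using False U by (auto simp: split_field_def)
  ultimately have "is_atom (fields_order I) (split_field I U)"
    using split_field_in[OF U] split_field_in[of "{}" I]
    unfolding is_atom_def covered_by_def fields_bottom carrier_inclusion_order lless_inclusion_order
    by (auto simp: split_field_def[of I "{}"])
  then show ?thesis by (simp add: basic_def)
qed

lemma ideal_field_Int:
  "U \<subseteq> I \<Longrightarrow> ideal_field I U \<inter> ideal_field I (I - U) = split_field I U"
  by (auto simp: ideal_field_def split_field_def)

lemma ideal_field_join_compl:
  assumes U: "U \<subseteq> I"
  shows "ideal_field I U \<squnion>\<^bsub>fields_order I\<^esub> ideal_field I (I - U) = Pow I"
proof -
  have "\<exists>t\<in>ideal_field I (I - U). s - U = t - U" if "s \<subseteq> I" for s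
    using that U by (intro bexI[of _ "s - U"]) (auto simp: ideal_field_def)
  then show ?thesis
    using U by (auto simp: ideal_field_join ideal_field_in)
qed

text \<open>
  A field that contains a two-element set and its two-element complement is determined by
  whether it splits the one and whether it splits the other, which leaves four fields.
\<close>

lemma field_with_2_2:
  assumes F: "F \<in> set_fields I" and I: "I = {a, b, c, d}" and dist: "distinct [a, b, c, d]"
    and U: "{a, b} \<in> F"
  shows "F = split_field I {a, b} \<or> F = ideal_field I {a, b} \<or> F = ideal_field I {c, d} \<or> F = Pow I"
proof -
  note D = set_fieldsD[OF F]
  have cd: "{c, d} \<in> F"
  proof -
    have "I - {a, b} = {c, d}" using I dist by auto
    then show ?thesis using D(4)[OF U] by simp
  qed
  have ab: "{a} \<in> F \<longleftrightarrow> {b} \<in> F"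
  proof -
    have "{a, b} - {a} = {b}" "{a, b} - {b} = {a}" using dist by auto
    then show ?thesis using set_fields_Diff[OF F U] by metis
  qed
  have cd': "{c} \<in> F \<longleftrightarrow> {d} \<in> F"
  proof -
    have "{c, d} - {c} = {d}" "{c, d} - {d} = {c}" using dist by auto
    then show ?thesis using set_fields_Diff[OF F cd] by metis
  qed
  have decomp: "s \<in> F \<longleftrightarrow> s \<inter> {a, b} \<in> F \<and> s \<inter> {c, d} \<in> F" if "s \<subseteq> I" for s
  proof -
    have "s = (s \<inter> {a, b}) \<union> (s \<inter> {c, d})" using that I by auto
    then show ?thesis using U cd D(5)[of s] set_fields_Un[OF F, of "s \<inter> {a, b}" "s \<inter> {c, d}"] by metis
  qed
  have i1: "s \<inter> {a, b} = (if a \<in> s then if b \<in> s then {a, b} else {a} else if b \<in> s then {b} else {})" for s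
    by auto
  have i2: "s \<inter> {c, d} = (if c \<in> s then if d \<in> s then {c, d} else {c} else if d \<in> s then {d} else {})" for s
    by auto
  have mem: "s \<in> F \<longleftrightarrow> s \<subseteq> I \<and> ({a} \<in> F \<or> (a \<in> s \<longleftrightarrow> b \<in> s)) \<and> ({c} \<in> F \<or> (c \<in> s \<longleftrightarrow> d \<in> s))" for s
  proof (cases "s \<subseteq> I")
    case True
    then show ?thesis using decomp[OF True] U cd D(2) ab cd' unfolding i1 i2 by (auto split: if_splits)
  next
    case False
    then show ?thesis using D(1) by auto
  qed
  have Iab: "I - {a, b} = {c, d}" using I dist by auto
  have split: "s \<in> split_field I {a, b} \<longleftrightarrow> s \<subseteq> I \<and> (a \<in> s \<longleftrightarrow> b \<in> s) \<and> (c \<in> s \<longleftrightarrow> d \<in> s)"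
    (is "_ \<longleftrightarrow> ?R s") for s
  proof
    assume "s \<in> split_field I {a, b}"
    then consider "s = {}" | "s = {a, b}" | "s = {c, d}" | "s = I" by (auto simp: split_field_def Iab)
    then show "?R s" by cases (use I dist in auto)
  next
    assume R: "?R s"
    have "s = s \<inter> {a, b} \<union> s \<inter> {c, d}" using R I by blast
    also have "\<dots> = (if a \<in> s then {a, b} else {}) \<union> (if c \<in> s then {c, d} else {})"
      using R unfolding i1 i2 by simp
    also have "\<dots> \<in> split_field I {a, b}"
      unfolding split_field_def Iab unfolding I by (simp add: insert_commute)
    finally show "s \<in> split_field I {a, b}" .
  qed
  have ideal: "s \<in> ideal_field I U \<longleftrightarrow> s \<subseteq> I \<and> (p \<in> s \<longleftrightarrow> q \<in> s)" if "I - U = {p, q}" for s U p q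
  proof -
    have "s \<subseteq> U \<longleftrightarrow> s \<inter> (I - U) = {}" if "s \<subseteq> I" using that by blast
    then have "s \<subseteq> U \<longleftrightarrow> p \<notin> s \<and> q \<notin> s" if "s \<subseteq> I"
      using that \<open>I - U = {p, q}\<close> by simp
    then show ?thesis unfolding ideal_field_def \<open>I - U = {p, q}\<close> by auto
  qed
  have Icd: "I - {c, d} = {a, b}" using I dist by auto
  note id1 = ideal[OF Iab] and id2 = ideal[OF Icd]
  define p q where "p \<longleftrightarrow> {a} \<in> F" and "q \<longleftrightarrow> {c} \<in> F"
  note mem' = mem[folded p_def q_def]
  show ?thesis
    unfolding set_eq_iff mem' split id1 id2 Pow_iff by (cases p; cases q) simp_all
qed

text \<open>
  If \<open>U\<close> or its complement has at most one element, then one of the two fields is everything and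
  the other one is basic; otherwise their meet fails to be dual modular. So each of the three
  kinds of principal pair occurs.
\<close>

lemma principal_pair_ideal_fields:
  assumes U: "U \<subseteq> I"
  shows "principal_pair_for (fields_order I) (split_field I U) (ideal_field I U, ideal_field I (I - U))"
proof -
  let ?L = "fields_order I"
  have P: "ideal_field I U \<in> set_fields I" "ideal_field I (I - U) \<in> set_fields I"
    using U by (auto intro: ideal_field_in)
  consider "\<And>a b. a \<in> U \<Longrightarrow> b \<in> U \<Longrightarrow> a = b" | "\<And>a b. a \<in> I - U \<Longrightarrow> b \<in> I - U \<Longrightarrow> a = b"
    | a a' c c' where "a \<in> U" "a' \<in> U" "a' \<noteq> a" "c \<in> I - U" "c' \<in> I - U" "c' \<noteq> c"
    by metis
  then have "(ideal_field I U = Pow I \<and> basic ?L (ideal_field I (I - U))) \<or>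
     (ideal_field I (I - U) = Pow I \<and> basic ?L (ideal_field I U)) \<or>
     \<not> dual_modular ?L (split_field I U)"
  proof cases
    case 1
    show ?thesis
      using split_eq_ideal_field[OF U 1] basic_split_field[OF U] by simp
  next
    case 2
    have "I - (I - U) = U" using U by auto
    then show ?thesis
      using split_eq_ideal_field[of "I - U" I, OF _ 2] basic_split_field[of "I - U" I] by simp
  next
    case 3
    then show ?thesis using not_dual_modular_split_field[OF U] by blast
  qed
  then show ?thesis
    using U P by (auto simp: principal_pair_for_def principal_pair_def fields_meet fields_top
        ideal_field_Int dual_modular_ideal_field ideal_field_join_compl basic_split_field)
qed

text \<open>
  In the third kind of principal pair, the meet \<^term>\<open>split_field I U\<close> is not dual modular, so both
  \<open>U\<close> and its complement have at least two elements. On at most four points only two proper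
  fields remain above it, and these are the ones of the two ideals.
\<close>

lemma principal_pair_fields_cases:
  assumes U: "U \<subseteq> I" and I: "finite I" "card I \<le> 4"
    and pp: "principal_pair_for (fields_order I) (split_field I U) (F, G)"
  shows "(F, G) = (ideal_field I U, ideal_field I (I - U)) \<or>
    (F, G) = (ideal_field I (I - U), ideal_field I U)"
proof -
  let ?L = "fields_order I" and ?x = "split_field I U"
  have FG: "F \<in> set_fields I" "G \<in> set_fields I" and dm: "dual_modular ?L F" "dual_modular ?L G"
    using pp by (auto simp: principal_pair_for_def principal_pair_def dual_modular_def)
  have m: "F \<inter> G = ?x" using pp FG by (simp add: principal_pair_for_def fields_meet)
  have UU: "I - (I - U) = U" using U by auto
  show ?thesis
  proof (cases "(\<forall>a\<in>U. \<forall>b\<in>U. a = b) \<or> (\<forall>a\<in>I-U. \<forall>b\<in>I-U. a = b)")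
    case True
    then have eq: "ideal_field I U = ?x \<and> ideal_field I (I - U) = Pow I \<or>
        ideal_field I U = Pow I \<and> ideal_field I (I - U) = ?x"
      using split_eq_ideal_field[OF U] split_eq_ideal_field[of "I - U" I] split_field_compl[OF U] UU
      by auto
    have "dual_modular ?L ?x"
      using eq dual_modular_ideal_field[OF U] dual_modular_ideal_field[of "I - U" I]
      by (metis Diff_subset)
    then have "F = Pow I \<or> G = Pow I"
      using pp FG m by (auto simp: principal_pair_for_def principal_pair_def fields_meet fields_top)
    then have "(F, G) = (Pow I, ?x) \<or> (F, G) = (?x, Pow I)"
      using m FG set_fieldsD(1) by (metis inf.absorb2 inf.commute)
    then show ?thesis using eq by auto
  next
    case False
    then obtain a b c d where abcd: "a \<in> U" "b \<in> U" "a \<noteq> b" "c \<in> I - U" "d \<in> I - U" "c \<noteq> d" by auto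
    then have d: "distinct [a, b, c, d]" by auto
    have "{a, b, c, d} \<subseteq> I" "card {a, b, c, d} = 4" using abcd U d by auto
    then have Ie: "I = {a, b, c, d}" using I by (metis card_seteq)
    then have Ue: "U = {a, b}" "I - U = {c, d}" using abcd U by auto
    have nx: "\<not> dual_modular ?L ?x"
      using not_dual_modular_split_field[OF U abcd(1,2) _ abcd(4,5)] abcd by auto
    have UF: "U \<in> F" "U \<in> G" using m by (auto simp: split_field_def)
    have ne: "F \<noteq> ?x" "G \<noteq> ?x" using nx dm by auto
    then have ne': "F \<noteq> Pow I" "G \<noteq> Pow I" using m FG set_fieldsD(1) by blast+
    have "F \<noteq> G" using m ne by auto
    then show ?thesis
      using field_with_2_2[OF FG(1) Ie d] field_with_2_2[OF FG(2) Ie d] UF ne ne' Ue by auto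
  qed
qed

lemma ideal_field_mono: "U \<subseteq> V \<Longrightarrow> ideal_field I U \<subseteq> ideal_field I V"
  unfolding ideal_field_def by blast

lemma inj_on_image_subset_iff:
  "\<lbrakk>inj_on f C; A \<subseteq> C; B \<subseteq> C\<rbrakk> \<Longrightarrow> f ` A \<subseteq> f ` B \<longleftrightarrow> A \<subseteq> B"
  by (auto simp: inj_on_def) blast

lemma fields_join_idem:
  assumes "F \<in> set_fields I"
  shows "F \<squnion>\<^bsub>fields_order I\<^esub> F = F"
  using assms by (intro fields_join_eqI) auto

lemma ideal_field_eq_compl:
  assumes U: "U \<subseteq> I" and e: "ideal_field I U = ideal_field I (I - U)"
  shows "split_field I U = Pow I"
  using ideal_field_join_compl[OF U] ideal_field_Int[OF U] fields_join_idem[OF ideal_field_in[OF U]]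
  by (simp flip: e)

lemma ideal_eq_split_field:
  assumes "U \<subseteq> I" "U \<noteq> I" "ideal_field I U = split_field I U" "i \<in> U"
  shows "U = {i}"
proof -
  have "{i} \<in> ideal_field I U" unfolding ideal_field_def using assms(1,4) by auto
  then have "{i} \<in> split_field I U" by (simp only: assms(3))
  then consider "{i} = U" | "{i} = I - U" | "{i} = I" unfolding split_field_def by blast
  then show ?thesis
    by cases (use assms in blast)+
qed

section \<open>Arithmetic in an orthoalgebra\<close>

context orthoalgebra
begin

abbreviation zero_elt ("\<zero>") where "\<zero> \<equiv> ozero A"
abbreviation one_elt ("\<one>") where "\<one> \<equiv> oone A"
abbreviation compl_elt ("\<sim> _" [81] 80) where "\<sim> a \<equiv> ocompl A a"

lemma assoc_rl:
  assumes "a \<in> carrier A" "b \<in> carrier A" "c \<in> carrier A" "a \<oplus> b = Some s" "s \<oplus> c = Some t"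
  obtains u where "u \<in> carrier A" "b \<oplus> c = Some u" "a \<oplus> u = Some t"
proof -
  have "Option.bind (b \<oplus> c) (\<lambda>s. a \<oplus> s) = Some t"
    using osum_assoc[of a b c] assms by simp
  then obtain u where "b \<oplus> c = Some u" "a \<oplus> u = Some t" by (auto simp: bind_eq_Some_conv)
  then show thesis using that osum_closed[of b c] assms by blast
qed

lemma assoc_lr:
  assumes "a \<in> carrier A" "b \<in> carrier A" "c \<in> carrier A" "b \<oplus> c = Some u" "a \<oplus> u = Some t"
  obtains s where "s \<in> carrier A" "a \<oplus> b = Some s" "s \<oplus> c = Some t"
proof -
  have "Option.bind (a \<oplus> b) (\<lambda>s. s \<oplus> c) = Some t"
    using osum_assoc[of a b c] assms by simp
  then obtain s where "a \<oplus> b = Some s" "s \<oplus> c = Some t" by (auto simp: bind_eq_Some_conv)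
  then show thesis using that osum_closed[of a b] assms by blast
qed

lemma compl_compl [simp]: "a \<in> carrier A \<Longrightarrow> \<sim> (\<sim> a) = a"
  using ocompl_unique[of "\<sim> a" a] osum_ocompl[of a] osum_comm[of a "\<sim> a"] by (simp add: ocompl_closed)

lemma sum_compl_one:
  assumes a: "a \<in> carrier A"
  shows "a \<oplus> \<sim> \<one> = Some a"
proof -
  have c: "\<sim> a \<in> carrier A" "\<sim> \<one> \<in> carrier A" using a by (auto simp: ocompl_closed oone_closed)
  have "\<sim> a \<oplus> a = Some \<one>" using osum_ocompl[OF c(1)] a by simp
  then obtain u where u: "u \<in> carrier A" "a \<oplus> \<sim> \<one> = Some u" "\<sim> a \<oplus> u = Some \<one>"
    using assoc_rl[OF c(1) a c(2) _ osum_ocompl[OF oone_closed]] by blast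
  then show ?thesis using ocompl_unique[OF c(1) u(1,3)] a by simp
qed

lemma compl_one [simp]: "\<sim> \<one> = \<zero>"
  using sum_compl_one[of "\<sim> \<one>"] osum_self[of "\<sim> \<one>"] by (simp add: ocompl_closed oone_closed)

lemma compl_zero [simp]: "\<sim> \<zero> = \<one>"
  using compl_compl[OF oone_closed] by simp

lemma sum_zero [simp]: "a \<in> carrier A \<Longrightarrow> a \<oplus> \<zero> = Some a"
  using sum_compl_one by simp

lemma zero_sum [simp]: "a \<in> carrier A \<Longrightarrow> \<zero> \<oplus> a = Some a"
  using osum_comm[of \<zero> a] by (simp add: ozero_closed)

lemma compl_inj: "\<lbrakk>a \<in> carrier A; b \<in> carrier A; \<sim> a = \<sim> b\<rbrakk> \<Longrightarrow> a = b"
  using compl_compl by metis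

lemma sum_eq_zero:
  assumes a: "a \<in> carrier A" and b: "b \<in> carrier A" and s: "a \<oplus> b = Some \<zero>"
  shows "a = \<zero>" "b = \<zero>"
proof -
  show b0: "b = \<zero>"
    using assoc_rl[OF a b b s zero_sum[OF b]] osum_self[OF b] by (metis option.distinct(1))
  show "a = \<zero>" using s b0 a by simp
qed

lemma one_sum:
  assumes b: "b \<in> carrier A" and s: "\<one> \<oplus> b = Some s"
  shows "b = \<zero>"
proof -
  have "\<sim> b \<oplus> b = Some \<one>" using osum_ocompl[OF ocompl_closed[OF b]] b by simp
  then show ?thesis
    using assoc_rl[OF ocompl_closed[OF b] b b _ s] osum_self[OF b] by (metis option.distinct(1))
qed

text \<open>
  The usual exchange of the inner terms of \<open>(x \<oplus> y) \<oplus> (a \<oplus> b)\<close>; that the new sums are defined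
  follows from associativity in the sense of partial operations.
\<close>

lemma interchange:
  assumes c: "x \<in> carrier A" "y \<in> carrier A" "a \<in> carrier A" "b \<in> carrier A"
    and s: "x \<oplus> y = Some z" "a \<oplus> b = Some c" "z \<oplus> c = Some w"
  obtains u v where "x \<oplus> a = Some u" "y \<oplus> b = Some v" "u \<oplus> v = Some w"
proof -
  have cc: "c \<in> carrier A" "z \<in> carrier A"
    using osum_closed[OF c(3,4) s(2)] osum_closed[OF c(1,2) s(1)] .
  obtain u1 where u1: "u1 \<in> carrier A" "y \<oplus> c = Some u1" "x \<oplus> u1 = Some w"
    using assoc_rl[OF c(1,2) cc(1) s(1,3)] .
  obtain s1 where s1: "s1 \<in> carrier A" "y \<oplus> a = Some s1" "s1 \<oplus> b = Some u1"
    using assoc_lr[OF c(2-4) s(2) u1(2)] .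
  have "a \<oplus> y = Some s1" using s1 osum_comm c by simp
  then obtain v where v: "v \<in> carrier A" "y \<oplus> b = Some v" "a \<oplus> v = Some u1"
    using assoc_rl[OF c(3,2,4) _ s1(3)] by blast
  obtain u where "x \<oplus> a = Some u" "u \<oplus> v = Some w"
    using assoc_lr[OF c(1,3) v(1,3) u1(3)] by blast
  with v that show thesis by blast
qed

lemma ortho_subalgebraD:
  assumes "ortho_subalgebra A S"
  shows "S \<subseteq> carrier A" "\<zero> \<in> S" "\<one> \<in> S" "a \<in> S \<Longrightarrow> \<sim> a \<in> S"
    "\<lbrakk>a \<in> S; b \<in> S; a \<oplus> b = Some c\<rbrakk> \<Longrightarrow> c \<in> S"
  using assms unfolding ortho_subalgebra_def by blast+

lemma boolean_ortho_subalgebra: "boolean_subalgebra A S \<Longrightarrow> ortho_subalgebra A S"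
  by (simp add: boolean_subalgebra_def)

lemma subalgebra_orthoalgebra:
  assumes "ortho_subalgebra A S"
  shows "orthoalgebra (A\<lparr>carrier := S\<rparr>)"
proof -
  note S = ortho_subalgebraD[OF assms]
  let ?A = "A\<lparr>carrier := S\<rparr>"
  have e: "carrier ?A = S" "osum ?A = osum A" "ocompl ?A = ocompl A" "ozero ?A = \<zero>" "oone ?A = \<one>"
    by simp_all
  show ?thesis
  proof (rule orthoalgebra.intro, unfold e)
    fix a b c assume "a \<in> S" "b \<in> S" "c \<in> S"
    then show "Option.bind (a \<oplus> b) (\<lambda>s. s \<oplus> c) = Option.bind (b \<oplus> c) (\<lambda>s. a \<oplus> s)"
      using S(1) by (intro osum_assoc) auto
  next
    fix a b assume "a \<in> S" "b \<in> S"
    then show "a \<oplus> b = b \<oplus> a" using S(1) by (intro osum_comm) auto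
  next
    fix a b assume "a \<in> S" "b \<in> S" "a \<oplus> b = Some \<one>"
    then show "b = \<sim> a" using S(1) by (intro ocompl_unique) auto
  next
    fix a assume "a \<in> S"
    then have "a \<in> carrier A" using S(1) by auto
    then show "a \<oplus> a \<noteq> None \<longleftrightarrow> a = \<zero>" "a \<oplus> \<sim> a = Some \<one>"
      using osum_self[of a] osum_ocompl[of a] by simp_all
  qed (fact S)+
qed

section \<open>Finite Boolean subalgebras as frames\<close>

text \<open>
  A frame with \<open>n\<close> parts is a partition of \<open>\<one>\<close> into nonzero elements, given with all its
  partial sums, because pairwise orthogonal elements of an orthoalgebra need not have a joint
  sum.
\<close>

definition frame :: "nat \<Rightarrow> (nat set \<Rightarrow> 'a) \<Rightarrow> bool" where
  "frame n h \<longleftrightarrow> h {..<n} = \<one> \<and> (\<forall>U\<subseteq>{..<n}. h U \<in> carrier A) \<and> (\<forall>i<n. h {i} \<noteq> \<zero>) \<and>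
     (\<forall>U\<subseteq>{..<n}. \<forall>V\<subseteq>{..<n}. U \<inter> V = {} \<longrightarrow> h U \<oplus> h V = Some (h (U \<union> V)))"

context
  fixes n h assumes frame: "frame n h"
begin

lemma frame_top: "h {..<n} = \<one>" using frame by (simp add: frame_def)

lemma frame_closed: "U \<subseteq> {..<n} \<Longrightarrow> h U \<in> carrier A"
  using frame by (simp add: frame_def)

lemma frame_nonzero: "i < n \<Longrightarrow> h {i} \<noteq> \<zero>"
  using frame by (simp add: frame_def)

lemma frame_sum:
  "\<lbrakk>U \<subseteq> {..<n}; V \<subseteq> {..<n}; U \<inter> V = {}\<rbrakk> \<Longrightarrow> h U \<oplus> h V = Some (h (U \<union> V))"
  using frame by (simp add: frame_def)

lemma frame_empty: "h {} = \<zero>"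
  using frame_sum[of "{}" "{}"] osum_self[of "h {}"] frame_closed[of "{}"] by simp

lemma frame_compl: "U \<subseteq> {..<n} \<Longrightarrow> h ({..<n} - U) = \<sim> (h U)"
  using frame_sum[of U "{..<n} - U"] frame_top
  by (intro ocompl_unique) (auto simp: frame_closed Un_absorb1)

lemma frame_eq_zero:
  assumes U: "U \<subseteq> {..<n}" and z: "h U = \<zero>"
  shows "U = {}"
proof (rule ccontr)
  assume "U \<noteq> {}"
  then obtain i where i: "i \<in> U" by auto
  then have "h {i} \<oplus> h (U - {i}) = Some \<zero>"
    using U z frame_sum[of "{i}" "U - {i}"] by (auto simp: insert_absorb)
  moreover have "h {i} \<in> carrier A" "h (U - {i}) \<in> carrier A"
    using U i by (intro frame_closed; auto)+
  ultimately have "h {i} = \<zero>" by (intro sum_eq_zero(1))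
  then show False using U i frame_nonzero by auto
qed

text \<open>
  A common part would be orthogonal to itself, which only \<open>\<zero>\<close> is.
\<close>

lemma frame_orth:
  assumes U: "U \<subseteq> {..<n}" and V: "V \<subseteq> {..<n}" and s: "h U \<oplus> h V = Some s"
  shows "U \<inter> V = {}"
proof -
  let ?W = "U \<inter> V"
  have W: "?W \<subseteq> {..<n}" using U by auto
  have c: "h (U - ?W) \<in> carrier A" "h ?W \<in> carrier A" "h V \<in> carrier A" "h (V - ?W) \<in> carrier A"
    using U V by (intro frame_closed; auto)+
  have "h (U - ?W) \<oplus> h ?W = Some (h U)"
    using frame_sum[of "U - ?W" ?W] U V by (auto simp: Un_absorb2)
  then obtain u where u: "h ?W \<oplus> h V = Some u"
    using assoc_rl[OF c(1-3) _ s] by blast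
  have "?W \<union> (V - ?W) = V" by auto
  then have "h ?W \<oplus> h (V - ?W) = Some (h V)"
    using frame_sum[of ?W "V - ?W"] U V W by auto
  then obtain t where "h ?W \<oplus> h ?W = Some t"
    using assoc_lr[OF c(2,2,4) _ u] by blast
  then have "h ?W = \<zero>" using osum_self[of "h ?W"] W frame_closed by auto
  then show ?thesis using frame_eq_zero[OF W] by simp
qed

lemma frame_orth_iff:
  "\<lbrakk>U \<subseteq> {..<n}; V \<subseteq> {..<n}\<rbrakk> \<Longrightarrow> h U \<oplus> h V \<noteq> None \<longleftrightarrow> U \<inter> V = {}"
  using frame_orth frame_sum by blast

lemma frame_subset:
  assumes U: "U \<subseteq> {..<n}" and V: "V \<subseteq> {..<n}" and e: "h U = h V"
  shows "U \<subseteq> V"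
proof -
  have "h U \<oplus> h ({..<n} - V) \<noteq> None"
    using osum_ocompl[OF frame_closed[OF V]] by (simp add: frame_compl[OF V] e)
  then have "U \<inter> ({..<n} - V) = {}" using U by (subst (asm) frame_orth_iff) auto
  then show ?thesis using U by auto
qed

lemma frame_eq_iff: "\<lbrakk>U \<subseteq> {..<n}; V \<subseteq> {..<n}\<rbrakk> \<Longrightarrow> h U = h V \<longleftrightarrow> U = V"
  using frame_subset[of U V] frame_subset[of V U] by auto

lemma frame_inj: "inj_on h (Pow {..<n})"
  by (rule inj_onI) (simp add: frame_eq_iff)

lemma frame_card: "card (h ` Pow {..<n}) = 2 ^ n"
  by (simp add: card_image[OF frame_inj] card_Pow)

lemma frame_subalgebra:
  assumes F: "F \<in> set_fields {..<n}"
  shows "ortho_subalgebra A (h ` F)"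
proof -
  note D = set_fieldsD[OF F]
  have sub: "U \<subseteq> {..<n}" if "U \<in> F" for U using that D(1) by auto
  have "\<zero> \<in> h ` F" "\<one> \<in> h ` F" using D(2,3) frame_empty frame_top by (metis imageI)+
  moreover have "c \<in> h ` F" if "U \<in> F" "V \<in> F" "h U \<oplus> h V = Some c" for U V c
  proof -
    have "U \<inter> V = {}" using frame_orth[OF sub sub] that by blast
    then have "c = h (U \<union> V)" using frame_sum[OF sub sub] that by auto
    then show ?thesis using set_fields_Un[OF F] that by blast
  qed
  moreover have "\<sim> (h U) \<in> h ` F" if "U \<in> F" for U
    using frame_compl[OF sub[OF that]] D(4)[OF that] by (metis imageI)
  moreover have "h ` F \<subseteq> carrier A" using sub frame_closed by auto
  ultimately show ?thesis
    unfolding ortho_subalgebra_def by (simp only: ball_simps) blast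
qed

text \<open>
  The order of the field transported along \<open>h\<close> makes the image a Boolean lattice, and sums are
  joins of disjoint elements since \<open>h\<close> reflects disjointness.
\<close>

lemma frame_boolean:
  assumes F: "F \<in> set_fields {..<n}"
  shows "boolean_subalgebra A (h ` F)"
proof -
  note D = set_fieldsD[OF F]
  have sub: "U \<subseteq> {..<n}" if "U \<in> F" for U using that D(1) by auto
  define L :: "'a gorder" where "L = \<lparr>carrier = h ` F, eq = (=),
    le = (\<lambda>x y. \<exists>U\<in>F. \<exists>V\<in>F. x = h U \<and> y = h V \<and> U \<subseteq> V)\<rparr>"
  have carr: "carrier L = h ` F" by (simp add: L_def)
  have le: "h U \<sqsubseteq>\<^bsub>L\<^esub> h V \<longleftrightarrow> U \<subseteq> V" if "U \<in> F" "V \<in> F" for U V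
    using that by (auto simp: L_def frame_eq_iff sub)
  have heq: "h U = h V \<longleftrightarrow> U = V" if "U \<in> F" "V \<in> F" for U V
    using that by (simp add: frame_eq_iff sub)
  interpret L: partial_order L
  proof unfold_locales
    show "(.=\<^bsub>L\<^esub>) = (=)" by (simp add: L_def)
    fix x y z assume "x \<sqsubseteq>\<^bsub>L\<^esub> y" "y \<sqsubseteq>\<^bsub>L\<^esub> z" "x \<in> carrier L" "y \<in> carrier L" "z \<in> carrier L"
    then show "x \<sqsubseteq>\<^bsub>L\<^esub> z" by (auto simp: carr le)
  qed (auto simp: carr le L_def heq)
  have lub: "is_lub L (h (U \<union> V)) {h U, h V}" if "U \<in> F" "V \<in> F" for U V
    using that set_fields_Un[OF F that] by (auto simp: is_lub_pair carr le)
  have glb: "is_glb L (h (U \<inter> V)) {h U, h V}" if "U \<in> F" "V \<in> F" for U V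
    using that D(5)[OF that] by (auto simp: is_glb_pair carr le)
  note join = L.join_eqI[OF lub] and meet = L.meet_eqI[OF glb]
  have bot: "\<bottom>\<^bsub>L\<^esub> = h {}" by (rule L.bottom_eqI) (auto simp: carr le D(2))
  have top: "\<top>\<^bsub>L\<^esub> = h {..<n}" by (rule L.top_eqI) (use sub in \<open>auto simp: carr le D(3)\<close>)
  have "boolean_lattice L"
  proof unfold_locales
    fix x y assume "x \<in> carrier L" "y \<in> carrier L"
    then show "\<exists>s. is_lub L s {x, y}" "\<exists>s. is_glb L s {x, y}"
      using lub glb by (force simp: carr)+
  next
    show "\<exists>x. least L x (carrier L)" "\<exists>x. greatest L x (carrier L)"
      using D(2,3) sub by (auto simp: least_def greatest_def carr le
          intro!: exI[of _ "h {}"] exI[of _ "h {..<n}"])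
  next
    fix x y z assume "x \<in> carrier L" "y \<in> carrier L" "z \<in> carrier L"
    then obtain U V W where UVW: "U \<in> F" "V \<in> F" "W \<in> F" "x = h U" "y = h V" "z = h W"
      by (auto simp: carr)
    then show "x \<sqinter>\<^bsub>L\<^esub> (y \<squnion>\<^bsub>L\<^esub> z) = x \<sqinter>\<^bsub>L\<^esub> y \<squnion>\<^bsub>L\<^esub> (x \<sqinter>\<^bsub>L\<^esub> z)"
      by (simp add: join meet set_fields_Un[OF F] D(5) Int_Un_distrib)
  next
    fix x assume "x \<in> carrier L"
    then obtain U where U: "U \<in> F" "x = h U" by (auto simp: carr)
    then have "x \<sqinter>\<^bsub>L\<^esub> h ({..<n} - U) = \<bottom>\<^bsub>L\<^esub>" "x \<squnion>\<^bsub>L\<^esub> h ({..<n} - U) = \<top>\<^bsub>L\<^esub>"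
      using sub[OF U(1)] by (auto simp: join meet D(4) bot top Un_absorb1)
    then show "\<exists>y\<in>carrier L. x \<sqinter>\<^bsub>L\<^esub> y = \<bottom>\<^bsub>L\<^esub> \<and> x \<squnion>\<^bsub>L\<^esub> y = \<top>\<^bsub>L\<^esub>"
      using D(4)[OF U(1)] by (auto simp: carr)
  qed
  moreover have "a \<sqinter>\<^bsub>L\<^esub> \<sim> a = \<bottom>\<^bsub>L\<^esub> \<and> a \<squnion>\<^bsub>L\<^esub> \<sim> a = \<top>\<^bsub>L\<^esub>" if "a \<in> h ` F" for a
  proof -
    obtain U where U: "U \<in> F" "a = h U" using \<open>a \<in> h ` F\<close> by auto
    then show ?thesis
      using sub[OF U(1)] by (simp add: frame_compl[symmetric] join meet D(4) bot top Un_absorb1)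
  qed
  moreover have "a \<oplus> b = (if a \<sqinter>\<^bsub>L\<^esub> b = \<bottom>\<^bsub>L\<^esub> then Some (a \<squnion>\<^bsub>L\<^esub> b) else None)"
    if "a \<in> h ` F" "b \<in> h ` F" for a b
  proof -
    obtain U V where UV: "U \<in> F" "a = h U" "V \<in> F" "b = h V" using \<open>a \<in> h ` F\<close> \<open>b \<in> h ` F\<close> by auto
    have "h (U \<inter> V) = h {} \<longleftrightarrow> U \<inter> V = {}" using UV D by (intro heq) auto
    then show ?thesis
      using frame_orth_iff[OF sub sub, of U V] frame_sum[OF sub sub, of U V] UV
      by (auto simp: join meet bot)
  qed
  ultimately have "boolean_orthoalgebra (A\<lparr>carrier := h ` F\<rparr>)"
    unfolding boolean_orthoalgebra_def
    using subalgebra_orthoalgebra[OF frame_subalgebra[OF F]]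
    by (intro conjI exI[of _ L]) (auto simp: carr bot top frame_empty frame_top)
  then show ?thesis using frame_subalgebra[OF F] by (simp add: boolean_subalgebra_def)
qed

end

text \<open>
  The least Boolean subalgebra has a single part, and no part at all if \<open>\<zero> = \<one>\<close>.
\<close>

lemma base_frame:
  "frame (if \<zero> = \<one> then 0 else 1) (\<lambda>U. if U = {} then \<zero> else \<one>)"
  (is "frame ?n ?h")
proof -
  have c: "\<zero> \<in> carrier A" "\<one> \<in> carrier A" by (rule ozero_closed oone_closed)+
  have *: "U = {} \<or> V = {}" if "U \<subseteq> {..<?n}" "V \<subseteq> {..<?n}" "U \<inter> V = {}" for U V
  proof -
    have "{..<?n} \<subseteq> {0}" by auto
    then have "U = {} \<or> U = {0}" "V = {} \<or> V = {0}" using that by blast+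
    then show ?thesis using that(3) by auto
  qed
  have "?h U \<oplus> ?h V = Some (?h (U \<union> V))"
    if "U \<subseteq> {..<?n}" "V \<subseteq> {..<?n}" "U \<inter> V = {}" for U V
    using *[OF that] c by auto
  moreover have "?h {..<?n} = \<one>" by (simp add: lessThan_Suc)
  moreover have "?h {i} \<noteq> \<zero>" if "i < ?n" for i using that by (simp split: if_splits)
  ultimately show ?thesis unfolding frame_def using c by simp
qed

subsection \<open>Splitting a part\<close>

text \<open>
  Part \<open>i\<close> is replaced by \<open>p\<close>, which keeps the index \<open>i\<close>, and \<open>q\<close>, which gets the new index \<open>n\<close>.
  A partial sum is formed from the old parts other than \<open>i\<close> and a summand below the old part \<open>i\<close>.
\<close>

definition split_part :: "nat \<Rightarrow> (nat set \<Rightarrow> 'a) \<Rightarrow> nat \<Rightarrow> 'a \<Rightarrow> 'a \<Rightarrow> nat set \<Rightarrow> 'a" where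
  "split_part n h i p q U = the (h (U \<inter> {..<n} - {i}) \<oplus>
     (if i \<in> U then if n \<in> U then h {i} else p else if n \<in> U then q else \<zero>))"

context
  fixes n h i p q
  assumes frame: "frame n h" and i: "i < n" and pq: "p \<in> carrier A" "q \<in> carrier A"
    "p \<noteq> \<zero>" "q \<noteq> \<zero>" "p \<oplus> q = Some (h {i})"
begin

private abbreviation "h' \<equiv> split_part n h i p q"
private definition "e U = (if i \<in> U then if n \<in> U then h {i} else p else if n \<in> U then q else \<zero>)"

private lemma split_part_e: "h' U = the (h (U \<inter> {..<n} - {i}) \<oplus> e U)"
  by (simp only: split_part_def e_def)

private lemma hi: "h {i} \<in> carrier A" using frame_closed[OF frame] i by auto

private lemma e_closed: "e U \<in> carrier A"
  using hi pq ozero_closed by (simp add: e_def)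

private lemma e_sum: "U \<inter> V = {} \<Longrightarrow> e U \<oplus> e V = Some (e (U \<union> V))"
  using pq hi osum_comm[of p q] by (auto simp: e_def ozero_closed)

private lemma e_le: "\<exists>d\<in>carrier A. e U \<oplus> d = Some (h {i})"
  using pq hi osum_comm[of p q] unfolding e_def by (auto simp: ozero_closed intro: bexI[of _ \<zero>])

private lemma he_defined:
  assumes U: "U \<subseteq> {..<n} - {i}"
  shows "\<exists>s\<in>carrier A. h U \<oplus> e V = Some s"
proof -
  have c: "h U \<in> carrier A" using U by (intro frame_closed[OF frame]) auto
  obtain d where d: "d \<in> carrier A" "e V \<oplus> d = Some (h {i})" using e_le by blast
  have "h U \<oplus> h {i} = Some (h (U \<union> {i}))" using U i by (intro frame_sum[OF frame]) auto
  then show ?thesis using assoc_lr[OF c e_closed d(1,2)] by blast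
qed

lemma split_part_sum:
  assumes "U \<inter> V = {}"
  shows "h' U \<oplus> h' V = Some (h' (U \<union> V))"
proof -
  let ?U = "U \<inter> {..<n} - {i}" and ?V = "V \<inter> {..<n} - {i}" and ?W = "(U \<union> V) \<inter> {..<n} - {i}"
  have "?U \<union> ?V = ?W" by auto
  then have s: "h ?U \<oplus> h ?V = Some (h ?W)"
    using frame_sum[OF frame, of ?U ?V] assms by auto
  have c: "h ?U \<in> carrier A" "h ?V \<in> carrier A" by (intro frame_closed[OF frame]; auto)+
  obtain w where w: "h ?W \<oplus> e (U \<union> V) = Some w" using he_defined[of ?W "U \<union> V"] by blast
  obtain u v where "h ?U \<oplus> e U = Some u" "h ?V \<oplus> e V = Some v" "u \<oplus> v = Some w"
    using interchange[OF c e_closed e_closed s e_sum[OF assms] w] .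
  with w show ?thesis by (simp only: split_part_e option.sel)
qed

lemma split_part_closed: "h' U \<in> carrier A"
proof -
  have "U \<inter> {..<n} - {i} \<subseteq> {..<n} - {i}" by auto
  from he_defined[OF this] obtain s
    where "s \<in> carrier A" "h (U \<inter> {..<n} - {i}) \<oplus> e U = Some s" by blast
  then show ?thesis by (simp only: split_part_e option.sel)
qed

lemma split_part_left: "h' {i} = p"
  using i pq by (simp add: split_part_def frame_empty[OF frame])

lemma split_part_right: "h' {n} = q"
  using i pq by (simp add: split_part_def frame_empty[OF frame])

lemma split_part_keep:
  assumes "U \<subseteq> {..<n}" "i \<notin> U"
  shows "h' U = h U"
proof -
  have "n \<notin> U" "U \<inter> {..<n} - {i} = U" using assms by auto
  then show ?thesis using assms frame_closed[OF frame] by (simp add: split_part_def)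
qed

lemma split_part_both:
  assumes "U \<subseteq> {..<n}" "i \<in> U"
  shows "h' (insert n U) = h U"
proof -
  have "insert n U \<inter> {..<n} - {i} = U - {i}" using assms by auto
  moreover have "h (U - {i}) \<oplus> h {i} = Some (h (U - {i} \<union> {i}))"
    using assms i by (intro frame_sum[OF frame]) auto
  ultimately show ?thesis using assms by (simp add: split_part_def insert_absorb)
qed

lemma frame_split_part: "frame (Suc n) h'"
proof -
  have "h' {..<Suc n} = \<one>"
    using split_part_both[of "{..<n}"] i frame_top[OF frame] by (simp add: lessThan_Suc)
  moreover have "h' {j} \<noteq> \<zero>" if "j < Suc n" for j
  proof -
    consider "j = i" | "j = n" | "j < n" "j \<noteq> i" using \<open>j < Suc n\<close> by linarith
    then show ?thesis
      by cases (use pq split_part_left split_part_right split_part_keep[of "{j}"]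
          frame_nonzero[OF frame, of j] in auto)
  qed
  ultimately show ?thesis
    unfolding frame_def using split_part_closed split_part_sum by blast
qed

lemma split_part_image: "h ` Pow {..<n} \<subseteq> h' ` Pow {..<Suc n}"
proof
  fix x assume "x \<in> h ` Pow {..<n}"
  then obtain U where U: "U \<subseteq> {..<n}" "x = h U" by auto
  show "x \<in> h' ` Pow {..<Suc n}"
  proof (cases "i \<in> U")
    case True
    then have "x = h' (insert n U)" using split_part_both U by simp
    moreover have "insert n U \<in> Pow {..<Suc n}" using U by auto
    ultimately show ?thesis by (rule image_eqI)
  next
    case False
    then have "x = h' U" using split_part_keep U by simp
    moreover have "U \<in> Pow {..<Suc n}" using U by auto
    ultimately show ?thesis by (rule image_eqI)
  qed
qed

end

lemma frame_image_le:
  assumes "frame n h" and T: "ortho_subalgebra A T" and "\<And>i. i < n \<Longrightarrow> h {i} \<in> T"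
  shows "h ` Pow {..<n} \<subseteq> T"
proof -
  have "h U \<in> T" if "finite U" "U \<subseteq> {..<n}" for U
    using that
  proof induction
    case empty
    then show ?case using ortho_subalgebraD(2)[OF T] frame_empty[OF assms(1)] by simp
  next
    case (insert i U)
    then have "h {i} \<oplus> h U = Some (h (insert i U))" using frame_sum[OF assms(1), of "{i}" U] by auto
    then show ?case using insert assms(3)[of i] ortho_subalgebraD(5)[OF T, of "h {i}" "h U"] by simp
  qed
  then have "h U \<in> T" if "U \<subseteq> {..<n}" for U
    using that finite_subset[OF that finite_lessThan] by blast
  then show ?thesis by blast
qed

section \<open>Boolean subalgebras\<close>

lemma boolean_subalgebra_lattice:
  assumes "boolean_subalgebra A S"
  obtains L :: "'a gorder" where "boolean_lattice L" "carrier L = S" "\<bottom>\<^bsub>L\<^esub> = \<zero>" "\<top>\<^bsub>L\<^esub> = \<one>"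
    "\<forall>a\<in>S. a \<sqinter>\<^bsub>L\<^esub> \<sim> a = \<zero>" "\<forall>a\<in>S. a \<squnion>\<^bsub>L\<^esub> \<sim> a = \<one>"
    "\<forall>a\<in>S. \<forall>b\<in>S. a \<oplus> b = (if a \<sqinter>\<^bsub>L\<^esub> b = \<zero> then Some (a \<squnion>\<^bsub>L\<^esub> b) else None)"
proof -
  have "boolean_orthoalgebra (A\<lparr>carrier := S\<rparr>)" using assms by (simp add: boolean_subalgebra_def)
  then obtain L :: "'a gorder" where L: "boolean_lattice L" "carrier L = S"
    "\<zero> = \<bottom>\<^bsub>L\<^esub>" "\<one> = \<top>\<^bsub>L\<^esub>"
    "\<forall>a\<in>S. a \<sqinter>\<^bsub>L\<^esub> \<sim> a = \<bottom>\<^bsub>L\<^esub> \<and> a \<squnion>\<^bsub>L\<^esub> \<sim> a = \<top>\<^bsub>L\<^esub>"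
    "\<forall>a\<in>S. \<forall>b\<in>S. a \<oplus> b = (if a \<sqinter>\<^bsub>L\<^esub> b = \<bottom>\<^bsub>L\<^esub> then Some (a \<squnion>\<^bsub>L\<^esub> b) else None)"
    unfolding boolean_orthoalgebra_def by auto
  then show thesis by (intro that[of L]) auto
qed

text \<open>
  In a Boolean algebra \<open>s\<close> and \<open>t\<close> decompose into their meet \<open>p\<close> and the differences \<open>q\<close> and \<open>r\<close>, a
  decomposition that can be stated in terms of the sum alone.
\<close>

lemma boolean_split:
  assumes S: "boolean_subalgebra A S" and st: "s \<in> S" "t \<in> S"
  obtains p q r where "p \<in> S" "q \<in> S" "r \<in> S" "p \<oplus> q = Some s" "p \<oplus> r = Some t" "s \<oplus> r \<noteq> None"
proof -
  obtain L :: "'a gorder" where L: "boolean_lattice L" and carr: "carrier L = S"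
    and bt: "\<bottom>\<^bsub>L\<^esub> = \<zero>" "\<top>\<^bsub>L\<^esub> = \<one>"
    and c': "\<forall>a\<in>S. a \<sqinter>\<^bsub>L\<^esub> \<sim> a = \<zero>" "\<forall>a\<in>S. a \<squnion>\<^bsub>L\<^esub> \<sim> a = \<one>"
    and sum': "\<forall>a\<in>S. \<forall>b\<in>S. a \<oplus> b = (if a \<sqinter>\<^bsub>L\<^esub> b = \<zero> then Some (a \<squnion>\<^bsub>L\<^esub> b) else None)"
    using boolean_subalgebra_lattice[OF S] by metis
  note sum = sum'[rule_format]
  note c = c'(1)[rule_format] c'(2)[rule_format]
  interpret L: boolean_lattice L by fact
  have tbS: "\<top>\<^bsub>L\<^esub> \<in> S" "\<bottom>\<^bsub>L\<^esub> \<in> S" using L.top_closed L.bottom_closed carr by simp_all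
  have le_top: "x \<sqsubseteq>\<^bsub>L\<^esub> \<top>\<^bsub>L\<^esub>" "\<bottom>\<^bsub>L\<^esub> \<sqsubseteq>\<^bsub>L\<^esub> x" if "x \<in> S" for x using that carr by auto
  have cS: "\<sim> a \<in> S" if "a \<in> S" for a
    using ortho_subalgebraD(4)[OF boolean_ortho_subalgebra[OF S] that] .
  have disj: "x \<sqinter>\<^bsub>L\<^esub> y = \<zero>" if "x \<in> S" "y \<in> S" "a \<in> S" "x \<sqsubseteq>\<^bsub>L\<^esub> a" "y \<sqsubseteq>\<^bsub>L\<^esub> \<sim> a" for x y a
  proof -
    have "x \<sqinter>\<^bsub>L\<^esub> y \<sqsubseteq>\<^bsub>L\<^esub> a \<sqinter>\<^bsub>L\<^esub> \<sim> a"
      using that cS[OF that(3)] unfolding carr[symmetric]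
      by (meson L.le_trans L.meet_closed L.meet_le L.meet_left L.meet_right)
    then have "x \<sqinter>\<^bsub>L\<^esub> y \<sqsubseteq>\<^bsub>L\<^esub> \<bottom>\<^bsub>L\<^esub>" using that by (simp add: c bt)
    moreover have "x \<sqinter>\<^bsub>L\<^esub> y \<in> carrier L" using that unfolding carr[symmetric] by simp
    ultimately have "x \<sqinter>\<^bsub>L\<^esub> y = \<bottom>\<^bsub>L\<^esub>" by (intro L.le_antisym) auto
    then show ?thesis using bt(1) by simp
  qed
  have dec: "x \<sqinter>\<^bsub>L\<^esub> y \<oplus> x \<sqinter>\<^bsub>L\<^esub> \<sim> y = Some x" if "x \<in> S" "y \<in> S" for x y
  proof -
    have m: "x \<sqinter>\<^bsub>L\<^esub> y \<in> S" "x \<sqinter>\<^bsub>L\<^esub> \<sim> y \<in> S" using that cS unfolding carr[symmetric] by auto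
    have "(x \<sqinter>\<^bsub>L\<^esub> y) \<sqinter>\<^bsub>L\<^esub> (x \<sqinter>\<^bsub>L\<^esub> \<sim> y) = \<zero>"
      using that m cS by (intro disj[of _ _ y]) (auto simp: carr[symmetric] L.meet_right)
    moreover have "x \<sqinter>\<^bsub>L\<^esub> y \<squnion>\<^bsub>L\<^esub> (x \<sqinter>\<^bsub>L\<^esub> \<sim> y) = x \<sqinter>\<^bsub>L\<^esub> (y \<squnion>\<^bsub>L\<^esub> \<sim> y)"
      using L.meet_join_distrib[of x y "\<sim> y"] that cS by (simp add: carr)
    moreover have "\<dots> = x"
      using L.le_iff_join[of x "\<top>\<^bsub>L\<^esub>"] that tbS le_top by (simp add: c carr flip: bt)
    ultimately show ?thesis using m by (simp add: sum)
  qed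
  show thesis
  proof (rule that)
    show "s \<sqinter>\<^bsub>L\<^esub> t \<in> S" "s \<sqinter>\<^bsub>L\<^esub> \<sim> t \<in> S" "t \<sqinter>\<^bsub>L\<^esub> \<sim> s \<in> S"
      using st cS unfolding carr[symmetric] by auto
    show "s \<sqinter>\<^bsub>L\<^esub> t \<oplus> s \<sqinter>\<^bsub>L\<^esub> \<sim> t = Some s" using dec st by simp
    show "s \<sqinter>\<^bsub>L\<^esub> t \<oplus> t \<sqinter>\<^bsub>L\<^esub> \<sim> s = Some t" using dec[OF st(2,1)] by (simp add: meet_comm[of L t s])
    have "s \<sqinter>\<^bsub>L\<^esub> (t \<sqinter>\<^bsub>L\<^esub> \<sim> s) = \<zero>"
      using st cS by (intro disj[of _ _ s]) (auto simp: carr[symmetric] L.meet_right)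
    moreover have "t \<sqinter>\<^bsub>L\<^esub> \<sim> s \<in> S" using st cS unfolding carr[symmetric] by auto
    ultimately show "s \<oplus> t \<sqinter>\<^bsub>L\<^esub> \<sim> s \<noteq> None" using st by (simp add: sum)
  qed
qed

text \<open>
  If \<open>s\<close> splits no part of the frame then, by distributivity, the meet of \<open>s\<close> with any union of
  parts, and in particular \<open>s\<close> itself, is a union of parts.
\<close>

lemma frame_splits:
  assumes S: "boolean_subalgebra A S" and fr: "frame n h" and sub: "h ` Pow {..<n} \<subseteq> S"
    and s: "s \<in> S" "s \<notin> h ` Pow {..<n}"
  obtains i p q where "i < n" "p \<in> S" "q \<in> S" "p \<noteq> \<zero>" "q \<noteq> \<zero>" "p \<oplus> q = Some (h {i})"
proof -
  obtain L :: "'a gorder" where L: "boolean_lattice L" and carr: "carrier L = S"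
    and bt: "\<bottom>\<^bsub>L\<^esub> = \<zero>" "\<top>\<^bsub>L\<^esub> = \<one>"
    and sum': "\<forall>a\<in>S. \<forall>b\<in>S. a \<oplus> b = (if a \<sqinter>\<^bsub>L\<^esub> b = \<zero> then Some (a \<squnion>\<^bsub>L\<^esub> b) else None)"
    using boolean_subalgebra_lattice[OF S] by metis
  note sum = sum'[rule_format]
  interpret L: boolean_lattice L by fact
  have tbS: "\<top>\<^bsub>L\<^esub> \<in> S" "\<bottom>\<^bsub>L\<^esub> \<in> S" using L.top_closed L.bottom_closed carr by simp_all
  have le_top: "x \<sqsubseteq>\<^bsub>L\<^esub> \<top>\<^bsub>L\<^esub>" "\<bottom>\<^bsub>L\<^esub> \<sqsubseteq>\<^bsub>L\<^esub> x" if "x \<in> S" for x using that carr by auto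
  have SA: "S \<subseteq> carrier A" using ortho_subalgebraD(1)[OF boolean_ortho_subalgebra[OF S]] .
  have hS: "h U \<in> S" if "U \<subseteq> {..<n}" for U using that sub by auto
  note splitI = that
  show thesis
  proof (rule ccontr)
    assume no: "\<not> thesis"
    have part: "s \<sqinter>\<^bsub>L\<^esub> h {i} = \<zero> \<or> s \<sqinter>\<^bsub>L\<^esub> h {i} = h {i}" if "i < n" for i
    proof -
      have hi: "h {i} \<in> S" using hS that by auto
      let ?p = "s \<sqinter>\<^bsub>L\<^esub> h {i}"
      have pS: "?p \<in> S" using s hi unfolding carr[symmetric] by simp
      obtain p q r where *: "p \<in> S" "q \<in> S" "r \<in> S" "p \<oplus> q = Some (h {i})" "p \<oplus> r = Some ?p"
        "h {i} \<oplus> r \<noteq> None"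
        using boolean_split[OF S hi pS] .
      have "?p \<sqsubseteq>\<^bsub>L\<^esub> h {i}" using s hi unfolding carr[symmetric] by (simp add: L.meet_right)
      have r_le: "r \<sqsubseteq>\<^bsub>L\<^esub> ?p"
        using *(5) sum[OF *(1,3)] L.join_right[of p r] *(1,3) by (auto simp: carr split: if_splits)
      then have "r \<sqsubseteq>\<^bsub>L\<^esub> h {i}" using \<open>?p \<sqsubseteq>\<^bsub>L\<^esub> h {i}\<close> L.le_trans *(3) pS hi carr by metis
      then have "h {i} \<sqinter>\<^bsub>L\<^esub> r = r"
        using L.le_iff_join[of r "h {i}"] *(3) hi by (simp add: carr meet_comm)
      then have "r = \<zero>" using *(6) sum[OF hi *(3)] by (simp split: if_splits)
      then have "p = ?p" using *(1,5) SA by auto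
      then show ?thesis
        using no splitI[of i p q] *(1,2,4) \<open>i < n\<close> SA by (cases "q = \<zero>") auto
    qed
    have "s \<sqinter>\<^bsub>L\<^esub> h U \<in> h ` Pow {..<n}" if "finite U" "U \<subseteq> {..<n}" for U
      using that
    proof induction
      case empty
      have "s \<sqinter>\<^bsub>L\<^esub> \<bottom>\<^bsub>L\<^esub> = \<bottom>\<^bsub>L\<^esub>"
        using L.le_iff_join[of "\<bottom>\<^bsub>L\<^esub>" s] s tbS le_top by (simp add: carr meet_comm)
      then show ?case by (auto simp: frame_empty[OF fr] bt intro: image_eqI[of _ _ "{}"])
    next
      case (insert i U)
      then obtain V where V: "V \<subseteq> {..<n}" "s \<sqinter>\<^bsub>L\<^esub> h U = h V" by auto
      have i: "i < n" "{i} \<subseteq> {..<n}" "U \<subseteq> {..<n}" using insert by auto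
      have hh: "h U \<in> S" "h {i} \<in> S" using hS i by auto
      have "h U \<oplus> h {i} = Some (h (insert i U))"
        using frame_sum[OF fr i(3,2)] insert by simp
      then have e: "h (insert i U) = h U \<squnion>\<^bsub>L\<^esub> h {i}" and d: "h U \<sqinter>\<^bsub>L\<^esub> h {i} = \<zero>"
        using sum[OF hh] by (simp_all split: if_splits)
      have m: "s \<sqinter>\<^bsub>L\<^esub> h (insert i U) = h V \<squnion>\<^bsub>L\<^esub> (s \<sqinter>\<^bsub>L\<^esub> h {i})"
        using L.meet_join_distrib[of s "h U" "h {i}"] s hh V by (simp add: e carr)
      show ?case
      proof (cases "s \<sqinter>\<^bsub>L\<^esub> h {i} = \<zero>")
        case True
        have "h V \<squnion>\<^bsub>L\<^esub> \<bottom>\<^bsub>L\<^esub> = h V"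
          using L.le_iff_meet[of "\<bottom>\<^bsub>L\<^esub>" "h V"] hS[OF V(1)] tbS le_top by (simp add: carr join_comm)
        then show ?thesis using V(1) by (simp add: m True bt)
      next
        case False
        then have e': "s \<sqinter>\<^bsub>L\<^esub> h {i} = h {i}" using part[OF i(1)] by blast
        have hV: "h V \<in> S" using hS V by auto
        have "h V \<sqinter>\<^bsub>L\<^esub> h {i} \<sqsubseteq>\<^bsub>L\<^esub> h U \<sqinter>\<^bsub>L\<^esub> h {i}"
        proof -
          have le: "h V \<sqsubseteq>\<^bsub>L\<^esub> h U" unfolding V(2)[symmetric]
            using s hh by (simp add: carr L.meet_right)
          show ?thesis using hV hh le unfolding carr[symmetric]
            by (meson L.le_trans L.meet_closed L.meet_le L.meet_left L.meet_right)
        qed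
        then have "h V \<sqinter>\<^bsub>L\<^esub> h {i} = \<bottom>\<^bsub>L\<^esub>"
          using hV hh L.meet_closed[of "h V" "h {i}"] tbS le_top
          by (intro L.le_antisym) (auto simp: d carr bt)
        then have "h V \<oplus> h {i} = Some (h V \<squnion>\<^bsub>L\<^esub> h {i})" using sum[OF hV hh(2)] bt by simp
        moreover from this have "V \<inter> {i} = {}" by (rule frame_orth[OF fr V(1) i(2)])
        then have "h V \<oplus> h {i} = Some (h (V \<union> {i}))" by (rule frame_sum[OF fr V(1) i(2)])
        ultimately have "s \<sqinter>\<^bsub>L\<^esub> h (insert i U) = h (V \<union> {i})" by (simp add: m e')
        moreover have "V \<union> {i} \<in> Pow {..<n}" using V i by auto
        ultimately show ?thesis by (rule image_eqI)
      qed
    qed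
    from this[of "{..<n}"] have "s \<sqinter>\<^bsub>L\<^esub> \<top>\<^bsub>L\<^esub> \<in> h ` Pow {..<n}"
      by (simp add: frame_top[OF fr] bt)
    moreover have "s \<sqinter>\<^bsub>L\<^esub> \<top>\<^bsub>L\<^esub> = s" using L.le_iff_join[of s "\<top>\<^bsub>L\<^esub>"] s tbS le_top by (simp add: carr)
    ultimately show False using s by simp
  qed
qed

lemma frame_extend:
  assumes S: "boolean_subalgebra A S" and fr: "frame n h" and sub: "h ` Pow {..<n} \<subset> S"
  obtains h' where "frame (Suc n) h'" "h' ` Pow {..<Suc n} \<subseteq> S" "h ` Pow {..<n} \<subseteq> h' ` Pow {..<Suc n}"
proof -
  have oS: "ortho_subalgebra A S" using S by (rule boolean_ortho_subalgebra)
  have SA: "S \<subseteq> carrier A" using ortho_subalgebraD(1)[OF oS] .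
  obtain s where "s \<in> S" "s \<notin> h ` Pow {..<n}" using sub by auto
  then obtain i p q where *: "i < n" "p \<in> S" "q \<in> S" "p \<noteq> \<zero>" "q \<noteq> \<zero>" "p \<oplus> q = Some (h {i})"
    using frame_splits[OF S fr] sub by blast
  then have pq: "p \<in> carrier A" "q \<in> carrier A" using SA by auto
  let ?h = "split_part n h i p q"
  note sp = fr *(1) pq *(4-6)
  have fr': "frame (Suc n) ?h" by (rule frame_split_part[OF sp])
  have "?h {j} \<in> S" if "j < Suc n" for j
  proof -
    consider "j = i" | "j = n" | "j < n" "j \<noteq> i" using \<open>j < Suc n\<close> by linarith
    then show ?thesis
      by cases (use * split_part_left[OF sp] split_part_right[OF sp] split_part_keep[OF sp, of "{j}"]
          sub in auto)
  qed
  then have "?h ` Pow {..<Suc n} \<subseteq> S" by (rule frame_image_le[OF fr' oS])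
  then show thesis using that fr' split_part_image[OF sp] by blast
qed

text \<open>
  Splitting parts as long as possible starting from \<open>{\<zero>, \<one>}\<close> either exhausts \<open>S\<close> after at most \<open>k\<close>
  parts or reaches \<open>k + 1\<close> parts.
\<close>

lemma boolean_frame_or_larger:
  assumes S: "boolean_subalgebra A S"
  shows "(\<exists>n h. n \<le> k \<and> frame n h \<and> S = h ` Pow {..<n}) \<or>
    (\<exists>h. frame (Suc k) h \<and> h ` Pow {..<Suc k} \<subseteq> S)"
proof (induction k)
  case 0
  let ?h = "\<lambda>U. if U = {} then \<zero> else \<one>"
  have S01: "\<zero> \<in> S" "\<one> \<in> S" and SA: "S \<subseteq> carrier A"
    by (rule ortho_subalgebraD[OF boolean_ortho_subalgebra[OF S]])+
  show ?case
  proof (cases "\<zero> = \<one>")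
    case True
    then have fr: "frame 0 ?h" using base_frame by simp
    have "a = \<zero>" if "a \<in> carrier A" for a
      using one_sum[OF that] that True by (metis zero_sum)
    then have "S = ?h ` Pow {..<0}" using S01 SA by auto
    with fr show ?thesis by blast
  next
    case False
    then have "frame (Suc 0) ?h" using base_frame by simp
    moreover have "?h ` Pow {..<Suc 0} \<subseteq> S" using S01 by auto
    ultimately show ?thesis by blast
  qed
next
  case (Suc k)
  show ?case
  proof (cases "\<exists>n h. n \<le> k \<and> frame n h \<and> S = h ` Pow {..<n}")
    case True
    then obtain n h where "n \<le> k" "frame n h" "S = h ` Pow {..<n}" by blast
    then show ?thesis by (intro disjI1 exI[of _ n] exI[of _ h]) simp
  next
    case False
    then obtain h where h: "frame (Suc k) h" "h ` Pow {..<Suc k} \<subseteq> S" using Suc by blast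
    show ?thesis
    proof (cases "h ` Pow {..<Suc k} = S")
      case True
      with h show ?thesis by blast
    next
      case False
      with h have "h ` Pow {..<Suc k} \<subset> S" by blast
      from frame_extend[OF S h(1) this] obtain h' where
        "frame (Suc (Suc k)) h'" "h' ` Pow {..<Suc (Suc k)} \<subseteq> S" .
      then show ?thesis by (intro disjI2 exI[of _ h'] conjI)
    qed
  qed
qed

text \<open>
  The sets whose sums lie in \<open>T\<close> are closed under complements and disjoint unions. Closure under
  intersections is where \<open>T\<close> has to be Boolean: the sets of even size in a four-element set form
  a subalgebra that is not a field.
\<close>

lemma boolean_below_frame:
  assumes fr: "frame n h" and T: "boolean_subalgebra A T" "T \<subseteq> h ` Pow {..<n}"
  obtains F where "F \<in> set_fields {..<n}" "T = h ` F"
proof -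
  define F where "F = {U. U \<subseteq> {..<n} \<and> h U \<in> T}"
  have oT: "ortho_subalgebra A T" using T by (simp add: boolean_subalgebra_def)
  have "F \<in> set_fields {..<n}"
    unfolding set_fields_def
  proof (rule CollectI, intro conjI ballI)
    show "F \<subseteq> Pow {..<n}" by (auto simp: F_def)
    show "{} \<in> F" using ortho_subalgebraD(2)[OF oT] by (simp add: F_def frame_empty[OF fr])
    fix U assume U: "U \<in> F"
    then show "{..<n} - U \<in> F"
      using ortho_subalgebraD(4)[OF oT] by (simp add: F_def frame_compl[OF fr])
    fix V assume V: "V \<in> F"
    have UV: "U \<subseteq> {..<n}" "V \<subseteq> {..<n}" "h U \<in> T" "h V \<in> T" using U V by (auto simp: F_def)
    obtain p q r where *: "p \<in> T" "q \<in> T" "r \<in> T" "p \<oplus> q = Some (h U)" "p \<oplus> r = Some (h V)"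
      "h U \<oplus> r \<noteq> None"
      using boolean_split[OF T(1) UV(3,4)] .
    have mem: "\<exists>U\<subseteq>{..<n}. x = h U" if "x \<in> T" for x using that T(2) by auto
    obtain P Q R where PQR: "P \<subseteq> {..<n}" "Q \<subseteq> {..<n}" "R \<subseteq> {..<n}" "p = h P" "q = h Q" "r = h R"
      using mem[OF *(1)] mem[OF *(2)] mem[OF *(3)] by auto
    have "P \<inter> Q = {}" "P \<inter> R = {}" "U \<inter> R = {}"
      using frame_orth[OF fr PQR(1,2)] frame_orth[OF fr PQR(1,3)] frame_orth[OF fr UV(1) PQR(3)]
        *(4-6) unfolding PQR(4-6) by blast+
    then have "h (P \<union> Q) = h U" "h (P \<union> R) = h V"
      using frame_sum[OF fr, of P Q] frame_sum[OF fr, of P R] * PQR by auto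
    then have "P \<union> Q = U" "P \<union> R = V"
      using frame_eq_iff[OF fr] PQR UV by (metis Un_least)+
    then have "U \<inter> V = P" using \<open>U \<inter> R = {}\<close> by auto
    then show "U \<inter> V \<in> F" using PQR * by (simp add: F_def)
  qed
  moreover have "T = h ` F" using T(2) by (auto simp: F_def)
  ultimately show thesis using that by blast
qed

section \<open>Heights of Boolean subalgebras\<close>

lemma frame_0_iff:
  assumes "frame n h"
  shows "n = 0 \<longleftrightarrow> \<zero> = \<one>"
  using frame_eq_iff[OF assms, of "{}" "{..<n}"] frame_top[OF assms] frame_empty[OF assms]
  by (auto simp: lessThan_empty_iff bot_nat_def)

lemma boolean_frame_image: "frame n h \<Longrightarrow> boolean_subalgebra A (h ` Pow {..<n})"
  by (rule frame_boolean[OF _ Pow_in_set_fields])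

lemma boolean_below_frame_is_frame:
  assumes fr: "frame n h" and T: "boolean_subalgebra A T" "T \<subseteq> h ` Pow {..<n}"
  obtains m k where "m \<le> n" "frame m k" "T = k ` Pow {..<m}"
proof -
  have "\<not> k ` Pow {..<Suc n} \<subseteq> T" if "frame (Suc n) k" for k
  proof
    assume "k ` Pow {..<Suc n} \<subseteq> T"
    then have "card (k ` Pow {..<Suc n}) \<le> card (h ` Pow {..<n})"
      using T(2) by (intro card_mono) auto
    then show False by (simp only: frame_card[OF fr] frame_card[OF that]) simp
  qed
  then show thesis using boolean_frame_or_larger[OF T(1), of n] that by metis
qed

lemma carrier_BSub: "carrier (BSub A) = {S. boolean_subalgebra A S}"
  by (simp add: BSub_def)

lemma height_mono:
  assumes "S \<subseteq> T"
  shows "height (BSub A) S \<le> height (BSub A) T"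
proof -
  have "carrier (down (BSub A) S) \<subseteq> carrier (down (BSub A) T)"
    using assms by (auto simp: carrier_down BSub_def)
  then show ?thesis unfolding height_def by (intro SUP_subset_mono) auto
qed

text \<open>
  Along a chain of Boolean subalgebras the numbers of parts strictly increase. Conversely, the
  subalgebras of the ideals of the first \<open>k\<close> parts, for \<open>k < n\<close>, are a chain of length \<open>n - 1\<close>.
  For \<open>n = 0\<close>, which happens only if \<open>\<zero> = \<one>\<close>, the truncated difference is the correct height \<open>0\<close>.
\<close>

lemma height_frame:
  assumes fr: "frame n h"
  shows "height (BSub A) (h ` Pow {..<n}) = enat (n - 1)"
proof (rule antisym)
  let ?S = "h ` Pow {..<n}"
  show "height (BSub A) ?S \<le> enat (n - 1)"
    unfolding height_def
  proof (rule SUP_least)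
    fix C assume "C \<in> {C. C \<subseteq> carrier (down (BSub A) ?S) \<and> finite C \<and>
      (\<forall>a\<in>C. \<forall>b\<in>C. a \<sqsubseteq>\<^bsub>BSub A\<^esub> b \<or> b \<sqsubseteq>\<^bsub>BSub A\<^esub> a)}"
    then have C: "\<And>T. T \<in> C \<Longrightarrow> boolean_subalgebra A T \<and> T \<subseteq> ?S" "finite C"
      and chain: "\<And>S T. S \<in> C \<Longrightarrow> T \<in> C \<Longrightarrow> S \<subseteq> T \<or> T \<subseteq> S"
      by (auto simp: carrier_down BSub_def)
    define M where "M = (if n = 0 then {0} else {1..n})"
    have fin: "finite T" if "T \<in> C" for T
      using C(1)[OF that] finite_subset[of T ?S] by simp
    have "card T \<in> (\<lambda>m. 2 ^ m) ` M" if "T \<in> C" for T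
    proof -
      have "boolean_subalgebra A T" "T \<subseteq> ?S" using C(1)[OF that] by auto
      then obtain m k where m: "m \<le> n" "frame m k" "T = k ` Pow {..<m}"
        by (rule boolean_below_frame_is_frame[OF fr])
      then have "card T = 2 ^ m" by (simp add: frame_card)
      moreover have "m \<in> M" using m(1) frame_0_iff[OF m(2)] frame_0_iff[OF fr] by (auto simp: M_def)
      ultimately show ?thesis by blast
    qed
    then have "card (card ` C) \<le> card ((\<lambda>m. 2 ^ m :: nat) ` M)"
      by (intro card_mono) (auto simp: M_def)
    also have "\<dots> \<le> card M" by (rule card_image_le) (simp add: M_def)
    finally have "card (card ` C) \<le> card M" .
    moreover have "inj_on card C"
    proof (rule inj_onI)
      fix S T assume "S \<in> C" "T \<in> C" "card S = card T"
      then show "S = T" using chain[of S T] fin card_subset_eq by metis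
    qed
    ultimately have "card C - 1 \<le> n - 1" by (auto simp: card_image M_def split: if_splits)
    then show "enat (card C - 1) \<le> enat (n - 1)" by simp
  qed
  show "enat (n - 1) \<le> height (BSub A) ?S"
  proof (cases "n = 0")
    case True
    then show ?thesis by (simp add: zero_enat_def[symmetric])
  next
    case False
    define G where "G k = h ` ideal_field {..<n} {..<k}" for k
    have field: "ideal_field {..<n} {..<k} \<in> set_fields {..<n}" if "k < n" for k
      using that by (intro ideal_field_in) auto
    have mono: "ideal_field {..<n} {..<k} \<subseteq> ideal_field {..<n} {..<l}" if "k \<le> l" for k l
      using that by (intro ideal_field_mono) auto
    have "inj_on G {..<n}"
    proof (rule linorder_inj_onI)
      fix k l assume kl: "k < l" "k \<in> {..<n}" "l \<in> {..<n}"
      show "G k \<noteq> G l"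
      proof
        assume "G k = G l"
        then have "ideal_field {..<n} {..<k} = ideal_field {..<n} {..<l}"
          using kl field[of k] field[of l] set_fieldsD(1) unfolding G_def
          by (subst (asm) inj_on_image_eq_iff[OF frame_inj[OF fr]]) auto
        moreover have "{k} \<in> ideal_field {..<n} {..<l}" using kl by (auto simp: ideal_field_def)
        moreover have "l \<in> {..<n} - {..<k}" "l \<notin> {k}" using kl by auto
        then have "\<not> {..<n} - {..<k} \<subseteq> {k}" by blast
        then have "{k} \<notin> ideal_field {..<n} {..<k}" by (simp add: ideal_field_def)
        ultimately show False by simp
      qed
    qed auto
    then have "card (G ` {..<n}) = n" by (simp add: card_image)
    moreover have "G ` {..<n} \<in> {C. C \<subseteq> carrier (down (BSub A) ?S) \<and> finite C \<and>
      (\<forall>a\<in>C. \<forall>b\<in>C. a \<sqsubseteq>\<^bsub>BSub A\<^esub> b \<or> b \<sqsubseteq>\<^bsub>BSub A\<^esub> a)}"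
    proof (intro CollectI conjI ballI)
      show "G ` {..<n} \<subseteq> carrier (down (BSub A) ?S)"
      proof
        fix T assume "T \<in> G ` {..<n}"
        then obtain k where k: "k < n" "T = h ` ideal_field {..<n} {..<k}" by (auto simp: G_def)
        then show "T \<in> carrier (down (BSub A) ?S)"
          using frame_boolean[OF fr field[OF k(1)]] image_mono[OF set_fieldsD(1)[OF field[OF k(1)]], of h]
          by (simp add: carrier_down BSub_def)
      qed
      show "finite (G ` {..<n})" by simp
      fix a b assume "a \<in> G ` {..<n}" "b \<in> G ` {..<n}"
      then obtain k l where "a = G k" "b = G l" by auto
      then show "a \<sqsubseteq>\<^bsub>BSub A\<^esub> b \<or> b \<sqsubseteq>\<^bsub>BSub A\<^esub> a"
        using mono[of k l] mono[of l k] by (cases "k \<le> l") (auto simp: BSub_def G_def)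
    qed
    ultimately show ?thesis unfolding height_def by (intro SUP_upper2[of "G ` {..<n}"]) simp_all
  qed
qed

abbreviation X where "X \<equiv> BSub_star A"

text \<open>
  A Boolean subalgebra that has no frame of at most four parts contains a frame with five parts,
  and therefore a subalgebra of height \<open>4\<close>.
\<close>

lemma carrier_X: "carrier X = {S. \<exists>n h. n \<le> 4 \<and> frame n h \<and> S = h ` Pow {..<n}}"
proof (intro equalityI subsetI)
  fix S assume "S \<in> carrier X"
  then have S: "boolean_subalgebra A S" and ht: "height (BSub A) S \<le> 3"
    by (auto simp: BSub_star_def carrier_BSub)
  have "\<not> h ` Pow {..<Suc 4} \<subseteq> S" if "frame (Suc 4) h" for h
  proof
    assume "h ` Pow {..<Suc 4} \<subseteq> S"
    from order_trans[OF height_mono[OF this] ht] show False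
      unfolding height_frame[OF that] by (simp add: numeral_eq_enat)
  qed
  then show "S \<in> {S. \<exists>n h. n \<le> 4 \<and> frame n h \<and> S = h ` Pow {..<n}}"
    using boolean_frame_or_larger[OF S, of 4] by blast
next
  fix S assume "S \<in> {S. \<exists>n h. n \<le> 4 \<and> frame n h \<and> S = h ` Pow {..<n}}"
  then obtain n h where nh: "n \<le> 4" "frame n h" "S = h ` Pow {..<n}" by auto
  then have "height (BSub A) S \<le> 3" by (simp add: height_frame numeral_eq_enat)
  then show "S \<in> carrier X"
    using boolean_frame_image[OF nh(2)] nh(3) by (simp add: BSub_star_def carrier_BSub)
qed

lemma X_eq: "X = inclusion_order (carrier X)"
  by (simp add: BSub_star_def)

lemma le_X [simp]: "S \<sqsubseteq>\<^bsub>X\<^esub> T \<longleftrightarrow> S \<subseteq> T" "S \<sqsubset>\<^bsub>X\<^esub> T \<longleftrightarrow> S \<subset> T"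
  by (simp_all add: BSub_star_def)

lemma partial_order_X: "partial_order X"
  by (subst X_eq) (rule partial_order_inclusion_order)

lemma in_X:
  assumes "S \<in> carrier X"
  shows "boolean_subalgebra A S" "ortho_subalgebra A S" "finite S"
proof -
  show "boolean_subalgebra A S" using assms by (auto simp: BSub_star_def carrier_BSub)
  then show "ortho_subalgebra A S" by (rule boolean_ortho_subalgebra)
  show "finite S" using assms by (auto simp: carrier_X)
qed

lemma obtain_frame:
  assumes "S \<in> carrier X"
  obtains n h where "n \<le> 4" "frame n h" "S = h ` Pow {..<n}"
  using assms by (auto simp: carrier_X)

lemma frame_in_X: "\<lbrakk>frame n h; n \<le> 4\<rbrakk> \<Longrightarrow> h ` Pow {..<n} \<in> carrier X"
  by (auto simp: carrier_X)

lemma boolean_below_in_X: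
  assumes "S \<in> carrier X" "boolean_subalgebra A T" "T \<subseteq> S"
  shows "T \<in> carrier X"
proof -
  have "height (BSub A) S \<le> 3" using assms(1) by (simp add: BSub_star_def)
  then have "height (BSub A) T \<le> 3" using height_mono[OF assms(3)] by (rule order_trans[rotated])
  then show ?thesis using assms(2) by (simp add: BSub_star_def carrier_BSub)
qed

lemma field_in_X:
  assumes "frame n h" "n \<le> 4" "F \<in> set_fields {..<n}"
  shows "h ` F \<in> carrier X"
  using boolean_below_in_X[OF frame_in_X[OF assms(1,2)] frame_boolean[OF assms(1,3)]]
    set_fieldsD(1)[OF assms(3)] by blast

lemma card_X: "S \<in> carrier X \<Longrightarrow> \<exists>n\<le>4. card S = 2 ^ n"
  by (auto elim!: obtain_frame simp: frame_card)

section \<open>Atoms\<close>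

text \<open>
  The subalgebra generated by \<open>a\<close>; it is an atom unless \<open>a\<close> is \<open>\<zero>\<close> or \<open>\<one>\<close>, in which case it is the
  least element.
\<close>

definition gen :: "'a \<Rightarrow> 'a set" where
  "gen a = {\<zero>, a, \<sim> a, \<one>}"

lemma gen_compl: "a \<in> carrier A \<Longrightarrow> gen (\<sim> a) = gen a"
  by (auto simp: gen_def)

lemma gen_subset_iff: "ortho_subalgebra A S \<Longrightarrow> gen a \<subseteq> S \<longleftrightarrow> a \<in> S"
  using ortho_subalgebraD(2-4)[of S] by (simp add: gen_def) blast

lemma gen_frame:
  assumes "frame n h" "U \<subseteq> {..<n}"
  shows "gen (h U) = h ` split_field {..<n} U"
  using assms by (auto simp: gen_def split_field_def frame_compl frame_empty frame_top)

lemma frame_2: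
  assumes a: "a \<in> carrier A" "a \<noteq> \<zero>" "a \<noteq> \<one>"
  obtains h where "frame 2 h" "h {0} = a" "h {1} = \<sim> a"
proof -
  have "\<zero> \<noteq> \<one>" using one_sum[of a] a by (metis zero_sum)
  then have fr: "frame 1 (\<lambda>U. if U = {} then \<zero> else \<one>)" (is "frame 1 ?h") using base_frame by simp
  have "\<sim> a \<noteq> \<zero>" using a compl_inj[of a "\<one>"] oone_closed by auto
  then have sp: "0 < (1::nat)" "a \<in> carrier A" "\<sim> a \<in> carrier A" "a \<noteq> \<zero>" "\<sim> a \<noteq> \<zero>"
      "a \<oplus> \<sim> a = Some (?h {0})"
    using a by (auto simp: ocompl_closed osum_ocompl)
  show thesis
    using that[of "split_part 1 ?h 0 a (\<sim> a)"] frame_split_part[OF fr sp] split_part_left[OF fr sp]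
      split_part_right[OF fr sp] by (simp add: numeral_2_eq_2)
qed

lemma frame_3:
  assumes ab: "a \<in> carrier A" "b \<in> carrier A" "a \<noteq> \<zero>" "b \<noteq> \<zero>" and s: "a \<oplus> b = Some s" "s \<noteq> \<one>"
  obtains h where "frame 3 h" "h {0} = a" "h {1} = \<sim> s" "h {2} = b"
proof -
  have sc: "s \<in> carrier A" using osum_closed[OF ab(1,2) s(1)] .
  have "s \<noteq> \<zero>" using sum_eq_zero[OF ab(1,2)] s ab by auto
  then obtain h where h: "frame 2 h" "h {0} = s" "h {1} = \<sim> s" using frame_2[OF sc] s by blast
  have sp: "0 < (2::nat)" "a \<in> carrier A" "b \<in> carrier A" "a \<noteq> \<zero>" "b \<noteq> \<zero>" "a \<oplus> b = Some (h {0})"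
    using ab s h by auto
  show thesis
    using that[of "split_part 2 h 0 a b"] frame_split_part[OF h(1) sp] split_part_left[OF h(1) sp]
      split_part_right[OF h(1) sp] split_part_keep[OF h(1) sp, of "{1}"] h(3)
    by (simp add: numeral_3_eq_3 numeral_2_eq_2)
qed

lemma gen_in_X:
  assumes "a \<in> carrier A"
  shows "gen a \<in> carrier X"
proof -
  have "\<exists>n h U. n \<le> 4 \<and> frame n h \<and> U \<subseteq> {..<n} \<and> a = h U"
  proof (cases "a = \<zero> \<or> a = \<one>")
    case True
    obtain n :: nat and h where fr: "frame n h" "n \<le> 4"
    proof
      show "(if \<zero> = \<one> then 0 else 1 :: nat) \<le> 4" by simp
    qed (rule base_frame)
    then have "a = h {} \<or> a = h {..<n}" using True frame_empty frame_top by metis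
    then show ?thesis using fr by blast
  next
    case False
    then obtain h where "frame 2 h" "h {0} = a" using frame_2 assms by metis
    then show ?thesis by (intro exI[of _ 2] exI[of _ h] exI[of _ "{0}"]) auto
  qed
  then show ?thesis using gen_frame field_in_X[OF _ _ split_field_in] by metis
qed

lemma bottom_inclusion_order:
  assumes "\<S> \<subseteq> {S. boolean_subalgebra A S}" "\<And>a. a \<in> carrier A \<Longrightarrow> gen a \<in> \<S>"
  shows "\<bottom>\<^bsub>inclusion_order \<S>\<^esub> = gen \<zero>"
proof (rule partial_order.bottom_eqI[OF partial_order_inclusion_order])
  show "gen \<zero> \<in> carrier (inclusion_order \<S>)" using assms(2) ozero_closed by simp
  fix S assume "S \<in> carrier (inclusion_order \<S>)"
  then have "ortho_subalgebra A S" using assms(1) boolean_ortho_subalgebra by auto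
  then show "gen \<zero> \<sqsubseteq>\<^bsub>inclusion_order \<S>\<^esub> S"
    by (simp add: gen_subset_iff ortho_subalgebraD(2))
qed

lemma gen_zero: "gen \<zero> = {\<zero>, \<one>}"
  by (auto simp: gen_def)

lemma is_atom_inclusion_order:
  assumes \<S>: "\<S> \<subseteq> {S. boolean_subalgebra A S}" "\<And>a. a \<in> carrier A \<Longrightarrow> gen a \<in> \<S>"
  shows "is_atom (inclusion_order \<S>) p \<longleftrightarrow> (\<exists>a\<in>carrier A. a \<noteq> \<zero> \<and> a \<noteq> \<one> \<and> p = gen a)"
proof -
  have sub: "ortho_subalgebra A S" if "S \<in> \<S>" for S
    using that \<S>(1) boolean_ortho_subalgebra by auto
  have at: "is_atom (inclusion_order \<S>) p \<longleftrightarrow>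
    p \<in> \<S> \<and> {\<zero>, \<one>} \<subset> p \<and> \<not> (\<exists>T\<in>\<S>. {\<zero>, \<one>} \<subset> T \<and> T \<subset> p)" for p
    using \<S>(2)[OF ozero_closed]
    by (simp add: is_atom_def covered_by_def bottom_inclusion_order[OF \<S>] gen_zero)
  show ?thesis
  proof
    assume p: "is_atom (inclusion_order \<S>) p"
    then obtain a where a: "a \<in> p" "a \<noteq> \<zero>" "a \<noteq> \<one>" unfolding at by blast
    have op: "ortho_subalgebra A p" using p sub unfolding at by blast
    then have ac: "a \<in> carrier A" using ortho_subalgebraD(1) a by blast
    have "gen a \<subseteq> p" using gen_subset_iff[OF op] a by simp
    moreover have "{\<zero>, \<one>} \<subset> gen a" using a by (auto simp: gen_def)
    ultimately have "p = gen a" using p \<S>(2)[OF ac] unfolding at by blast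
    then show "\<exists>a\<in>carrier A. a \<noteq> \<zero> \<and> a \<noteq> \<one> \<and> p = gen a" using a ac by blast
  next
    assume "\<exists>a\<in>carrier A. a \<noteq> \<zero> \<and> a \<noteq> \<one> \<and> p = gen a"
    then obtain a where a: "a \<in> carrier A" "a \<noteq> \<zero>" "a \<noteq> \<one>" "p = gen a" by blast
    have "\<not> T \<subset> p" if T: "T \<in> \<S>" "{\<zero>, \<one>} \<subset> T" for T
    proof
      assume "T \<subset> p"
      then obtain b where "b \<in> T" "b = a \<or> b = \<sim> a" using T a by (auto simp: gen_def)
      then have "a \<in> T" using ortho_subalgebraD(4)[OF sub[OF T(1)], of b] a by auto
      then show False using gen_subset_iff[OF sub[OF T(1)]] \<open>T \<subset> p\<close> a by blast
    qed
    moreover have "{\<zero>, \<one>} \<subset> gen a" using a by (auto simp: gen_def)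
    ultimately show "is_atom (inclusion_order \<S>) p" unfolding at using a \<S>(2) by blast
  qed
qed

lemma X_family: "carrier X \<subseteq> {S. boolean_subalgebra A S}"
  by (auto dest: in_X)

lemma bottom_X: "\<bottom>\<^bsub>X\<^esub> = gen \<zero>"
  by (subst X_eq) (rule bottom_inclusion_order[OF X_family gen_in_X])

lemma is_atom_X: "is_atom X p \<longleftrightarrow> (\<exists>a\<in>carrier A. a \<noteq> \<zero> \<and> a \<noteq> \<one> \<and> p = gen a)"
  by (subst X_eq) (rule is_atom_inclusion_order[OF X_family gen_in_X])

lemma gen_in_BSub: "a \<in> carrier A \<Longrightarrow> gen a \<in> {S. boolean_subalgebra A S}"
  using gen_in_X in_X by auto

lemma is_atom_BSub: "is_atom (BSub A) p \<longleftrightarrow> (\<exists>a\<in>carrier A. a \<noteq> \<zero> \<and> a \<noteq> \<one> \<and> p = gen a)"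
  unfolding BSub_def by (rule is_atom_inclusion_order[OF subset_refl gen_in_BSub])

section \<open>The hypergraph determines the poset\<close>

lemma atoms_below_BSub:
  assumes S: "boolean_subalgebra A S"
  shows "atoms_below (BSub A) S = gen ` (S - {\<zero>, \<one>})"
proof -
  have o: "ortho_subalgebra A S" using S by (rule boolean_ortho_subalgebra)
  have "p \<sqsubseteq>\<^bsub>BSub A\<^esub> S \<longleftrightarrow> p \<subseteq> S" for p by (simp add: BSub_def)
  then show ?thesis
    using ortho_subalgebraD(1)[OF o] gen_subset_iff[OF o]
    by (auto simp: atoms_below_def is_atom_BSub)
qed

text \<open>
  An element \<open>a\<close> is recovered from its atom, which is contained in \<open>S\<close> iff \<open>a\<close> is an element of \<open>S\<close>.
\<close>

lemma atoms_below_subset_iff: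
  assumes S: "boolean_subalgebra A S" and T: "boolean_subalgebra A T"
  shows "atoms_below (BSub A) S \<subseteq> atoms_below (BSub A) T \<longleftrightarrow> S \<subseteq> T"
proof
  assume sub: "atoms_below (BSub A) S \<subseteq> atoms_below (BSub A) T"
  have oT: "ortho_subalgebra A T" using T by (rule boolean_ortho_subalgebra)
  show "S \<subseteq> T"
  proof
    fix a assume a: "a \<in> S"
    show "a \<in> T"
    proof (cases "a = \<zero> \<or> a = \<one>")
      case True
      then show ?thesis using ortho_subalgebraD[OF oT] by blast
    next
      case False
      then have "gen a \<in> atoms_below (BSub A) S" using a by (simp add: atoms_below_BSub[OF S])
      then have "gen a \<in> atoms_below (BSub A) T" using sub by blast
      then have "gen a \<subseteq> T" by (simp add: atoms_below_def BSub_def)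
      then show ?thesis by (auto simp: gen_def)
    qed
  qed
qed (auto simp: atoms_below_def BSub_def)

text \<open>
  The atoms below a frame correspond to the nontrivial two-part partitions of its set of
  parts; picking the side that contains part \<open>0\<close> counts each of them once.
\<close>

lemma card_atoms_below_frame:
  assumes fr: "frame n h" and n: "n > 0"
  shows "card (atoms_below (BSub A) (h ` Pow {..<n})) = 2 ^ (n - 1) - 1"
proof -
  let ?I = "{..<n}" and ?D = "Pow {1..<n} - {{1..<n}}"
  let ?f = "\<lambda>V. gen (h (insert 0 V))"
  have I: "insert 0 {1..<n} = ?I" using n by auto
  have D: "insert 0 V \<subseteq> ?I" "insert 0 V \<noteq> ?I" "V = insert 0 V - {0}" if "V \<in> ?D" for V
  proof -
    show "insert 0 V \<subseteq> ?I" using that n by auto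
    show "V = insert 0 V - {0}" using that by auto
    then show "insert 0 V \<noteq> ?I" using that I by (metis Diff_iff Diff_insert_absorb atLeastLessThan_iff not_one_le_zero singletonI)
  qed
  have h: "h U \<noteq> \<zero> \<and> h U \<noteq> \<one> \<longleftrightarrow> U \<noteq> {} \<and> U \<noteq> ?I" if "U \<subseteq> ?I" for U
    using frame_eq_iff[OF fr that, of "{}"] frame_eq_iff[OF fr that, of ?I] frame_empty[OF fr]
      frame_top[OF fr] by auto
  have "atoms_below (BSub A) (h ` Pow ?I) = ?f ` ?D"
  proof (intro equalityI subsetI)
    fix p assume "p \<in> atoms_below (BSub A) (h ` Pow ?I)"
    then obtain U where U: "U \<subseteq> ?I" "h U \<noteq> \<zero>" "h U \<noteq> \<one>" "p = gen (h U)"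
      by (auto simp: atoms_below_BSub[OF boolean_frame_image[OF fr]])
    define W where "W = (if 0 \<in> U then U else ?I - U)"
    have W: "W \<subseteq> ?I" "0 \<in> W" "W \<noteq> ?I" "p = gen (h W)"
      using U h[OF U(1)] n frame_compl[OF fr U(1)] frame_closed[OF fr U(1)] gen_compl
      by (auto simp: W_def)
    have "W - {0} \<in> ?D"
    proof -
      have "W - {0} \<subseteq> {1..<n}" using W(1) by (auto simp: Suc_le_eq)
      moreover have "W - {0} \<noteq> {1..<n}" using W(2,3) I by (metis insert_Diff)
      ultimately show ?thesis by simp
    qed
    moreover have "p = ?f (W - {0})" using W by (simp add: insert_absorb)
    ultimately show "p \<in> ?f ` ?D" by (rule rev_image_eqI)
  next
    fix p assume "p \<in> ?f ` ?D"
    then obtain V where V: "V \<in> ?D" "p = ?f V" by auto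
    then show "p \<in> atoms_below (BSub A) (h ` Pow ?I)"
      using h[OF D(1)[OF V(1)]] D[OF V(1)]
      by (auto simp: atoms_below_BSub[OF boolean_frame_image[OF fr]])
  qed
  moreover have "inj_on ?f ?D"
  proof (rule inj_onI)
    fix V W assume V: "V \<in> ?D" and W: "W \<in> ?D" and e: "?f V = ?f W"
    note DV = D[OF V] and DW = D[OF W]
    have "split_field ?I (insert 0 V) = split_field ?I (insert 0 W)"
      using e gen_frame[OF fr DV(1)] gen_frame[OF fr DW(1)]
        set_fieldsD(1)[OF split_field_in[OF DV(1)]] set_fieldsD(1)[OF split_field_in[OF DW(1)]]
        inj_on_image_eq_iff[OF frame_inj[OF fr]] by metis
    moreover have "insert 0 V \<in> split_field ?I (insert 0 V)" by (simp add: split_field_def)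
    ultimately have "insert 0 V \<in> split_field ?I (insert 0 W)" by simp
    then have "insert 0 V = insert 0 W" using DV(2) unfolding split_field_def by blast
    then show "V = W" using DV(3) DW(3) by metis
  qed
  ultimately have "card (atoms_below (BSub A) (h ` Pow ?I)) = card ?D" by (simp only: card_image)
  also have "\<dots> = 2 ^ (n - 1) - 1" by (simp add: card_Diff_subset card_Pow)
  finally show ?thesis .
qed

lemma atoms_below_bij:
  "bij_betw (atoms_below (BSub A)) (carrier X) (carrier (hypergraph_poset (hypergraph_of A)))"
  (is "bij_betw ?f _ ?Y")
proof (rule bij_betw_imageI)
  show "inj_on ?f (carrier X)"
    using in_X(1) atoms_below_subset_iff by (intro inj_onI) (metis subset_antisym subset_refl)
  have Y: "?Y = {{}} \<union> (\<lambda>p. {p}) ` {p. is_atom (BSub A) p} \<union>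
      {l. card l = 3 \<and> (\<exists>S\<in>carrier (BSub A). height (BSub A) S = 2 \<and> l = ?f S)} \<union>
      {l. card l = 7 \<and> (\<exists>S\<in>carrier (BSub A). height (BSub A) S = 3 \<and> l = ?f S)}"
    by (simp add: hypergraph_poset_def hypergraph_of_def)
  have f_atom: "?f (gen a) = {gen a}" if "a \<in> carrier A" "a \<noteq> \<zero>" "a \<noteq> \<one>" for a
  proof -
    have "gen b = gen a" if "b \<in> gen a - {\<zero>, \<one>}" for b
    proof -
      have "b = a \<or> b = \<sim> a" using that unfolding gen_def by blast
      then show ?thesis using gen_compl[OF \<open>a \<in> carrier A\<close>] by metis
    qed
    moreover have "a \<in> gen a - {\<zero>, \<one>}" using that by (simp add: gen_def)
    moreover have "?f (gen a) = gen ` (gen a - {\<zero>, \<one>})"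
      using gen_in_BSub[OF that(1)] by (simp add: atoms_below_BSub)
    ultimately show ?thesis by blast
  qed
  show "?f ` carrier X = ?Y"
  proof (intro equalityI subsetI)
    fix y assume "y \<in> ?f ` carrier X"
    then obtain S where S: "S \<in> carrier X" "y = ?f S" by auto
    then obtain n h where h: "n \<le> 4" "frame n h" "S = h ` Pow {..<n}" by (auto elim: obtain_frame)
    note bool = in_X(1)[OF S(1)]
    have inB: "S \<in> carrier (BSub A)" using bool by (simp add: carrier_BSub)
    have ht: "height (BSub A) S = enat (n - 1)" using height_frame[OF h(2)] h(3) by simp
    have cd: "card y = 2 ^ (n - 1) - 1" if "n > 0" using card_atoms_below_frame[OF h(2) that] S h by simp
    consider "n \<le> 1" | "n = 2" | "n = 3" | "n = 4" using h(1) by linarith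
    then show "y \<in> ?Y"
    proof cases
      case 1
      then have "{..<n} \<subseteq> {0}" by auto
      then have "U = {} \<or> U = {..<n}" if "U \<subseteq> {..<n}" for U using that by blast
      then have "S \<subseteq> {\<zero>, \<one>}" using h frame_empty[OF h(2)] frame_top[OF h(2)] by auto
      then have "y = {}" using S(2) by (auto simp: atoms_below_BSub[OF bool])
      then show ?thesis unfolding Y by simp
    next
      case 2
      have "Pow {..<2::nat} = {{}, {0}, {1}, {0, 1}}"
        by (auto simp: numeral_2_eq_2 lessThan_Suc Pow_insert)
      moreover have "h {1} = \<sim> (h {0})"
        using frame_compl[OF h(2), of "{0}"] 2 by (simp add: numeral_2_eq_2 lessThan_Suc insert_Diff_if)
      moreover have "h {0, 1} = \<one>"
        using frame_top[OF h(2)] 2 by (simp add: numeral_2_eq_2 lessThan_Suc insert_commute)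
      ultimately have "S = gen (h {0})" using h 2 frame_empty[OF h(2)] by (auto simp: gen_def)
      moreover have "h {0} \<in> carrier A" using frame_closed[OF h(2), of "{0}"] 2 by simp
      moreover have "h {0} \<noteq> \<zero>" using frame_nonzero[OF h(2)] 2 by simp
      moreover have "h {0} \<noteq> \<one>" using frame_eq_iff[OF h(2), of "{0}" "{..<n}"] frame_top[OF h(2)] 2
        by (auto simp: numeral_2_eq_2 lessThan_Suc)
      ultimately have "y = {S}" "is_atom (BSub A) S" using f_atom S(2) is_atom_BSub by auto
      then show ?thesis unfolding Y by blast
    next
      case 3
      then have "card y = 3" "height (BSub A) S = 2" using cd ht by (auto simp: numeral_eq_enat)
      then show ?thesis unfolding Y using S(2) inB by blast
    next
      case 4
      then have "card y = 7" "height (BSub A) S = 3" using cd ht by (auto simp: numeral_eq_enat)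
      then show ?thesis unfolding Y using S(2) inB by blast
    qed
  next
    fix y assume "y \<in> ?Y"
    then consider "y = {}" | p where "is_atom (BSub A) p" "y = {p}"
      | S where "S \<in> carrier (BSub A)" "height (BSub A) S \<le> 3" "y = ?f S"
      unfolding Y by (auto simp: numeral_eq_enat)
    then show "y \<in> ?f ` carrier X"
    proof cases
      case 1
      have "?f (gen \<zero>) = {}" using gen_in_BSub[OF ozero_closed] by (auto simp: atoms_below_BSub gen_def)
      then show ?thesis using gen_in_X[OF ozero_closed] 1 by (metis imageI)
    next
      case 2
      then obtain a where "a \<in> carrier A" "a \<noteq> \<zero>" "a \<noteq> \<one>" "p = gen a" using is_atom_BSub by blast
      then show ?thesis using f_atom gen_in_X 2 by (metis imageI)
    next
      case 3
      then have "S \<in> carrier X" by (simp add: BSub_star_def)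
      then show ?thesis using 3 by blast
    qed
  qed
qed

lemma order_iso_hypergraph_poset:
  "order_iso X (hypergraph_poset (hypergraph_of A)) (atoms_below (BSub A))"
proof (intro order_iso.intro order_iso_axioms.intro partial_order_X atoms_below_bij)
  show "partial_order (hypergraph_poset (hypergraph_of A))"
    unfolding hypergraph_poset_def by (rule partial_order_inclusion_order)
  fix S T assume "S \<in> carrier X" "T \<in> carrier X"
  then show "atoms_below (BSub A) S \<sqsubseteq>\<^bsub>hypergraph_poset (hypergraph_of A)\<^esub> atoms_below (BSub A) T
    \<longleftrightarrow> S \<sqsubseteq>\<^bsub>X\<^esub> T"
    using in_X(1) atoms_below_subset_iff by (simp add: hypergraph_poset_def)
qed

section \<open>Down-sets of the poset are lattices of fields\<close>

lemma order_iso_frame: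
  assumes fr: "frame n h" and n: "n \<le> 4"
  shows "order_iso (fields_order {..<n}) (down X (h ` Pow {..<n})) ((`) h)"
proof (intro order_iso.intro order_iso_axioms.intro fields_order.partial_order_axioms
    partial_order_down partial_order_X)
  have P: "F \<subseteq> Pow {..<n}" if "F \<in> set_fields {..<n}" for F using set_fieldsD(1)[OF that] .
  show "bij_betw ((`) h) (carrier (fields_order {..<n})) (carrier (down X (h ` Pow {..<n})))"
  proof (rule bij_betw_imageI)
    show "inj_on ((`) h) (carrier (fields_order {..<n}))"
      by (rule inj_onI) (use inj_on_image_eq_iff[OF frame_inj[OF fr] P P] in simp)
    show "(`) h ` carrier (fields_order {..<n}) = carrier (down X (h ` Pow {..<n}))"
    proof (intro equalityI subsetI)
      fix T assume "T \<in> (`) h ` carrier (fields_order {..<n})"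
      then obtain F where F: "F \<in> set_fields {..<n}" "T = h ` F" by auto
      then show "T \<in> carrier (down X (h ` Pow {..<n}))"
        using field_in_X[OF fr n F(1)] image_mono[OF P[OF F(1)], of h] by (simp add: carrier_down)
    next
      fix T assume "T \<in> carrier (down X (h ` Pow {..<n}))"
      then have T: "T \<in> carrier X" "T \<subseteq> h ` Pow {..<n}" by (auto simp: carrier_down)
      obtain F where "F \<in> set_fields {..<n}" "T = h ` F"
        using boolean_below_frame[OF fr in_X(1)[OF T(1)] T(2)] .
      then show "T \<in> (`) h ` carrier (fields_order {..<n})" by simp
    qed
  qed
  fix F G assume "F \<in> carrier (fields_order {..<n})" "G \<in> carrier (fields_order {..<n})"
  then show "h ` F \<sqsubseteq>\<^bsub>down X (h ` Pow {..<n})\<^esub> h ` G \<longleftrightarrow> F \<sqsubseteq>\<^bsub>fields_order {..<n}\<^esub> G"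
    using inj_on_image_subset_iff[OF frame_inj[OF fr] P P] by simp
qed

lemma lattice_iso_frame:
  assumes "frame n h" "n \<le> 4"
  shows "lattice_iso (fields_order {..<n}) (down X (h ` Pow {..<n})) ((`) h)"
  by (intro lattice_iso.intro order_iso_frame assms bounded_lattice_fields)

lemma downset_lattice_X: "downset_lattice X"
proof (intro downset_lattice.intro downset_lattice_axioms.intro partial_order_X)
  show "\<exists>b\<in>carrier X. \<forall>x\<in>carrier X. b \<sqsubseteq>\<^bsub>X\<^esub> x"
    using gen_in_X[OF ozero_closed] in_X(2) gen_subset_iff ortho_subalgebraD(2)
    by (intro bexI[of _ "gen \<zero>"]) auto
  fix S assume "S \<in> carrier X"
  then obtain n h where "n \<le> 4" "frame n h" "S = h ` Pow {..<n}" by (rule obtain_frame)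
  then show "bounded_lattice (down X S)"
    using order_iso.bounded_lattice[OF order_iso_frame bounded_lattice_fields] by simp
qed

section \<open>The parts of a subalgebra below an element and below its complement\<close>

text \<open>
  Since \<open>s \<le> a\<close> means that \<open>s\<close> is orthogonal to \<open>\<sim> a\<close>, this is the subalgebra of \<open>S\<close> that
  consists of the members of the principal ideal of \<open>a\<close> and their complements.
\<close>

definition ideal_part :: "'a set \<Rightarrow> 'a \<Rightarrow> 'a set" where
  "ideal_part S a = {s \<in> S. s \<oplus> \<sim> a \<noteq> None \<or> \<sim> s \<oplus> \<sim> a \<noteq> None}"

definition dir_of :: "'a \<Rightarrow> ('a set \<rightharpoonup> 'a set \<times> 'a set)" where
  "dir_of a = (\<lambda>S. if S \<in> carrier X \<and> a \<in> S then Some (ideal_part S a, ideal_part S (\<sim> a)) else None)"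

lemma ideal_part_frame:
  assumes fr: "frame n h" and U: "U \<subseteq> {..<n}"
  shows "ideal_part (h ` Pow {..<n}) (h U) = h ` ideal_field {..<n} U"
proof -
  let ?I = "{..<n}"
  have "h W \<oplus> \<sim> (h U) \<noteq> None \<or> \<sim> (h W) \<oplus> \<sim> (h U) \<noteq> None \<longleftrightarrow> W \<in> ideal_field ?I U"
    if W: "W \<subseteq> ?I" for W
  proof -
    have "h W \<oplus> \<sim> (h U) \<noteq> None \<longleftrightarrow> W \<inter> (?I - U) = {}"
      using frame_orth_iff[OF fr W, of "?I - U"] frame_compl[OF fr U] by simp
    moreover have "\<sim> (h W) \<oplus> \<sim> (h U) \<noteq> None \<longleftrightarrow> (?I - W) \<inter> (?I - U) = {}"
      using frame_orth_iff[OF fr, of "?I - W" "?I - U"] frame_compl[OF fr U] frame_compl[OF fr W] by simp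
    moreover have "W \<inter> (?I - U) = {} \<longleftrightarrow> W \<subseteq> U" using W by blast
    moreover have "(?I - W) \<inter> (?I - U) = {} \<longleftrightarrow> ?I - U \<subseteq> W" by blast
    ultimately show ?thesis using W by (simp add: ideal_field_def)
  qed
  moreover have "ideal_field ?I U \<subseteq> Pow ?I" using set_fieldsD(1)[OF ideal_field_in[OF U]] .
  ultimately show ?thesis unfolding ideal_part_def by (auto; blast)
qed

lemma ideal_part_Int: "T \<subseteq> S \<Longrightarrow> T \<inter> ideal_part S a = ideal_part T a"
  by (auto simp: ideal_part_def)

lemma ideal_part_le: "ideal_part S a \<subseteq> S"
  by (auto simp: ideal_part_def)

lemma obtain_frame_element:
  assumes "S \<in> carrier X" "a \<in> S"
  obtains n h U where "n \<le> 4" "frame n h" "S = h ` Pow {..<n}" "U \<subseteq> {..<n}" "a = h U"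
    "\<sim> a = h ({..<n} - U)" "gen a = h ` split_field {..<n} U"
    "ideal_part S a = h ` ideal_field {..<n} U" "ideal_part S (\<sim> a) = h ` ideal_field {..<n} ({..<n} - U)"
proof -
  obtain n h where h: "n \<le> 4" "frame n h" "S = h ` Pow {..<n}" using assms(1) by (rule obtain_frame)
  then obtain U where U: "U \<subseteq> {..<n}" "a = h U" using assms(2) by auto
  show thesis
    using that[OF h U] frame_compl[OF h(2) U(1)] gen_frame[OF h(2) U(1)] ideal_part_frame[OF h(2) U(1)]
      ideal_part_frame[OF h(2), of "{..<n} - U"] U h by simp
qed

lemma ideal_part_in_X:
  assumes "S \<in> carrier X" "a \<in> S"
  shows "ideal_part S a \<in> carrier X"
proof -
  obtain n h U where *: "n \<le> 4" "frame n h" "U \<subseteq> {..<n}" "ideal_part S a = h ` ideal_field {..<n} U"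
    using obtain_frame_element[OF assms] by metis
  show ?thesis unfolding *(4) by (rule field_in_X[OF *(2,1) ideal_field_in[OF *(3)]])
qed

lemma ideal_part_Int_compl:
  assumes "S \<in> carrier X" "a \<in> S"
  shows "ideal_part S a \<inter> ideal_part S (\<sim> a) = gen a"
proof -
  obtain n h U where *: "frame n h" "U \<subseteq> {..<n}" "gen a = h ` split_field {..<n} U"
    "ideal_part S a = h ` ideal_field {..<n} U" "ideal_part S (\<sim> a) = h ` ideal_field {..<n} ({..<n} - U)"
    using obtain_frame_element[OF assms] by metis
  have "ideal_field {..<n} U \<subseteq> Pow {..<n}" "ideal_field {..<n} ({..<n} - U) \<subseteq> Pow {..<n}"
    by (auto simp: ideal_field_def)
  then have "h ` ideal_field {..<n} U \<inter> h ` ideal_field {..<n} ({..<n} - U) =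
      h ` (ideal_field {..<n} U \<inter> ideal_field {..<n} ({..<n} - U))"
    using inj_on_image_Int[OF frame_inj[OF *(1)]] by metis
  then show ?thesis using * by (simp add: ideal_field_Int)
qed

text \<open>
  The two parts have the atom of \<open>a\<close> as meet and \<open>S\<close> as join, so they coincide only if these do.
\<close>

lemma ideal_part_neq:
  assumes "S \<in> carrier X" "a \<in> S" "S \<noteq> gen a"
  shows "ideal_part S a \<noteq> ideal_part S (\<sim> a)"
proof
  assume e: "ideal_part S a = ideal_part S (\<sim> a)"
  obtain n h U where *: "frame n h" "S = h ` Pow {..<n}" "U \<subseteq> {..<n}" "gen a = h ` split_field {..<n} U"
    "ideal_part S a = h ` ideal_field {..<n} U" "ideal_part S (\<sim> a) = h ` ideal_field {..<n} ({..<n} - U)"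
    using obtain_frame_element[OF assms(1,2)] by metis
  have "ideal_field {..<n} U \<subseteq> Pow {..<n}" "ideal_field {..<n} ({..<n} - U) \<subseteq> Pow {..<n}"
    by (auto simp: ideal_field_def)
  then have "ideal_field {..<n} U = ideal_field {..<n} ({..<n} - U)"
    using e inj_on_image_eq_iff[OF frame_inj[OF *(1)]] *(5,6) by metis
  then show False using ideal_field_eq_compl[OF *(3)] * assms(3) by simp
qed

lemma principal_pair_ideal_parts:
  assumes "S \<in> carrier X" "a \<in> S"
  shows "principal_pair_for (down X S) (gen a) (ideal_part S a, ideal_part S (\<sim> a))"
proof -
  obtain n h U where *: "n \<le> 4" "frame n h" "S = h ` Pow {..<n}" "U \<subseteq> {..<n}"
    "gen a = h ` split_field {..<n} U"
    "ideal_part S a = h ` ideal_field {..<n} U" "ideal_part S (\<sim> a) = h ` ideal_field {..<n} ({..<n} - U)"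
    using obtain_frame_element[OF assms] by metis
  show ?thesis
    using lattice_iso.principal_pair_for[OF lattice_iso_frame[OF *(2,1)]
        principal_pair_ideal_fields[OF *(4)]] unfolding *(3,5-7)
    using *(3,5-7) by simp
qed

lemma principal_pair_cases:
  assumes S: "S \<in> carrier X" "a \<in> S" and pp: "principal_pair_for (down X S) (gen a) (v, w)"
  shows "(v, w) = (ideal_part S a, ideal_part S (\<sim> a)) \<or>
    (v, w) = (ideal_part S (\<sim> a), ideal_part S a)"
proof -
  obtain n h U where *: "n \<le> 4" "frame n h" "S = h ` Pow {..<n}" "U \<subseteq> {..<n}"
    "gen a = h ` split_field {..<n} U"
    "ideal_part S a = h ` ideal_field {..<n} U" "ideal_part S (\<sim> a) = h ` ideal_field {..<n} ({..<n} - U)"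
    using obtain_frame_element[OF S] by metis
  interpret i: lattice_iso "fields_order {..<n}" "down X S" "(`) h"
    using lattice_iso_frame[OF *(2,1)] *(3) by simp
  have "v \<in> carrier (down X S)" "w \<in> carrier (down X S)"
    using pp by (auto simp: principal_pair_for_def principal_pair_def dual_modular_def)
  then obtain F G where FG: "F \<in> set_fields {..<n}" "G \<in> set_fields {..<n}" "v = h ` F" "w = h ` G"
    by (auto simp: i.image)
  have "principal_pair_for (fields_order {..<n}) (split_field {..<n} U) (F, G)"
    using pp lattice_iso_principal_pair_for_iff[OF i.lattice_iso_axioms, of "split_field {..<n} U" F G]
      FG * split_field_in[OF *(4)] by simp
  then have "(F, G) = (ideal_field {..<n} U, ideal_field {..<n} ({..<n} - U)) \<or>
      (F, G) = (ideal_field {..<n} ({..<n} - U), ideal_field {..<n} U)"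
    using principal_pair_fields_cases[OF *(4)] *(1) by simp
  then show ?thesis unfolding FG(3,4) *(6,7) by (elim disjE) simp_all
qed

lemma meet_X:
  assumes "S \<in> carrier X" "T \<in> carrier X" "S \<inter> T \<in> carrier X"
  shows "S \<sqinter>\<^bsub>X\<^esub> T = S \<inter> T"
  by (rule partial_order.meet_eqI[OF partial_order_X]) (use assms in \<open>auto simp: is_glb_pair\<close>)

lemma up_set_gen: "up_set X (gen a) = {S \<in> carrier X. a \<in> S}"
  using gen_subset_iff in_X(2) by (auto simp: up_set_def)

lemma basic_gen:
  assumes a: "a \<in> carrier A"
  shows "basic X (gen a)"
proof (cases "a = \<zero> \<or> a = \<one>")
  case True
  then show ?thesis using bottom_X gen_compl[OF ozero_closed] by (auto simp: basic_def)
next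
  case False
  then have "is_atom X (gen a)" using a is_atom_X by blast
  then show ?thesis by (simp add: basic_def)
qed

lemma gen_le: "\<lbrakk>S \<in> carrier X; a \<in> S\<rbrakk> \<Longrightarrow> gen a \<subseteq> S"
  using gen_subset_iff in_X(2) by blast

lemma mem_carrier: "\<lbrakk>S \<in> carrier X; a \<in> S\<rbrakk> \<Longrightarrow> a \<in> carrier A"
  using in_X(2) ortho_subalgebraD(1) by blast

lemma compl_mem: "\<lbrakk>S \<in> carrier X; a \<in> S\<rbrakk> \<Longrightarrow> \<sim> a \<in> S"
  using in_X(2) ortho_subalgebraD(4) by blast

lemma compl_mem_iff: "\<lbrakk>S \<in> carrier X; a \<in> carrier A\<rbrakk> \<Longrightarrow> \<sim> a \<in> S \<longleftrightarrow> a \<in> S"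
  using compl_mem compl_compl by metis

lemma dir_of_eq: "\<lbrakk>S \<in> carrier X; a \<in> S\<rbrakk> \<Longrightarrow> dir_of a S = Some (ideal_part S a, ideal_part S (\<sim> a))"
  by (simp add: dir_of_def)

lemma dir_of_compl_eq:
  "\<lbrakk>S \<in> carrier X; a \<in> S\<rbrakk> \<Longrightarrow> dir_of (\<sim> a) S = Some (ideal_part S (\<sim> a), ideal_part S a)"
  by (simp add: dir_of_def compl_mem mem_carrier)

lemma dir_compl_dir_of: "a \<in> carrier A \<Longrightarrow> dir_compl (dir_of a) = dir_of (\<sim> a)"
  by (rule ext) (simp add: dir_compl_def dir_of_def compl_mem_iff)

section \<open>The direction of an element is a direction\<close>

lemma covered_by_X:
  "covered_by X S T \<longleftrightarrow> S \<in> carrier X \<and> T \<in> carrier X \<and> S \<subset> T \<and> \<not> (\<exists>R\<in>carrier X. S \<subset> R \<and> R \<subset> T)"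
  by (simp add: covered_by_def)

lemma cover_gen:
  assumes "covered_by X (gen a) T"
  shows "T \<in> carrier X" "a \<in> T" "T \<noteq> gen a"
proof -
  have "a \<in> gen a" by (simp add: gen_def)
  then show "T \<in> carrier X" "a \<in> T" "T \<noteq> gen a" using assms unfolding covered_by_X by blast+
qed

text \<open>
  Cardinalities of subalgebras in the poset are powers of two, so none lies strictly between a
  cardinality and its double.
\<close>

lemma covered_by_if_card:
  assumes "S \<in> carrier X" "T \<in> carrier X" "S \<subseteq> T" "card T = 2 * card S"
  shows "covered_by X S T"
proof -
  obtain m where m: "card S = 2 ^ m" using card_X assms by blast
  have "S \<noteq> T" using m assms(4) by auto
  moreover have False if R: "R \<in> carrier X" "S \<subset> R" "R \<subset> T" for R
  proof -
    have "card S < card R" "card R < card T"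
      using psubset_card_mono[OF in_X(3)[OF R(1)] R(2)] psubset_card_mono[OF in_X(3)[OF assms(2)] R(3)] .
    moreover obtain k where k: "card R = 2 ^ k" using card_X R by blast
    ultimately have "(2::nat) ^ m < 2 ^ k" "(2::nat) ^ k < 2 ^ Suc m" using m assms(4) by auto
    then have "m < k" "k < Suc m" by (simp_all only: power_strict_increasing_iff)
    then show False by simp
  qed
  ultimately show ?thesis using assms unfolding covered_by_X by blast
qed

lemma compl_neq:
  assumes a: "a \<in> carrier A" "a \<noteq> \<zero>"
  shows "\<sim> a \<noteq> a"
  using osum_ocompl[OF a(1)] osum_self[OF a(1)] a(2) by auto

lemma card_gen:
  assumes "a \<in> carrier A" "a \<noteq> \<zero>" "a \<noteq> \<one>"
  shows "card (gen a) = 4"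
proof -
  have "\<sim> a \<noteq> \<zero>" using compl_inj[of a "\<one>"] assms oone_closed by auto
  moreover have "\<sim> a \<noteq> \<one>" using compl_inj[of a "\<zero>"] assms ozero_closed by auto
  moreover have "\<sim> a \<noteq> a" using compl_neq assms by blast
  moreover have "\<zero> \<noteq> \<one>" using one_sum[of a] assms by (metis zero_sum)
  ultimately show ?thesis using assms by (auto simp: gen_def card_insert_if)
qed

text \<open>
  A cover \<open>S\<close> of the atom of \<open>a\<close> whose part below \<open>a\<close> is trivial is a frame with the three parts
  \<open>a\<close>, \<open>b\<close> and \<open>c\<close>.
\<close>

lemma cover_of_part:
  assumes cov: "covered_by X (gen a) S" and a: "a \<noteq> \<zero>" "a \<noteq> \<one>" and part: "ideal_part S a = gen a"
  obtains b c where "b \<in> S" "c \<in> S" "b \<noteq> \<zero>" "c \<noteq> \<zero>" "b \<oplus> c = Some (\<sim> a)" "card S = 8"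
    "\<And>T. ortho_subalgebra A T \<Longrightarrow> a \<in> T \<Longrightarrow> b \<in> T \<Longrightarrow> c \<in> T \<Longrightarrow> S \<subseteq> T"
proof -
  have S: "S \<in> carrier X" and aS: "a \<in> S" using cov by (auto simp: covered_by_X gen_def)
  obtain n h U where *: "n \<le> 4" "frame n h" "S = h ` Pow {..<n}" "U \<subseteq> {..<n}" "a = h U"
    "\<sim> a = h ({..<n} - U)" "gen a = h ` split_field {..<n} U" "ideal_part S a = h ` ideal_field {..<n} U"
    using obtain_frame_element[OF S aS] by metis
  let ?I = "{..<n}"
  note fr = *(2)
  have image_subset: "h ` F \<subset> h ` G \<longleftrightarrow> F \<subset> G" if "F \<subseteq> Pow ?I" "G \<subseteq> Pow ?I" for F G
    using inj_on_image_subset_iff[OF frame_inj[OF fr]] that by (simp add: less_le_not_le)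
  have fields: "split_field ?I U \<subseteq> Pow ?I" "\<And>W. ideal_field ?I W \<subseteq> Pow ?I"
    using *(4) by (auto simp: split_field_def ideal_field_def)
  have U: "U \<noteq> {}" "U \<noteq> ?I" using a * frame_empty[OF fr] frame_top[OF fr] by auto
  then obtain u where u: "u \<in> U" by auto
  have "ideal_field ?I U = split_field ?I U"
    using part *(7,8) inj_on_image_eq_iff[OF frame_inj[OF fr] fields(2,1)] by simp
  then have Uu: "U = {u}" using ideal_eq_split_field[OF *(4) U(2) _ u] by simp
  have uI: "u < n" using *(4) u by auto
  obtain j where j: "j \<in> ?I - U" using U(2) *(4) by auto
  \<comment> \<open>With fewer than two other parts \<open>S\<close> would equal \<open>gen a\<close>; with more than two,
    a coarser partition would lie strictly between.\<close>
  have "\<exists>k. k \<in> ?I - U \<and> k \<noteq> j"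
  proof (rule ccontr)
    assume "\<not> ?thesis"
    then have "?I - U = {j}" using j by blast
    then have I: "?I = {u, j}" using uI Uu by auto
    have "Pow ?I \<subseteq> split_field ?I U" unfolding I using j Uu by (auto simp: split_field_def)
    then have "S \<subseteq> gen a" using * by auto
    then show False using cov by (auto simp: covered_by_X)
  qed
  then obtain k where k: "k \<in> ?I - U" "k \<noteq> j" by blast
  have I: "?I = {u, j, k}"
  proof (rule ccontr)
    assume "?I \<noteq> {u, j, k}"
    then obtain l where l: "l \<in> ?I" "l \<noteq> u" "l \<noteq> j" "l \<noteq> k" using uI j k by auto
    let ?F = "ideal_field ?I {u, j}"
    have F: "?F \<in> set_fields ?I" using uI j by (intro ideal_field_in) auto
    have "{j} \<in> ?F" using j by (auto simp: ideal_field_def)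
    moreover have "{j} \<notin> split_field ?I U" using j k uI Uu by (auto simp: split_field_def)
    moreover have "split_field ?I U \<subseteq> ?F" using uI Uu by (auto simp: split_field_def ideal_field_def)
    moreover have "{k} \<notin> ?F" using k l Uu by (auto simp: ideal_field_def)
    moreover have "{k} \<in> Pow ?I" using k by auto
    ultimately have "split_field ?I U \<subset> ?F" "?F \<subset> Pow ?I" using fields by blast+
    then have "gen a \<subset> h ` ?F" "h ` ?F \<subset> S" using image_subset fields * by auto
    then show False using cov field_in_X[OF fr *(1) F] unfolding covered_by_X by blast
  qed
  have distinct: "u \<noteq> j" "u \<noteq> k" "j \<noteq> k" using j k Uu by auto
  have jk: "{j} \<subseteq> ?I" "{k} \<subseteq> ?I" using j k by auto
  show thesis
  proof (rule that)
    show "h {j} \<in> S" "h {k} \<in> S" using * jk by auto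
    show "h {j} \<noteq> \<zero>" "h {k} \<noteq> \<zero>" using frame_nonzero[OF fr] jk by auto
    have "{j} \<union> {k} = ?I - U" using I Uu distinct by auto
    then show "h {j} \<oplus> h {k} = Some (\<sim> a)"
      using frame_sum[OF fr jk] distinct *(6) by auto
    have "card ?I = 3" unfolding I using distinct by simp
    then have "n = 3" by simp
    then show "card S = 8" using frame_card[OF fr] *(3) by simp
    fix T assume T: "ortho_subalgebra A T" "a \<in> T" "h {j} \<in> T" "h {k} \<in> T"
    have "h {i} \<in> T" if "i < n" for i
    proof -
      have "i \<in> {u, j, k}" using that I by blast
      then show ?thesis using T *(5) Uu by auto
    qed
    then show "S \<subseteq> T" using frame_image_le[OF fr T(1)] *(3) by simp
  qed
qed

text \<open>
  The two covers refine \<open>\<sim> a\<close> and \<open>a\<close> respectively, so that their parts other than \<open>a\<close> and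
  \<open>\<sim> a\<close> together form a frame with four parts, which is their join.
\<close>

lemma join_of_covers:
  assumes a: "a \<in> carrier A"
    and y: "covered_by X (gen a) y" "ideal_part y a = gen a"
    and z: "covered_by X (gen a) z" "ideal_part z (\<sim> a) = gen a"
    and nontrivial: "a \<noteq> \<zero>" "a \<noteq> \<one>"
  shows "\<exists>j. is_lub X j {y, z} \<and> covered_by X y j \<and> covered_by X z j"
proof -
  have X: "y \<in> carrier X" "z \<in> carrier X" and ay: "a \<in> y" "a \<in> z"
    using y(1) z(1) unfolding covered_by_X gen_def by blast+
  have na: "\<sim> a \<noteq> \<zero>" "\<sim> a \<noteq> \<one>"
    using compl_inj[of a \<one>] compl_inj[of a \<zero>] a nontrivial by (auto simp: ozero_closed oone_closed)
  obtain b c where bc: "b \<in> y" "c \<in> y" "b \<noteq> \<zero>" "c \<noteq> \<zero>" "b \<oplus> c = Some (\<sim> a)" "card y = 8"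
    and y_le: "\<And>T. ortho_subalgebra A T \<Longrightarrow> a \<in> T \<Longrightarrow> b \<in> T \<Longrightarrow> c \<in> T \<Longrightarrow> y \<subseteq> T"
    using cover_of_part[OF y(1) nontrivial y(2)] by metis
  have "covered_by X (gen (\<sim> a)) z" "ideal_part z (\<sim> a) = gen (\<sim> a)"
    using z gen_compl[OF a] by simp_all
  then obtain p q where pq: "p \<in> z" "q \<in> z" "p \<noteq> \<zero>" "q \<noteq> \<zero>" "p \<oplus> q = Some (\<sim> (\<sim> a))" "card z = 8"
    and z_le: "\<And>T. ortho_subalgebra A T \<Longrightarrow> \<sim> a \<in> T \<Longrightarrow> p \<in> T \<Longrightarrow> q \<in> T \<Longrightarrow> z \<subseteq> T"
    using cover_of_part[OF _ na] by metis
  have car: "b \<in> carrier A" "c \<in> carrier A" "p \<in> carrier A" "q \<in> carrier A"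
    using mem_carrier X bc pq by blast+
  obtain h0 where h0: "frame 2 h0" "h0 {0} = a" "h0 {1} = \<sim> a" using frame_2[OF a nontrivial] .
  let ?h1 = "split_part 2 h0 1 b c"
  have sp1: "1 < (2::nat)" "b \<in> carrier A" "c \<in> carrier A" "b \<noteq> \<zero>" "c \<noteq> \<zero>" "b \<oplus> c = Some (h0 {1})"
    using car bc h0 by auto
  have h1: "frame 3 ?h1" "?h1 {0} = a" "?h1 {1} = b" "?h1 {2} = c"
    using frame_split_part[OF h0(1) sp1] split_part_left[OF h0(1) sp1] split_part_right[OF h0(1) sp1]
      split_part_keep[OF h0(1) sp1, of "{0}"] h0(2) by (simp_all add: numeral_3_eq_3 numeral_2_eq_2)
  let ?h = "split_part 3 ?h1 0 p q"
  have sp: "0 < (3::nat)" "p \<in> carrier A" "q \<in> carrier A" "p \<noteq> \<zero>" "q \<noteq> \<zero>" "p \<oplus> q = Some (?h1 {0})"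
    using car pq h1 a by auto
  have h: "frame 4 ?h" "?h {0} = p" "?h {1} = b" "?h {2} = c" "?h {3} = q"
    using frame_split_part[OF h1(1) sp] split_part_left[OF h1(1) sp] split_part_right[OF h1(1) sp]
      split_part_keep[OF h1(1) sp, of "{1}"] split_part_keep[OF h1(1) sp, of "{2}"] h1(3,4)
    by (simp_all add: eval_nat_numeral)
  define j where "j = ?h ` Pow {..<4}"
  have jX: "j \<in> carrier X" unfolding j_def using h(1) by (rule frame_in_X) simp
  have single: "?h {i} \<in> j" if "i < 4" for i unfolding j_def using that by auto
  have pbcq: "p \<in> j" "b \<in> j" "c \<in> j" "q \<in> j"
    using single[of 0] single[of 1] single[of 2] single[of 3] h by simp_all
  have oj: "ortho_subalgebra A j" using in_X(2)[OF jX] .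
  have "a \<in> j" using ortho_subalgebraD(5)[OF oj pbcq(1,4)] pq(5) a by simp
  then have "\<sim> a \<in> j" using compl_mem[OF jX] by blast
  have yj: "y \<subseteq> j" using y_le[OF oj \<open>a \<in> j\<close> pbcq(2,3)] .
  have zj: "z \<subseteq> j" using z_le[OF oj \<open>\<sim> a \<in> j\<close> pbcq(1,4)] .
  have cj: "card j = 16" unfolding j_def using frame_card[OF h(1)] by simp
  have "j \<subseteq> T" if T: "T \<in> carrier X" "y \<subseteq> T" "z \<subseteq> T" for T
    unfolding j_def
  proof (rule frame_image_le[OF h(1) in_X(2)[OF T(1)]])
    fix i :: nat assume "i < 4"
    then have "i = 0 \<or> i = 1 \<or> i = 2 \<or> i = 3" by linarith
    then show "?h {i} \<in> T" using h T bc pq by auto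
  qed
  then have "is_lub X j {y, z}" using X jX yj zj by (simp add: is_lub_pair)
  moreover have "covered_by X y j" "covered_by X z j"
    using X jX yj zj cj bc(6) pq(6) by (auto intro: covered_by_if_card)
  ultimately show ?thesis by blast
qed

lemma ideal_part_zero:
  assumes "S \<in> carrier X"
  shows "ideal_part S \<zero> = gen \<zero>" "ideal_part S \<one> = S"
proof -
  have o: "ortho_subalgebra A S" using in_X(2) assms .
  have c: "s \<in> carrier A" if "s \<in> S" for s using mem_carrier assms that .
  have one: "s \<oplus> \<one> \<noteq> None \<longleftrightarrow> s = \<zero>" if "s \<in> carrier A" for s
  proof
    assume "s \<oplus> \<one> \<noteq> None"
    then show "s = \<zero>" using one_sum[OF that] osum_comm[OF that oone_closed] by auto
  qed (simp add: oone_closed)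
  have "s \<oplus> \<sim> \<zero> \<noteq> None \<or> \<sim> s \<oplus> \<sim> \<zero> \<noteq> None \<longleftrightarrow> s = \<zero> \<or> s = \<one>" if "s \<in> S" for s
    using one[OF c[OF that]] one[OF ocompl_closed[OF c[OF that]]] compl_inj[OF c[OF that] oone_closed]
    by auto
  then show "ideal_part S \<zero> = gen \<zero>"
    using ortho_subalgebraD(2,3)[OF o] unfolding ideal_part_def gen_zero by blast
  show "ideal_part S \<one> = S" using c by (auto simp: ideal_part_def)
qed

text \<open>
  Compatibility with restriction is immediate, since orthogonality does not depend on the ambient
  subalgebra. The third condition is about covers in which \<open>a\<close> is an atom and a coatom,
  respectively.
\<close>

lemma direction_dir_of:
  assumes a: "a \<in> carrier A"
  shows "direction X (gen a) (dir_of a)"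
  unfolding direction_def
proof (intro conjI ballI allI impI)
  show "gen a \<in> carrier X" "basic X (gen a)" using a by (rule gen_in_X, rule basic_gen)
  show "dom (dir_of a) = up_set X (gen a)" by (auto simp: up_set_gen dir_of_def split: if_splits)
next
  fix y assume "y \<in> up_set X (gen a)"
  then show "principal_pair_for (down X y) (gen a) (the (dir_of a y))"
    by (simp add: up_set_gen dir_of_eq principal_pair_ideal_parts)
next
  fix y z v w
  assume "y \<in> up_set X (gen a)" "z \<in> up_set X (gen a)" "y \<sqsubseteq>\<^bsub>X\<^esub> z \<and> dir_of a z = Some (v, w)"
  then have *: "y \<in> carrier X" "a \<in> y" "z \<in> carrier X" "a \<in> z" "y \<subseteq> z"
    "v = ideal_part z a" "w = ideal_part z (\<sim> a)"
    by (auto simp: up_set_gen dir_of_eq)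
  then show "dir_of a y = Some (y \<sqinter>\<^bsub>X\<^esub> v, y \<sqinter>\<^bsub>X\<^esub> w)"
    by (simp add: dir_of_eq meet_X ideal_part_Int ideal_part_in_X compl_mem)
next
  fix y z
  assume h: "covered_by X (gen a) y \<and> covered_by X (gen a) z \<and>
    dir_of a y = Some (gen a, y) \<and> dir_of a z = Some (z, gen a)"
  then have X: "y \<in> carrier X" "z \<in> carrier X" and ay: "a \<in> y" "a \<in> z" and ne: "y \<noteq> gen a" "z \<noteq> gen a"
    by (auto simp: covered_by_X gen_def)
  have p: "ideal_part y a = gen a" "ideal_part z a = z" "ideal_part z (\<sim> a) = gen a"
    using h X ay by (auto simp: dir_of_eq)
  have "a \<noteq> \<zero>" using p(2) ne X ideal_part_zero by auto
  moreover have "a \<noteq> \<one>" using p(1) ne X ideal_part_zero by auto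
  ultimately show "\<exists>j. is_lub X j {y, z} \<and> covered_by X y j \<and> covered_by X z j"
    using join_of_covers[OF a] h p by blast
qed

section \<open>Every direction is the direction of an element\<close>

lemma obtain_cover:
  assumes S: "S \<in> carrier X" "a \<in> S" "S \<noteq> gen a"
  obtains T where "covered_by X (gen a) T" "T \<subseteq> S"
proof -
  let ?P = "\<lambda>T. T \<in> carrier X \<and> gen a \<subset> T \<and> T \<subseteq> S"
  have "?P S" using S gen_le[OF S(1,2)] by blast
  then obtain T where T: "?P T" "\<And>R. ?P R \<Longrightarrow> card T \<le> card R"
    using ex_has_least_nat[of ?P S card] by blast
  have "\<not> R \<subset> T" if "R \<in> carrier X" "gen a \<subset> R" for R
  proof
    assume "R \<subset> T"
    then have "card R < card T" using T(1) in_X(3)[of T] psubset_card_mono[of T R] by simp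
    moreover have "R \<subseteq> S" using T(1) \<open>R \<subset> T\<close> by auto
    then have "card T \<le> card R" using T(2)[of R] that by simp
    ultimately show False by simp
  qed
  moreover have "gen a \<in> carrier X" using gen_in_X[OF mem_carrier[OF S(1,2)]] .
  ultimately show thesis using that[of T] T(1) unfolding covered_by_X by blast
qed

text \<open>
  Both parts lie between the atom of \<open>a\<close> and its cover, and they are different.
\<close>

lemma cover_parts:
  assumes cov: "covered_by X (gen a) T"
  shows "ideal_part T a = gen a \<and> ideal_part T (\<sim> a) = T \<or>
    ideal_part T a = T \<and> ideal_part T (\<sim> a) = gen a"
proof -
  have T: "T \<in> carrier X" "a \<in> T" "T \<noteq> gen a" using cov by (auto simp: covered_by_X gen_def)
  have "P = gen a \<or> P = T" if "P \<in> carrier X" "gen a \<subseteq> P" "P \<subseteq> T" for P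
    using cov that unfolding covered_by_X by blast
  moreover have "gen a \<subseteq> ideal_part T a" "gen a \<subseteq> ideal_part T (\<sim> a)"
    using ideal_part_Int_compl[OF T(1,2)] by auto
  ultimately have "ideal_part T a = gen a \<or> ideal_part T a = T"
    "ideal_part T (\<sim> a) = gen a \<or> ideal_part T (\<sim> a) = T"
    using ideal_part_in_X[OF T(1)] T(2) compl_mem[OF T(1,2)] ideal_part_le by blast+
  then show ?thesis using ideal_part_neq[OF T] by auto
qed

text \<open>
  By the classification of principal pairs, a direction for the atom of \<open>a\<close> has at each place
  one of two values, which are exchanged by replacing \<open>a\<close> with \<open>\<sim> a\<close>. If it had values of
  both sorts then, restricting them to covers of the atom and applying the third condition on
  directions, to this direction or to the one of \<open>a\<close>, would give a common upper bound of two
  such places; its value would restrict to both.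
\<close>

lemma direction_cases:
  assumes a: "a \<in> carrier A" and d: "direction X (gen a) d"
  shows "d = dir_of a \<or> d = dir_of (\<sim> a)"
proof (rule ccontr)
  assume not: "\<not> ?thesis"
  let ?d = "dir_of a" and ?e = "dir_of (\<sim> a)"
  have dom: "dom d = up_set X (gen a)"
    and pp: "\<And>S. S \<in> up_set X (gen a) \<Longrightarrow> principal_pair_for (down X S) (gen a) (the (d S))"
    and mt: "\<And>S T v w. S \<in> up_set X (gen a) \<Longrightarrow> T \<in> up_set X (gen a) \<Longrightarrow> S \<sqsubseteq>\<^bsub>X\<^esub> T \<Longrightarrow>
      d T = Some (v, w) \<Longrightarrow> d S = Some (S \<sqinter>\<^bsub>X\<^esub> v, S \<sqinter>\<^bsub>X\<^esub> w)"
    and cv: "\<And>S T. covered_by X (gen a) S \<Longrightarrow> covered_by X (gen a) T \<Longrightarrow> d S = Some (gen a, S) \<Longrightarrow>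
      d T = Some (T, gen a) \<Longrightarrow> \<exists>j. is_lub X j {S, T} \<and> covered_by X S j \<and> covered_by X T j"
    using d unfolding direction_def by blast+
  note dom = dom[unfolded up_set_gen] and up = up_set_gen[of a]
  have vals: "d S = ?d S \<or> d S = ?e S" if S: "S \<in> carrier X" "a \<in> S" for S
  proof -
    have "S \<in> dom d" using dom S by simp
    then obtain v w where vw: "d S = Some (v, w)" by auto
    have "principal_pair_for (down X S) (gen a) (v, w)" using pp[of S] S vw by (simp add: up)
    from principal_pair_cases[OF S this] show ?thesis
      by (elim disjE) (simp_all add: vw dir_of_eq dir_of_compl_eq S)
  qed
  have neq: "?d S \<noteq> ?e S" if "S \<in> carrier X" "a \<in> S" "S \<noteq> gen a" for S
    using ideal_part_neq[OF that] that by (simp add: dir_of_eq dir_of_compl_eq)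
  have restrict: "d S = dir_of b S"
    if "S \<in> carrier X" "a \<in> S" "T \<in> carrier X" "S \<subseteq> T" "d T = dir_of b T" "b = a \<or> b = \<sim> a" for S T b
  proof -
    have b: "b \<in> S" "b \<in> T" using that compl_mem by blast+
    then have "d T = Some (ideal_part T b, ideal_part T (\<sim> b))" using that by (simp add: dir_of_eq)
    then have "d S = Some (S \<sqinter>\<^bsub>X\<^esub> ideal_part T b, S \<sqinter>\<^bsub>X\<^esub> ideal_part T (\<sim> b))"
      using mt[of S T] that b by (auto simp: up)
    then show ?thesis using that b
      by (simp add: dir_of_eq meet_X ideal_part_Int ideal_part_in_X compl_mem)
  qed
  have none: "d S = None \<and> ?d S = None \<and> ?e S = None" if "\<not> (S \<in> carrier X \<and> a \<in> S)" for S
    using that dom compl_mem_iff[OF _ a] by (auto simp: dir_of_def domIff split: if_splits)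
  \<comment> \<open>a difference from one of the two directions already shows at a cover of the atom\<close>
  have at_cover: "\<exists>T. covered_by X (gen a) T \<and> d T = dir_of b T" if b: "b = a \<or> b = \<sim> a" "d \<noteq> dir_of (\<sim> b)" for b
  proof -
    obtain S where S: "d S \<noteq> dir_of (\<sim> b) S" using b(2) by blast
    have "S \<in> carrier X \<and> a \<in> S"
    proof (rule ccontr)
      assume "\<not> ?thesis"
      from none[OF this] show False using S b(1) a by auto
    qed
    then have SX: "S \<in> carrier X" "a \<in> S" by auto
    have dS: "d S = dir_of b S" using vals[OF SX] S b(1) a by auto
    have "S \<noteq> gen a"
    proof
      assume "S = gen a"
      then have "ideal_part S a = gen a" "ideal_part S (\<sim> a) = gen a"
        using ideal_part_Int_compl[OF SX] ideal_part_le[of S] by blast+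
      then show False using S dS b(1) SX a by (auto simp: dir_of_eq dir_of_compl_eq)
    qed
    then obtain T where T: "covered_by X (gen a) T" "T \<subseteq> S" using obtain_cover[OF SX] by blast
    have "d T = dir_of b T" using restrict[OF cover_gen(1,2)[OF T(1)] SX(1) T(2) dS b(1)] .
    then show ?thesis using T by blast
  qed
  obtain S where S: "covered_by X (gen a) S" "d S = ?d S" using at_cover[of a] not by blast
  obtain T where T: "covered_by X (gen a) T" "d T = ?e T" using at_cover[of "\<sim> a"] not a by auto
  have SX: "S \<in> carrier X" "a \<in> S" "S \<noteq> gen a" and TX: "T \<in> carrier X" "a \<in> T" "T \<noteq> gen a"
    using cover_gen[OF S(1)] cover_gen[OF T(1)] by auto
  \<comment> \<open>the third condition for the direction of \<open>a\<close> itself, used when \<open>a\<close> is an atom of one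
    cover and a coatom of the other\<close>
  have cv': "\<exists>j. is_lub X j {S, T} \<and> covered_by X S j \<and> covered_by X T j"
    if "covered_by X (gen a) S" "covered_by X (gen a) T" "?d S = Some (gen a, S)" "?d T = Some (T, gen a)" for S T
    using direction_dir_of[OF a] that unfolding direction_def by blast
  have "\<exists>j. is_lub X j {S, T}"
    using cover_parts[OF S(1)]
  proof
    assume s: "ideal_part S a = gen a \<and> ideal_part S (\<sim> a) = S"
    show ?thesis
      using cover_parts[OF T(1)]
    proof
      assume "ideal_part T a = gen a \<and> ideal_part T (\<sim> a) = T"
      then show ?thesis
        using s S T cv[of S T] SX TX by (auto simp: dir_of_eq dir_of_compl_eq)
    next
      assume "ideal_part T a = T \<and> ideal_part T (\<sim> a) = gen a"
      then show ?thesis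
        using s S(1) T(1) cv'[of S T] SX TX by (auto simp: dir_of_eq)
    qed
  next
    assume s: "ideal_part S a = S \<and> ideal_part S (\<sim> a) = gen a"
    show ?thesis
      using cover_parts[OF T(1)]
    proof
      assume "ideal_part T a = gen a \<and> ideal_part T (\<sim> a) = T"
      then show ?thesis
        using s S(1) T(1) cv'[of T S] SX TX by (auto simp: dir_of_eq insert_commute)
    next
      assume "ideal_part T a = T \<and> ideal_part T (\<sim> a) = gen a"
      then show ?thesis
        using s S T cv[of T S] SX TX by (auto simp: dir_of_eq dir_of_compl_eq insert_commute)
    qed
  qed
  then obtain j where j: "j \<in> carrier X" "S \<subseteq> j" "T \<subseteq> j" using SX TX by (auto simp: is_lub_pair)
  then have "a \<in> j" using SX by blast
  from vals[OF j(1) this] show False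
  proof
    assume "d j = ?d j"
    then show False using restrict[OF TX(1,2) j(1,3), of a] T(2) neq[OF TX] by simp
  next
    assume "d j = ?e j"
    then show False using restrict[OF SX(1,2) j(1,2), of "\<sim> a"] S(2) neq[OF SX] by simp
  qed
qed

lemma directions_X: "directions X = dir_of ` carrier A"
proof (intro equalityI subsetI)
  fix d assume "d \<in> directions X"
  then obtain x where d: "direction X x d" by (auto simp: directions_def)
  then have "basic X x" by (simp add: direction_def)
  then obtain a where a: "a \<in> carrier A" "x = gen a"
    using is_atom_X bottom_X ozero_closed unfolding basic_def by blast
  then show "d \<in> dir_of ` carrier A"
    using direction_cases[OF a(1)] d ocompl_closed[OF a(1)] by blast
next
  fix d assume "d \<in> dir_of ` carrier A"
  then show "d \<in> directions X" using direction_dir_of by (auto simp: directions_def)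
qed

lemma direction_dir_of_unique:
  assumes "a \<in> carrier A" "direction X x (dir_of a)"
  shows "x = gen a"
proof -
  have x: "dom (dir_of a) = up_set X x" "x \<in> carrier X"
    using assms(2) unfolding direction_def by blast+
  have g: "dom (dir_of a) = up_set X (gen a)"
    using direction_dir_of[OF assms(1)] unfolding direction_def by blast
  have "x \<in> up_set X x" "gen a \<in> up_set X (gen a)"
    using x(2) gen_in_X[OF assms(1)] by (simp_all add: up_set_def)
  then have "x \<in> up_set X (gen a)" "gen a \<in> up_set X x" using x(1) g by simp_all
  then show ?thesis by (auto simp: up_set_def)
qed

section \<open>Sums of directions\<close>

lemma gen_frame_eq:
  assumes fr: "frame n h" and UV: "U \<subseteq> {..<n}" "V \<subseteq> {..<n}" and e: "gen (h U) = gen (h V)"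
  shows "U = {} \<or> U = V \<or> U = {..<n} - V \<or> U = {..<n}"
proof -
  have "h U \<in> h ` split_field {..<n} V" using e gen_frame[OF fr UV(2)] by (auto simp: gen_def)
  then obtain W where "W \<in> split_field {..<n} V" "h U = h W" by auto
  moreover have "W \<subseteq> {..<n}" using set_fieldsD(1)[OF split_field_in[OF UV(2)]] calculation by auto
  ultimately have "U \<in> split_field {..<n} V" using frame_eq_iff[OF fr UV(1)] by simp
  then show ?thesis by (auto simp: split_field_def)
qed

lemma dir_of_single:
  assumes fr: "frame n h" "n \<le> 4" and i: "i < n"
  shows "dir_of (h {i}) (h ` Pow {..<n}) = Some (gen (h {i}), h ` Pow {..<n})"
proof -
  let ?I = "{..<n}"
  have U: "{i} \<subseteq> ?I" using i by simp
  have "ideal_part (h ` Pow ?I) (h {i}) = gen (h {i})"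
    using ideal_part_frame[OF fr(1) U] gen_frame[OF fr(1) U] split_eq_ideal_field(1)[OF U] by simp
  moreover have "ideal_part (h ` Pow ?I) (\<sim> (h {i})) = h ` Pow ?I"
    using ideal_part_frame[OF fr(1), of "?I - {i}"] frame_compl[OF fr(1) U]
      split_eq_ideal_field(2)[OF U] by simp
  ultimately show ?thesis using frame_in_X[OF fr] U by (simp add: dir_of_eq)
qed

lemma dir_of_single_imp:
  assumes S: "S \<in> carrier X" "a \<in> S" and a: "a \<noteq> \<one>" and d: "dir_of a S = Some (gen a, S)"
    and fr: "frame n h" "S = h ` Pow {..<n}" and U: "U \<subseteq> {..<n}" "a = h U" "i \<in> U"
  shows "U = {i}"
proof (rule ideal_eq_split_field[OF U(1) _ _ U(3)])
  show "U \<noteq> {..<n}" using a U(2) frame_top[OF fr(1)] by auto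
  have "h ` ideal_field {..<n} U = h ` split_field {..<n} U"
    using d S ideal_part_frame[OF fr(1) U(1)] gen_frame[OF fr(1) U(1)] fr(2) U(2) by (simp add: dir_of_eq)
  then show "ideal_field {..<n} U = split_field {..<n} U"
    using inj_on_image_eq_iff[OF frame_inj[OF fr(1)]] set_fieldsD(1)[OF split_field_in[OF U(1)]]
      set_fieldsD(1)[OF ideal_field_in[OF U(1)]] by metis
qed

text \<open>
  At the common cover \<open>w\<close> of the two atoms, the value of the direction of \<open>a\<close> says that nothing in
  \<open>w\<close> lies strictly below \<open>a\<close>, so that \<open>a\<close> is a single part of any frame of \<open>w\<close>, and likewise for
  \<open>b\<close>. Different parts are orthogonal.
\<close>

lemma dir_summable_imp:
  assumes ab: "a \<in> carrier A" "b \<in> carrier A" and s: "dir_summable X (dir_of a) (dir_of b) w z"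
  shows "a \<noteq> \<zero>" "b \<noteq> \<zero>" "b \<noteq> \<sim> a" "a \<oplus> b \<noteq> None"
proof -
  obtain x y where nv: "near_via X x y w z" and dx: "direction X x (dir_of a)" "direction X y (dir_of b)"
    and w: "dir_of a w = Some (x, w)" "dir_of b w = Some (y, w)"
    using s unfolding dir_summable_def by blast
  have xy: "x = gen a" "y = gen b" using direction_dir_of_unique ab dx by auto
  have at: "is_atom X (gen a)" "is_atom X (gen b)" and ne: "gen a \<noteq> gen b"
    and cov: "covered_by X (gen a) w" "covered_by X (gen b) w"
    using nv xy unfolding near_via_def by blast+
  have nontriv: "c \<noteq> \<zero> \<and> c \<noteq> \<one>" if "is_atom X (gen c)" for c
  proof -
    have "gen \<zero> \<subset> gen c" using that by (simp add: is_atom_def bottom_X covered_by_X)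
    then have "gen c \<noteq> gen \<zero>" by simp
    moreover have "gen \<one> = gen \<zero>" using gen_compl[OF ozero_closed] by simp
    ultimately show ?thesis by metis
  qed
  note na = nontriv[OF at(1)] and nb = nontriv[OF at(2)]
  show "a \<noteq> \<zero>" "b \<noteq> \<zero>" using na nb by auto
  show "b \<noteq> \<sim> a" using ne gen_compl[OF ab(1)] by auto
  have wX: "w \<in> carrier X" "a \<in> w" "b \<in> w" using cover_gen cov by auto
  obtain n h where h: "n \<le> 4" "frame n h" "w = h ` Pow {..<n}" using wX(1) by (rule obtain_frame)
  obtain U V where UV: "U \<subseteq> {..<n}" "a = h U" "V \<subseteq> {..<n}" "b = h V" using wX h by auto
  have "U \<noteq> {}" "V \<noteq> {}" using na nb UV frame_empty[OF h(2)] by auto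
  then obtain i j where ij: "i \<in> U" "j \<in> V" by auto
  have "U = {i}" "V = {j}"
    using dir_of_single_imp[OF wX(1,2) _ w(1)[unfolded xy] h(2,3) UV(1,2) ij(1)]
      dir_of_single_imp[OF wX(1,3) _ w(2)[unfolded xy] h(2,3) UV(3,4) ij(2)] na nb by auto
  moreover have "U \<noteq> V" using ne UV by auto
  ultimately have "U \<inter> V = {}" by auto
  then show "a \<oplus> b \<noteq> None" using frame_sum[OF h(2) UV(1,3)] UV by simp
qed

text \<open>
  Orthogonal elements \<open>a\<close> and \<open>b\<close> are two parts of the three-part frame \<open>a\<close>, \<open>b\<close>, \<open>\<sim> (a \<oplus> b)\<close>,
  which is the join of their atoms; the third atom below it belongs to the third part, and
  hence also to \<open>a \<oplus> b\<close>.
\<close>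

lemma dir_summable_sum:
  assumes ab: "a \<in> carrier A" "b \<in> carrier A" "a \<noteq> \<zero>" "b \<noteq> \<zero>" "b \<noteq> \<sim> a" and s: "a \<oplus> b = Some s"
  obtains w where "\<And>w' z'. dir_summable X (dir_of a) (dir_of b) w' z' \<longleftrightarrow> w' = w \<and> z' = gen s"
    "dir_of s w = Some (w, gen s)" "w \<noteq> gen s"
proof -
  have sc: "s \<in> carrier A" using osum_closed[OF ab(1,2) s] .
  have s1: "s \<noteq> \<one>" using ocompl_unique[OF ab(1,2)] s ab(5) by auto
  have a1: "a \<noteq> \<one>" using one_sum[OF ab(2)] s ab(4) by auto
  have b1: "b \<noteq> \<one>" using one_sum[OF ab(1)] s ab(3) osum_comm[OF ab(1,2)] by auto
  have s0: "s \<noteq> \<zero>" using sum_eq_zero[OF ab(1,2)] s ab(3) by auto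
  obtain h where h: "frame 3 h" "h {0} = a" "h {1} = \<sim> s" "h {2} = b"
    using frame_3[OF ab(1-4) s s1] .
  let ?I = "{..<3::nat}"
  define w where "w = h ` Pow ?I"
  have wX: "w \<in> carrier X" unfolding w_def using h(1) by (rule frame_in_X) simp
  have hs: "h {0, 2} = s"
    using frame_sum[OF h(1), of "{0}" "{2}"] h s by (simp add: insert_commute)
  have single: "h {i} \<in> w" if "i < 3" for i unfolding w_def using that by auto
  have in_w: "a \<in> w" "b \<in> w" "\<sim> s \<in> w"
    using single[of 0] single[of 1] single[of 2] h by simp_all
  have cw: "card w = 8" unfolding w_def using frame_card[OF h(1)] by simp
  have w_le: "w \<subseteq> T" if T: "T \<in> carrier X" "a \<in> T" "b \<in> T" for T
    unfolding w_def
  proof (rule frame_image_le[OF h(1) in_X(2)[OF T(1)]])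
    have "s \<in> T" using ortho_subalgebraD(5)[OF in_X(2)[OF T(1)] T(2,3) s] .
    then have "\<sim> s \<in> T" using compl_mem[OF T(1)] by blast
    fix i :: nat assume "i < 3"
    then have "i = 0 \<or> i = 1 \<or> i = 2" by linarith
    then show "h {i} \<in> T" using h T \<open>\<sim> s \<in> T\<close> by auto
  qed
  have da: "dir_of a w = Some (gen a, w)" and db: "dir_of b w = Some (gen b, w)"
    and ds': "dir_of (\<sim> s) w = Some (gen (\<sim> s), w)"
    using dir_of_single[OF h(1), of 0] dir_of_single[OF h(1), of 2] dir_of_single[OF h(1), of 1] h
    unfolding w_def by simp_all
  have sw: "s \<in> w" using compl_mem[OF wX in_w(3)] sc by simp
  have ds: "dir_of s w = Some (w, gen s)"
    using ds' wX sw in_w(3) sc gen_compl[OF sc] by (simp add: dir_of_eq)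
  have cov: "covered_by X (gen c) w" if "c \<in> carrier A" "c \<noteq> \<zero>" "c \<noteq> \<one>" "c \<in> w" for c
    using that wX gen_in_X gen_le card_gen cw by (intro covered_by_if_card) auto
  have I: "{0} \<subseteq> ?I" "{2} \<subseteq> ?I" "{0, 2} \<subseteq> ?I" "{1} \<subseteq> ?I" by auto
  have co: "?I - {0} = {1, 2}" "?I - {2} = {0, 1}" "?I = {0, 1, 2}" by auto
  have gen_neq: "gen (h U) \<noteq> gen (h V)"
    if "U \<subseteq> ?I" "V \<subseteq> ?I" "U \<notin> {{}, V, ?I - V, ?I}" for U V
    using gen_frame_eq[OF h(1) that(1,2)] that(3) by blast
  have notin: "{0} \<notin> {{}, {2}, ?I - {2}, ?I}" "{0, 2} \<notin> {{}, {2}, ?I - {2}, ?I}"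
    "{0, 2} \<notin> {{}, {0}, ?I - {0}, ?I}"
    unfolding co(1,2) unfolding co(3) insert_iff empty_iff set_eq_iff by presburger+
  have gab: "gen a \<noteq> gen b" using gen_neq[OF I(1,2) notin(1)] unfolding h .
  have gsb: "gen s \<noteq> gen b" using gen_neq[OF I(3,2) notin(2)] unfolding h hs .
  have gsa: "gen s \<noteq> gen a" using gen_neq[OF I(3,1) notin(3)] unfolding h hs .
  have lub: "is_lub X w {gen a, gen b}"
    using wX gen_in_X ab(1,2) gen_le[OF wX] in_w w_le gen_subset_iff in_X(2)
    by (simp add: is_lub_pair)
  have at: "is_atom X (gen a)" "is_atom X (gen b)" "is_atom X (gen s)"
    unfolding is_atom_X using ab sc a1 b1 s1 s0 by blast+
  have "near_via X (gen a) (gen b) w (gen s)"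
    unfolding near_via_def using at gab lub cov ab a1 b1 in_w gen_le[OF wX sw] gsa gsb by simp
  then have sum: "dir_summable X (dir_of a) (dir_of b) w (gen s)"
    unfolding dir_summable_def
    using direction_dir_of ab(1,2) da db by blast
  have unique: "w' = w \<and> z' = gen s" if sm: "dir_summable X (dir_of a) (dir_of b) w' z'" for w' z'
  proof -
    obtain x y where nv: "near_via X x y w' z'" and dx: "direction X x (dir_of a)" "direction X y (dir_of b)"
      using sm unfolding dir_summable_def by blast
    have xy: "x = gen a" "y = gen b" using direction_dir_of_unique ab dx by auto
    have l: "is_lub X w' {gen a, gen b}" and z: "is_atom X z'" "z' \<sqsubseteq>\<^bsub>X\<^esub> w'" "z' \<noteq> gen a" "z' \<noteq> gen b"
      using nv xy unfolding near_via_def by blast+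
    have ww: "w' = w" using partial_order.least_unique[OF partial_order_X l lub] .
    obtain c where c: "c \<in> carrier A" "c \<noteq> \<zero>" "c \<noteq> \<one>" "z' = gen c" using z(1) is_atom_X by blast
    have "c \<in> w" using z(2) ww c(4) by (auto simp: gen_def)
    then obtain V where V: "V \<subseteq> ?I" "c = h V" unfolding w_def by auto
    have "Pow ?I = {{}, {0}, {1}, {2}, {0, 1}, {0, 2}, {1, 2}, {0, 1, 2}}"
      by (auto simp: eval_nat_numeral lessThan_Suc Pow_insert)
    then have "V \<in> {{}, {0}, {1}, {2}, {0, 1}, {0, 2}, {1, 2}, {0, 1, 2}}" using V(1) by blast
    moreover have "h {1, 2} = \<sim> a" "h {0, 1} = \<sim> b" "h {0, 1, 2} = \<one>"
      using frame_compl[OF h(1) I(1), unfolded co(1)] frame_compl[OF h(1) I(2), unfolded co(2)]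
        frame_top[OF h(1), unfolded co(3)] h by simp_all
    ultimately have "c = a \<or> c = \<sim> a \<or> c = b \<or> c = \<sim> b \<or> c = s \<or> c = \<sim> s"
      using V(2) c frame_empty[OF h(1)] h hs by auto
    then have "z' = gen s" using z(3,4) c(4) gen_compl ab(1,2) sc by auto
    then show ?thesis using ww by simp
  qed
  have "w \<noteq> gen s" using cw card_gen[OF sc s0 s1] by auto
  then show thesis using that[of w] sum unique ds by blast
qed

text \<open>
  Of the two directions for the atom of \<open>s\<close>, the required value at \<open>w\<close> singles out the one of \<open>s\<close>;
  the other one has the components exchanged.
\<close>

lemma dir_summable_unique_value:
  assumes ab: "a \<in> carrier A" "b \<in> carrier A" and s: "a \<oplus> b = Some s"
    and sm: "\<exists>w z. dir_summable X (dir_of a) (dir_of b) w z"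
  shows "(\<exists>w z. dir_summable X (dir_of a) (dir_of b) w z \<and> direction X z f \<and> f w = Some (w, z))
    \<longleftrightarrow> f = dir_of s"
proof -
  have sc: "s \<in> carrier A" using osum_closed[OF ab s] .
  have nz: "a \<noteq> \<zero>" "b \<noteq> \<zero>" "b \<noteq> \<sim> a" using dir_summable_imp[OF ab] sm by blast+
  obtain w where w: "\<And>w' z'. dir_summable X (dir_of a) (dir_of b) w' z' \<longleftrightarrow> w' = w \<and> z' = gen s"
    "dir_of s w = Some (w, gen s)" "w \<noteq> gen s"
    using dir_summable_sum[OF ab nz s] by metis
  have "dir_of (\<sim> s) w = Some (gen s, w)"
    unfolding dir_compl_dir_of[OF sc, symmetric] by (simp add: dir_compl_def w(2))
  then have "dir_of (\<sim> s) w \<noteq> Some (w, gen s)" using w(3) by simp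
  then have "direction X (gen s) f \<and> f w = Some (w, gen s) \<longleftrightarrow> f = dir_of s"
    using direction_cases[OF sc, of f] direction_dir_of[OF sc] w(2) by blast
  then show ?thesis by (simp add: w(1))
qed

section \<open>Proper orthoalgebras are recovered from their directions\<close>

lemma dir_of_zero: "dir_of \<zero> = dir_zero X"
proof
  fix S
  show "dir_of \<zero> S = dir_zero X S"
    using ideal_part_zero[of S] ortho_subalgebraD(2)[OF in_X(2)] bottom_X
    by (simp add: dir_of_def dir_zero_def)
qed

lemma dir_of_one: "dir_of \<one> = dir_one X"
proof
  fix S
  show "dir_of \<one> S = dir_one X S"
    using ideal_part_zero[of S] ortho_subalgebraD(3)[OF in_X(2)] bottom_X
    by (simp add: dir_of_def dir_one_def)
qed

text \<open>
  The subalgebra of \<open>a\<close> has at most four elements, hence is not a block. A Boolean subalgebra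
  properly above it may have infinite height, but splitting a single part of the frame of \<open>a\<close>
  within it gives one with at most three parts.
\<close>

lemma proper_above_gen:
  assumes "proper A" and a: "a \<in> carrier A"
  obtains S where "S \<in> carrier X" "gen a \<subset> S"
proof -
  obtain n h where h: "n \<le> 4" "frame n h" "gen a = h ` Pow {..<n}"
    using gen_in_X[OF a] by (rule obtain_frame)
  have "card (gen a) \<le> 4" unfolding gen_def by (intro card_insert_le_m1) auto
  then have "(2::nat) ^ n \<le> 2 ^ 2" using frame_card[OF h(2)] h(3) by simp
  then have n: "n \<le> 2" by (simp only: power_increasing_iff)
  have bool: "boolean_subalgebra A (gen a)" using in_X(1) gen_in_X a by blast
  have "small (gen a)" using \<open>card (gen a) \<le> 4\<close> by (simp add: small_def gen_def)
  then obtain T where T: "boolean_subalgebra A T" "gen a \<subset> T"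
    using assms(1) bool unfolding proper_def block_def by blast
  obtain h' where h': "frame (Suc n) h'" "h ` Pow {..<n} \<subseteq> h' ` Pow {..<Suc n}"
    using frame_extend[OF T(1) h(2)] T(2) h(3) by metis
  have "card (gen a) < card (h' ` Pow {..<Suc n})"
    unfolding h(3) frame_card[OF h(2)] frame_card[OF h'(1)] by simp
  then have "gen a \<subset> h' ` Pow {..<Suc n}" using h'(2) h(3) by auto
  moreover have "h' ` Pow {..<Suc n} \<in> carrier X" using h'(1) n by (intro frame_in_X) auto
  ultimately show thesis using that by blast
qed

text \<open>
  Equal directions are directions for the same atom, so that only \<open>a\<close> and \<open>\<sim> a\<close> could be confused;
  the values at a subalgebra properly above the atom distinguish them.
\<close>

lemma inj_dir_of:
  assumes "proper A"
  shows "inj_on dir_of (carrier A)"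
proof (rule inj_onI)
  fix a b assume a: "a \<in> carrier A" and b: "b \<in> carrier A" and e: "dir_of a = dir_of b"
  have "gen a = gen b"
    using direction_dir_of[OF a] direction_dir_of_unique[OF b] e by simp
  moreover have "b \<in> gen b" "a \<in> gen a" by (simp_all add: gen_def)
  ultimately have mem: "b \<in> gen a" "a \<in> gen b" by simp_all
  obtain S where S: "S \<in> carrier X" "gen a \<subset> S" using proper_above_gen[OF assms a] .
  have aS: "a \<in> S" "S \<noteq> gen a" using S by (auto simp: gen_def)
  have "dir_of a S \<noteq> dir_of (\<sim> a) S"
    using ideal_part_neq[OF S(1) aS] S(1) aS by (simp add: dir_of_eq dir_of_compl_eq)
  then have not_compl: "b \<noteq> \<sim> a" using e by auto
  have "a = \<zero> \<or> a = \<one>" if "b = \<zero> \<or> b = \<one>"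
    using mem(2) that by (auto simp: gen_def)
  then show "a = b" using mem(1) not_compl by (auto simp: gen_def)
qed

lemma dir_sum_dir_of:
  assumes proper_A: "proper A" and ab: "a \<in> carrier A" "b \<in> carrier A"
  shows "dir_sum X (dir_of a) (dir_of b) = map_option dir_of (a \<oplus> b)"
proof -
  have eq: "dir_of c = dir_of d \<longleftrightarrow> c = d" if "c \<in> carrier A" "d \<in> carrier A" for c d
    using inj_dir_of[OF proper_A] that by (auto dest: inj_onD)
  have zero: "dir_of c = dir_zero X \<longleftrightarrow> c = \<zero>" if "c \<in> carrier A" for c
    using eq[OF that ozero_closed] by (simp add: dir_of_zero)
  have compl: "dir_of b = dir_compl (dir_of a) \<longleftrightarrow> b = \<sim> a"
    using eq[OF ab(2) ocompl_closed[OF ab(1)]] by (simp add: dir_compl_dir_of ab(1))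
  consider "b = \<zero>" | "a = \<zero>" | "b = \<sim> a" | "a \<noteq> \<zero>" "b \<noteq> \<zero>" "b \<noteq> \<sim> a" by blast
  then show ?thesis
  proof cases
    case 1
    then show ?thesis using ab zero by (simp add: dir_sum_def)
  next
    case 2
    then show ?thesis using ab zero dir_of_zero by (auto simp: dir_sum_def)
  next
    case 3
    show ?thesis
    proof (cases "a = \<zero> \<or> b = \<zero>")
      case True
      then show ?thesis using ab zero dir_of_zero by (auto simp: dir_sum_def)
    next
      case False
      have "dir_of b = dir_compl (dir_of a)" "dir_of b \<noteq> dir_zero X" "dir_of a \<noteq> dir_zero X"
        using compl 3 zero[OF ab(1)] zero[OF ab(2)] False by blast+
      moreover have "a \<oplus> b = Some \<one>" using 3 osum_ocompl[OF ab(1)] by simp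
      ultimately show ?thesis by (simp add: dir_sum_def dir_of_one)
    qed
  next
    case 4
    show ?thesis
    proof (cases "a \<oplus> b")
      case None
      then have "\<not> (\<exists>w z. dir_summable X (dir_of a) (dir_of b) w z)"
        using dir_summable_imp(4)[OF ab] by blast
      then show ?thesis using None 4 zero ab compl by (simp add: dir_sum_def)
    next
      case (Some s)
      have sm: "\<exists>w z. dir_summable X (dir_of a) (dir_of b) w z"
        using dir_summable_sum[OF ab 4 Some] by metis
      have "(THE f. \<exists>w z. dir_summable X (dir_of a) (dir_of b) w z \<and> direction X z f \<and> f w = Some (w, z))
          = dir_of s"
        by (simp only: dir_summable_unique_value[OF ab Some sm] the_eq_trivial)
      then show ?thesis using Some 4 zero ab compl sm by (simp add: dir_sum_def)
    qed
  qed
qed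

lemma Dir_X:
  assumes proper_A: "proper A"
  shows "orthoalgebra (Dir X)" "ortho_isomorphic A (Dir X)"
proof -
  have "bij_betw dir_of (carrier A) (carrier (Dir X))"
    using inj_dir_of[OF proper_A] by (simp add: bij_betw_def Dir_def directions_X)
  then show "orthoalgebra (Dir X)" "ortho_isomorphic A (Dir X)"
    using orthoalgebra_transport[OF orthoalgebra_axioms, of dir_of "Dir X"]
    by (simp_all add: Dir_def dir_of_zero dir_of_one dir_compl_dir_of dir_sum_dir_of[OF proper_A])
qed

lemma Dir_hypergraph_poset:
  assumes proper_A: "proper A"
  shows "orthoalgebra (Dir (hypergraph_poset (hypergraph_of A)))" (is "orthoalgebra (Dir ?Y)")
    and "ortho_isomorphic (Dir X) (Dir (hypergraph_poset (hypergraph_of A)))"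
proof -
  interpret i: downset_lattice_iso X ?Y "atoms_below (BSub A)"
    by (intro downset_lattice_iso.intro order_iso_hypergraph_poset downset_lattice_X)
  interpret j: downset_lattice_iso ?Y X i.g by (rule i.downset_lattice_iso_inverse)
  have bij: "bij_betw i.lift (carrier (Dir X)) (carrier (Dir ?Y))"
  proof (rule bij_betw_imageI)
    show "inj_on i.lift (carrier (Dir X))"
      by (rule inj_onI) (simp add: Dir_def i.lift_eq_iff)
    show "i.lift ` carrier (Dir X) = carrier (Dir ?Y)"
    proof (intro equalityI subsetI)
      fix d assume "d \<in> i.lift ` carrier (Dir X)"
      then show "d \<in> carrier (Dir ?Y)" using i.lift_in_directions by (auto simp: Dir_def)
    next
      fix d assume "d \<in> carrier (Dir ?Y)"
      then have d: "d \<in> directions ?Y" by (simp add: Dir_def)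
      then have "j.lift d \<in> carrier (Dir X)" "i.lift (j.lift d) = d"
        using j.lift_in_directions[OF d] i.lift_unlift[OF d] by (simp_all add: Dir_def)
      then show "d \<in> i.lift ` carrier (Dir X)" by (metis imageI)
    qed
  qed
  have sum: "dir_sum ?Y (i.lift d) (i.lift e) = map_option i.lift (dir_sum X d e)"
    if de: "d \<in> directions X" "e \<in> directions X" for d e
  proof (rule i.dir_sum_lift[OF de])
    obtain a b where ab: "a \<in> carrier A" "b \<in> carrier A" "d = dir_of a" "e = dir_of b"
      using de by (auto simp: directions_X)
    show "dir_zero X \<in> directions X" using ozero_closed by (auto simp: directions_X simp flip: dir_of_zero)
    show "dir_compl d \<in> directions X" using ab ocompl_closed by (auto simp: directions_X dir_compl_dir_of)
    assume sm: "\<exists>w z. dir_summable X d e w z"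
    then have "a \<oplus> b \<noteq> None" using dir_summable_imp(4)[OF ab(1,2)] ab(3,4) by blast
    then obtain s where "a \<oplus> b = Some s" by blast
    then show "\<exists>!h. \<exists>w z. dir_summable X d e w z \<and> direction X z h \<and> h w = Some (w, z)"
      using dir_summable_unique_value[OF ab(1,2)] sm ab(3,4) by simp
  qed
  show "orthoalgebra (Dir ?Y)" "ortho_isomorphic (Dir X) (Dir ?Y)"
    using orthoalgebra_transport[OF Dir_X(1)[OF proper_A] bij]
    by (simp_all add: Dir_def i.lift_zero i.lift_one i.lift_compl sum)
qed

end

theorem theorem6p4:
  fixes A :: "'a orthoalg"
  assumes "orthoalgebra A"
  shows "order_isomorphic (BSub_star A) (hypergraph_poset (hypergraph_of A)) \<and>
    (proper A \<longrightarrow>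
       orthoalgebra (Dir (BSub_star A)) \<and>
       orthoalgebra (Dir (hypergraph_poset (hypergraph_of A))) \<and>
       ortho_isomorphic A (Dir (BSub_star A)) \<and>
       ortho_isomorphic (Dir (BSub_star A)) (Dir (hypergraph_poset (hypergraph_of A))))"
proof -
  interpret orthoalgebra A by fact
  interpret i: order_iso X "hypergraph_poset (hypergraph_of A)" "atoms_below (BSub A)"
    by (rule order_iso_hypergraph_poset)
  have "order_emb X (hypergraph_poset (hypergraph_of A)) (atoms_below (BSub A))"
    unfolding order_emb_def
    using i.X.weak_partial_order_axioms i.Y.weak_partial_order_axioms i.le_iff by blast
  then show ?thesis
    unfolding order_isomorphic_def using i.bij Dir_X Dir_hypergraph_poset by blast
qed
end
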